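(* Let $n,m,q\ge 1$ be integers, let $g_k\in\{0,1\}^{n}$ be binary column vectors and $h_k\in\{0,1\}^{1\times(n+m)}$ be binary row vectors for $k\in\{1,\dots,q\}$, such that $\{g_1h_1,\dots,g_qh_q\}$ is a linearly independent set of real $n\times(n+m)$ matrices. Let $(A,B)=(A(p),B(p))$ be the matrix pair, with $A$ of size $n\times n$ and $B$ of size $n\times m$, parameterized by $p=(p_1,\dots,p_q)\in\mathbb{R}^q$ via $$[A(p)\;\;B(p)]=\sum_{k=1}^{q} g_k p_k h_k$$ (i.e. $(A,B)$ is a linearly parameterized matrix pair satisfying the binary assumption), and let $\mathbb{G}$ be the graph of $(A,B)$. The following statements are equivalent. (i) The pair $(A,B)$ is structurally controllable. (ii) The generic rank of $[A\;\;B]$ is $n$ and $(A,B)$ is irreducible. (iii) $\mathbb{G}$ has an unbalanced similarity class of multi-colored subgraphs, and $\mathbb{G}$ has a spanning subgraph which is a disjoint union of $m$ cactus graphs rooted at the $m$ vertices with labels $n+1$ to $n+m$, respectively. (iv) $\mathbb{G}$ has an unbalanced similarity class of multi-colored subgraphs, and $\mathbb{G}$ has a spanning forest rooted at the $m$ vertices with labels $n+1$ to $n+m$.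
   Context: **Algebraic notions.** $(A,B)$ is *structurally controllable* if there is $p\in\mathbb{R}^q$ such that $(A(p),B(p))$ is a controllable pair of real matrices. The *generic rank* of a matrix $M(p)$ is the maximum of $\operatorname{rank} M(p)$ over $p\in\mathbb{R}^q$. $(A,B)$ is *irreducible* if there is no $n\times n$ permutation matrix $\Pi$ (independent of $p$) and no integer $n_1$ with $1\le n_1\le n$ such that, identically in $p$, $$\Pi A\Pi^{-1}=\begin{bmatrix} A_1 & \mathbf 0 \\ A_2 & A_3 \end{bmatrix},\qquad \Pi B=\begin{bmatrix} \mathbf 0 \\ B_1 \end{bmatrix},$$ where $A_1$ is $n_1\times n_1$ and $B_1$ is $(n-n_1)\times m$ (for $n_1=n$ this says $B=\mathbf 0$). **Graph of $(A,B)$.** The directed graph $\mathbb{G}$ has vertices $1,\dots,n+m$ and, for each $k\in\{1,\dots,q\}$, an arc of color $k$ from vertex $j$ to vertex $i$, written $(j,i)_k$, whenever the $ij$th entry of $g_kh_k$ is nonzero. Self-loops, and several arcs of distinct colors from one vertex to another, are allowed. (No arc points toward the vertices $n+1,\dots,n+m$.) **Path graphs, cycle graphs.** A *path graph* is a directed graph whose distinct vertices can be labeled $1,\dots,k$ ($k\ge1$) so that its arcs are exactly $(i,i+1)$, $i=1,\dots,k-1$; $k=1$ gives an isolated vertex. A *cycle graph* is a directed graph whose distinct vertices can be labeled $1,\dots,k$ ($k\ge 1$) so that its arcs are exactly $(i,i+1)$, $i=1,\dots,k-1$, and $(k,1)$; $k=1$ gives a vertex with a single self-loop. A *disjoint union*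 of graphs is a union of graphs with pairwise disjoint vertex sets. A subgraph is *spanning* if it contains all vertices. **Spanning forest.** $\mathbb{G}$ has a *spanning forest rooted at* the vertices in a set $\mathcal{V}_{\rm root}$ if for each vertex $v\notin\mathcal{V}_{\rm root}$ there is a directed path in $\mathbb{G}$ to $v$ from some vertex of $\mathcal{V}_{\rm root}$. **Cactus graphs.** A *trunk* is a path graph with at least one vertex. A *bud* consists of a cycle graph with at least one vertex together with one additional arc, the bud's *stem*, which points to one of the cycle's vertices. A *cactus graph* is a weakly connected graph with exactly one trunk and any number ($\ge 0$) of buds (trunk and cycles having pairwise disjoint vertex sets), where the stem of each bud comes out of either a vertex of the trunk or a vertex of the cycle of another bud. It is rooted at the first vertex of its trunk, which is its unique root. **Multi-colored subgraphs.** A *multi-colored subgraph* of $\mathbb{G}$ is a spanning subgraph of $\mathbb{G}$ which is a disjoint union of $m$ path graphs and any number ($\ge0$) of cycle graphs, with all its arcs of pairwise different colors. It has $n$ arcs. Its *source* (resp. *sink* ) *vertices* are the $m$ first (resp. last) vertices of its path graphs (a path of length $0$ contributes the same vertex as both source and sink); the source vertices are always $n+1,\dots,n+m$. Two multi-colored subgraphs are *similar* if they have the same set of $m$ sink vertices and the same set of $n$ colors. Equivalence classes of this relation on the set of multi-colored subgraphs of $\mathbb{G}$ are called *similarity classes* (in particular they are nonempty). **Parity and balance.** Let $\mathbb{S}$ be a multi-colored subgraph with source vertex set $\mathcal{V}_{\rm source}$ and sink vertex set $\mathcal{V}_{\rm sink}$. A *matrimonial partition* $\pi$ for $\mathbb{S}$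 is a partition of the vertex set obtained by choosing a bijection between $\mathcal{V}_{\rm source}\setminus\mathcal{V}_{\rm sink}$ and $\mathcal{V}_{\rm sink}\setminus\mathcal{V}_{\rm source}$, making each matched pair a cell, and making each remaining vertex a singleton cell. The quotient graph $\mathbb{S}/\pi$ has one vertex for each cell, and exactly one arc from cell $i$ to cell $j$ ($i=j$ allowed) whenever $\mathbb{S}$ has at least one arc from a vertex in cell $i$ to a vertex in cell $j$; it is a disjoint union of cycle graphs and isolated vertices. For a given similarity class, one matrimonial partition $\pi$ (determined by the common sources and sinks) is fixed and used for all its members. A member $\mathbb{S}$ is *odd* (resp. *even* ) if $\mathbb{S}/\pi$ has an odd (resp. even) number of cycle graphs. The similarity class is *balanced* if it has equally many odd and even members, and *unbalanced* otherwise; this does not depend on the choice of $\pi$. *)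

theory Defs
  imports
    "Jordan_Normal_Form.DL_Rank"
    "Graph_Theory.Digraph_Component"
    "HOL-Library.Disjoint_Sets"
begin

text \<open>Matrix rows and columns, parameters, colors and vertices are all numbered from 0: vertex
  \<open>v\<close> here is the vertex labeled \<open>v + 1\<close> in the usual convention, so the vertices labeled
  \<open>n + 1, \<dots>, n + m\<close> are those in \<open>{n..<n + m}\<close>. A parameterized matrix is a function of a
  parameter vector, and only its values on \<open>carrier_vec q\<close> matter.\<close>

subsection \<open>Matrix pairs\<close>

abbreviation mat_rank :: "real mat \<Rightarrow> nat" where
  "mat_rank M \<equiv> vec_space.rank (dim_row M) M"

definition append_cols :: "real mat \<Rightarrow> real mat \<Rightarrow> real mat" (infixr "@\<^sub>c" 65) where
  "M @\<^sub>c N = four_block_mat M N (0\<^sub>m 0 (dim_col M)) (0\<^sub>m 0 (dim_col N))"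

text \<open>\<open>[B, A B, \<dots>, A^(n - 1) B]\<close>, where \<open>A\<close> is \<open>n \<times> n\<close>.\<close>

definition controllability_mat :: "real mat \<Rightarrow> real mat \<Rightarrow> real mat" where
  "controllability_mat A B =
     mat (dim_row A) (dim_row A * dim_col B)
       (\<lambda>(i, j). (A ^\<^sub>m (j div dim_col B) * B) $$ (i, j mod dim_col B))"

definition controllable :: "real mat \<Rightarrow> real mat \<Rightarrow> bool" where
  "controllable A B \<longleftrightarrow> mat_rank (controllability_mat A B) = dim_row A"

definition structurally_controllable ::
  "nat \<Rightarrow> (real vec \<Rightarrow> real mat) \<Rightarrow> (real vec \<Rightarrow> real mat) \<Rightarrow> bool" where
  "structurally_controllable q A B \<longleftrightarrow> (\<exists>p \<in> carrier_vec q. controllable (A p) (B p))"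

definition generic_rank :: "nat \<Rightarrow> (real vec \<Rightarrow> real mat) \<Rightarrow> nat" where
  "generic_rank q M = Max ((\<lambda>p. mat_rank (M p)) ` carrier_vec q)"

definition permutation_mat :: "nat \<Rightarrow> real mat \<Rightarrow> bool" where
  "permutation_mat n P \<longleftrightarrow>
     (\<exists>\<sigma>. \<sigma> permutes {..<n} \<and> P = mat n n (\<lambda>(i, j). if j = \<sigma> i then 1 else 0))"

definition irreducible_pair ::
  "nat \<Rightarrow> nat \<Rightarrow> nat \<Rightarrow> (real vec \<Rightarrow> real mat) \<Rightarrow> (real vec \<Rightarrow> real mat) \<Rightarrow> bool" where
  "irreducible_pair n m q A B \<longleftrightarrow>
     \<not> (\<exists>P P' n1. permutation_mat n P \<and>
          P' \<in> carrier_mat n n \<and> inverts_mat P P' \<and> inverts_mat P' P \<and>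
          1 \<le> n1 \<and> n1 \<le> n \<and>
          (\<forall>p \<in> carrier_vec q. \<exists>A1 A2 A3 B1.
             A1 \<in> carrier_mat n1 n1 \<and> A2 \<in> carrier_mat (n - n1) n1 \<and>
             A3 \<in> carrier_mat (n - n1) (n - n1) \<and> B1 \<in> carrier_mat (n - n1) m \<and>
             P * A p * P' = four_block_mat A1 (0\<^sub>m n1 (n - n1)) A2 A3 \<and>
             P * B p = 0\<^sub>m n1 m @\<^sub>r B1))"

text \<open>The column vectors \<open>g k\<close> are \<open>n \<times> 1\<close> matrices and the row vectors \<open>h k\<close> are
  \<open>1 \<times> (n + m)\<close> matrices.\<close>

definition linear_param ::
  "nat \<Rightarrow> nat \<Rightarrow> nat \<Rightarrow> (nat \<Rightarrow> real mat) \<Rightarrow> (nat \<Rightarrow> real mat) \<Rightarrow> real vec \<Rightarrow> real mat" where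
  "linear_param n m q g h p =
     mat n (n + m) (\<lambda>(i, j). \<Sum>k<q. p $ k * (g k * h k) $$ (i, j))"

definition linearly_independent_products ::
  "nat \<Rightarrow> nat \<Rightarrow> nat \<Rightarrow> (nat \<Rightarrow> real mat) \<Rightarrow> (nat \<Rightarrow> real mat) \<Rightarrow> bool" where
  "linearly_independent_products n m q g h \<longleftrightarrow>
     (\<forall>c \<in> carrier_vec q. linear_param n m q g h c = 0\<^sub>m n (n + m) \<longrightarrow> c = 0\<^sub>v q)"

subsection \<open>Colored graphs, path graphs, cycle graphs\<close>

text \<open>The triple \<open>(j, i, k)\<close> is the arc of color \<open>k\<close> from \<open>j\<close> to \<open>i\<close>.\<close>

type_synonym colored_arc = "nat \<times> nat \<times> nat"
type_synonym colored_graph = "(nat, colored_arc) pre_digraph"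

definition graph_of_pair ::
  "nat \<Rightarrow> nat \<Rightarrow> nat \<Rightarrow> (nat \<Rightarrow> real mat) \<Rightarrow> (nat \<Rightarrow> real mat) \<Rightarrow> colored_graph" where
  "graph_of_pair n m q g h =
     \<lparr> verts = {..<n + m},
       arcs = {(j, i, k). j < n + m \<and> i < n \<and> k < q \<and> (g k * h k) $$ (i, j) \<noteq> 0},
       tail = (\<lambda>(j, i, k). j),
       head = (\<lambda>(j, i, k). i) \<rparr>"

definition colors :: "colored_graph \<Rightarrow> nat set" where
  "colors S = (\<lambda>(j, i, k). k) ` arcs S"

text \<open>In the next two definitions injectivity of \<open>arc_to_ends\<close> excludes parallel arcs.\<close>

definition path_labeling :: "'a list \<Rightarrow> ('a, 'b) pre_digraph \<Rightarrow> bool" where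
  "path_labeling vs H \<longleftrightarrow> vs \<noteq> [] \<and> distinct vs \<and> verts H = set vs \<and>
     inj_on (arc_to_ends H) (arcs H) \<and>
     arcs_ends H = {(vs ! i, vs ! Suc i) | i. Suc i < length vs}"

definition cycle_labeling :: "'a list \<Rightarrow> ('a, 'b) pre_digraph \<Rightarrow> bool" where
  "cycle_labeling vs H \<longleftrightarrow> vs \<noteq> [] \<and> distinct vs \<and> verts H = set vs \<and>
     inj_on (arc_to_ends H) (arcs H) \<and>
     arcs_ends H = {(vs ! i, vs ! Suc i) | i. Suc i < length vs} \<union> {(last vs, hd vs)}"

definition path_graph :: "('a, 'b) pre_digraph \<Rightarrow> bool" where
  "path_graph H \<longleftrightarrow> (\<exists>vs. path_labeling vs H)"

definition cycle_graph :: "('a, 'b) pre_digraph \<Rightarrow> bool" where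
  "cycle_graph H \<longleftrightarrow> (\<exists>vs. cycle_labeling vs H)"

definition disjoint_graph_union ::
  "('a, 'b) pre_digraph \<Rightarrow> 'i set \<Rightarrow> ('i \<Rightarrow> ('a, 'b) pre_digraph) \<Rightarrow> bool" where
  "disjoint_graph_union S I H \<longleftrightarrow>
     (\<forall>i \<in> I. subgraph (H i) S) \<and> disjoint_family_on (\<lambda>i. verts (H i)) I \<and>
     verts S = (\<Union>i \<in> I. verts (H i)) \<and> arcs S = (\<Union>i \<in> I. arcs (H i))"

definition spanning_forest_rooted :: "('a, 'b) pre_digraph \<Rightarrow> 'a set \<Rightarrow> bool" where
  "spanning_forest_rooted G R \<longleftrightarrow> (\<forall>v \<in> verts G - R. \<exists>r \<in> R. r \<rightarrow>\<^sup>*\<^bsub>G\<^esub> v)"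

subsection \<open>Cactus graphs\<close>

text \<open>\<open>T\<close> is the trunk, \<open>Cs\<close> the set of cycles of the buds, and \<open>stem C\<close> the stem of the bud with
  cycle \<open>C\<close>. The name \<open>connected\<close> of the graph library (weak connectedness) is qualified because
  it is also a topological notion.\<close>

definition cactus_graph :: "'a \<Rightarrow> ('a, 'b) pre_digraph \<Rightarrow> bool" where
  "cactus_graph r H \<longleftrightarrow> Digraph_Component.connected H \<and>
     (\<exists>T vs Cs stem.
        subgraph T H \<and> path_labeling vs T \<and> hd vs = r \<and>
        finite Cs \<and> (\<forall>C \<in> Cs. subgraph C H \<and> cycle_graph C \<and> verts C \<inter> verts T = {}) \<and>
        disjoint_family_on verts Cs \<and>
        (\<forall>C \<in> Cs. stem C \<in> arcs H \<and> head H (stem C) \<in> verts C \<and>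
           tail H (stem C) \<in> verts T \<union> (\<Union>C' \<in> Cs - {C}. verts C')) \<and>
        verts H = verts T \<union> (\<Union>C \<in> Cs. verts C) \<and>
        arcs H = arcs T \<union> (\<Union>C \<in> Cs. arcs C) \<union> stem ` Cs)"

subsection \<open>Multi-colored subgraphs\<close>

definition path_cycle_decomposition ::
  "nat \<Rightarrow> ('a, 'b) pre_digraph \<Rightarrow> ('a, 'b) pre_digraph set \<Rightarrow> ('a, 'b) pre_digraph set \<Rightarrow> bool"
  where
  "path_cycle_decomposition m S Ps Cs \<longleftrightarrow>
     finite Ps \<and> card Ps = m \<and> (\<forall>H \<in> Ps. path_graph H) \<and>
     finite Cs \<and> (\<forall>H \<in> Cs. cycle_graph H) \<and>
     disjoint_graph_union S (Ps \<union> Cs) (\<lambda>H. H)"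

definition multi_colored_subgraph :: "nat \<Rightarrow> colored_graph \<Rightarrow> colored_graph \<Rightarrow> bool" where
  "multi_colored_subgraph m G S \<longleftrightarrow> spanning S G \<and>
     (\<exists>Ps Cs. path_cycle_decomposition m S Ps Cs) \<and>
     inj_on (\<lambda>(j, i, k). k) (arcs S)"

definition source_verts :: "nat \<Rightarrow> ('a, 'b) pre_digraph \<Rightarrow> 'a set" where
  "source_verts m S =
     {hd vs | vs P Ps Cs. path_cycle_decomposition m S Ps Cs \<and> P \<in> Ps \<and> path_labeling vs P}"

definition sink_verts :: "nat \<Rightarrow> ('a, 'b) pre_digraph \<Rightarrow> 'a set" where
  "sink_verts m S =
     {last vs | vs P Ps Cs. path_cycle_decomposition m S Ps Cs \<and> P \<in> Ps \<and> path_labeling vs P}"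

definition similarity :: "nat \<Rightarrow> colored_graph \<Rightarrow> (colored_graph \<times> colored_graph) set" where
  "similarity m G =
     {(S, S'). multi_colored_subgraph m G S \<and> multi_colored_subgraph m G S' \<and>
        sink_verts m S = sink_verts m S' \<and> colors S = colors S'}"

definition similarity_classes :: "nat \<Rightarrow> colored_graph \<Rightarrow> colored_graph set set" where
  "similarity_classes m G = {S. multi_colored_subgraph m G S} // similarity m G"

subsection \<open>Parity and balance\<close>

definition matrimonial_partition :: "nat \<Rightarrow> ('a, 'b) pre_digraph \<Rightarrow> 'a set set \<Rightarrow> bool" where
  "matrimonial_partition m S \<pi> \<longleftrightarrow>
     (let X = source_verts m S - sink_verts m S; Y = sink_verts m S - source_verts m S in
      \<exists>f. bij_betw f X Y \<and>
        \<pi> = (\<lambda>v. {v, f v}) ` X \<union> (\<lambda>v. {v}) ` (verts S - (X \<union> Y)))"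

definition quotient_graph ::
  "('a, 'b) pre_digraph \<Rightarrow> 'a set set \<Rightarrow> ('a set, 'a set \<times> 'a set) pre_digraph" where
  "quotient_graph S \<pi> =
     \<lparr> verts = \<pi>,
       arcs = {(c, d). c \<in> \<pi> \<and> d \<in> \<pi> \<and> (\<exists>e \<in> arcs S. tail S e \<in> c \<and> head S e \<in> d)},
       tail = fst,
       head = snd \<rparr>"

text \<open>In a disjoint union of cycle graphs and isolated vertices, the subgraphs that are cycle graphs
  are precisely the cycle graphs of that union.\<close>

definition num_cycle_graphs :: "('a, 'b) pre_digraph \<Rightarrow> nat" where
  "num_cycle_graphs Q = card {C. subgraph C Q \<and> cycle_graph C}"

definition odd_member :: "'a set set \<Rightarrow> ('a, 'b) pre_digraph \<Rightarrow> bool" where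
  "odd_member \<pi> S \<longleftrightarrow> odd (num_cycle_graphs (quotient_graph S \<pi>))"

definition even_member :: "'a set set \<Rightarrow> ('a, 'b) pre_digraph \<Rightarrow> bool" where
  "even_member \<pi> S \<longleftrightarrow> even (num_cycle_graphs (quotient_graph S \<pi>))"

text \<open>The one matrimonial partition fixed for all members of the similarity class \<open>K\<close>.\<close>

definition class_partition :: "nat \<Rightarrow> colored_graph set \<Rightarrow> nat set set" where
  "class_partition m K = (SOME \<pi>. \<forall>S \<in> K. matrimonial_partition m S \<pi>)"

definition balanced_class :: "nat \<Rightarrow> colored_graph set \<Rightarrow> bool" where
  "balanced_class m K \<longleftrightarrow>
     card {S \<in> K. odd_member (class_partition m K) S} =
     card {S \<in> K. even_member (class_partition m K) S}"

end

theory Submission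
  imports Defs "HOL-Computational_Algebra.Fundamental_Theorem_Algebra" "HOL-Combinatorics.Orbits"
begin

text \<open>If \<open>(A, B)\<close> is uncontrollable for every \<open>p\<close>, then every
  \<open>p\<close> has an uncontrollable eigenvalue. Since parameter \<open>p k\<close> enters
  with rank one, it acts as an output feedback, and the uncontrollable eigenvalues are zeros of a
  transfer function that does not involve \<open>p k\<close>. If all vertices are reachable from
  the inputs and the other parameters are positive, then this transfer function is not zero
  because \<open>g\<close> and \<open>h\<close> are nonnegative, so that one of its finitely many
  zeros is an uncontrollable eigenvalue for infinitely many, hence for all, values of \<open>p
  k\<close>. Releasing the parameters one after the other yields a number that is an
  uncontrollable eigenvalue for all \<open>p\<close>; by \<open>p = 0\<close> it is zero, so
  \<open>[A B]\<close> never has full row rank.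

  The \<open>n \<times> n\<close> minors of \<open>[A B]\<close> are combinations of squarefree
  monomials, again because of the rank-one structure. The coefficient of \<open>\<Prod>k\<in>C. p
  k\<close> in the minor that omits the columns in \<open>T\<close> is a signed count of the
  multi-colored subgraphs with color set \<open>C\<close> and sink set \<open>T\<close>.
  Identifying matched sources and sinks turns such a subgraph into a permutation of
  \<open>n\<close> points, whose sign is determined by its number of cycles. Thus the generic rank
  is \<open>n\<close> iff some similarity class is unbalanced.\<close>

subsection \<open>Full row rank and determinants\<close>

text \<open>The obstacle is that an uncontrollable eigenvalue may a priori vary with
  \<open>p\<close>. Freezing all parameters but one confines it to a finite root set, so by the
  pigeonhole principle a single value serves infinitely many settings of the freed parameter, and a
  polynomial vanishing infinitely often extends this to all settings. Finiteness of the root set is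
  always tested at strictly positive parameters, including those already released, since a mode
  valid for all their values is valid there; positivity excludes cancellation between walks from an
  input to the support of \<open>h k\<close>. The cactus condition is tied to the forest condition
  through a multi-colored subgraph, which an unbalanced class provides: its paths become the trunks
  and its cycles the buds. A walk from a root to an uncovered vertex must leave the covered set by
  an arc that enters a fresh cycle, and that arc becomes a stem. Stems may repeat colors. Row rank
  is phrased by left null vectors throughout, because the eigenvector test, the minors and the
  controllability matrix all speak about such vectors.\<close>

lemma det_mat_eq_0_iff:
  fixes f :: "nat \<times> nat \<Rightarrow> 'a :: field"
  shows "det (mat n n f) = 0 \<longleftrightarrow>
    (\<exists>v. (\<exists>i<n. v i \<noteq> 0) \<and> (\<forall>l<n. (\<Sum>i<n. v i * f (i, l)) = 0))"
proof -
  have prod: "row (transpose_mat (mat n n f)) l \<bullet> v = (\<Sum>i<n. v $ i * f (i, l))"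
    if "l < n" "v \<in> carrier_vec n" for v :: "'a vec" and l
    using that by (auto simp: scalar_prod_def atLeast0LessThan mult.commute intro!: sum.cong)
  have "det (mat n n f) = det (transpose_mat (mat n n f))"
    by (rule det_transpose[symmetric]) auto
  also have "\<dots> = 0 \<longleftrightarrow> (\<exists>v. v \<in> carrier_vec n \<and> v \<noteq> 0\<^sub>v n \<and>
      transpose_mat (mat n n f) *\<^sub>v v = 0\<^sub>v n)"
    by (rule det_0_iff_vec_prod_zero_field) auto
  also have "\<dots> \<longleftrightarrow> (\<exists>v. v \<in> carrier_vec n \<and> (\<exists>i<n. v $ i \<noteq> 0) \<and>
      (\<forall>l<n. (\<Sum>i<n. v $ i * f (i, l)) = 0))"
  proof (intro ex_cong1 conj_cong refl)
    fix v :: "'a vec" assume v: "v \<in> carrier_vec n"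
    show "v \<noteq> 0\<^sub>v n \<longleftrightarrow> (\<exists>i<n. v $ i \<noteq> 0)"
      using v by (auto simp: vec_eq_iff)
    show "transpose_mat (mat n n f) *\<^sub>v v = 0\<^sub>v n \<longleftrightarrow> (\<forall>l<n. (\<Sum>i<n. v $ i * f (i, l)) = 0)"
      using prod[OF _ v] by (auto simp: vec_eq_iff)
  qed
  also have "\<dots> \<longleftrightarrow> (\<exists>v. (\<exists>i<n. v i \<noteq> 0) \<and> (\<forall>l<n. (\<Sum>i<n. v i * f (i, l)) = 0))"
  proof
    assume "\<exists>v. v \<in> carrier_vec n \<and> (\<exists>i<n. v $ i \<noteq> 0) \<and> (\<forall>l<n. (\<Sum>i<n. v $ i * f (i, l)) = 0)"
    then obtain v where "\<exists>i<n. v $ i \<noteq> 0" "\<forall>l<n. (\<Sum>i<n. v $ i * f (i, l)) = 0" by blast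
    then show "\<exists>v. (\<exists>i<n. v i \<noteq> 0) \<and> (\<forall>l<n. (\<Sum>i<n. v i * f (i, l)) = 0)"
      by (intro exI[of _ "\<lambda>i. v $ i"] conjI)
  next
    assume "\<exists>v. (\<exists>i<n. v i \<noteq> 0) \<and> (\<forall>l<n. (\<Sum>i<n. v i * f (i, l)) = 0)"
    then obtain v where v: "\<exists>i<n. v i \<noteq> 0" "\<forall>l<n. (\<Sum>i<n. v i * f (i, l)) = 0" by blast
    have "(\<Sum>i<n. vec n v $ i * f (i, l)) = (\<Sum>i<n. v i * f (i, l))" for l
      by (rule sum.cong) simp_all
    moreover have "\<exists>i<n. vec n v $ i \<noteq> 0" using v(1) index_vec by metis
    ultimately show "\<exists>v. v \<in> carrier_vec n \<and> (\<exists>i<n. v $ i \<noteq> 0) \<and> (\<forall>l<n. (\<Sum>i<n. v $ i * f (i, l)) = 0)"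
      using v(2) by (intro exI[of _ "vec n v"] conjI) simp_all
  qed
  finally show ?thesis .
qed

lemma det_mat_eq_sum:
  "det (mat n n f) = (\<Sum>\<sigma> | \<sigma> permutes {..<n}. of_int (sign \<sigma>) * (\<Prod>i<n. f (i, \<sigma> i)))"
proof -
  have "(\<Prod>i<n. mat n n f $$ (i, \<sigma> i)) = (\<Prod>i<n. f (i, \<sigma> i))" if "\<sigma> permutes {..<n}" for \<sigma>
    using permutes_in_image[OF that] by (intro prod.cong) auto
  moreover have "det (mat n n f) =
      (\<Sum>\<sigma> | \<sigma> permutes {..<n}. of_int (sign \<sigma>) * (\<Prod>i<n. mat n n f $$ (i, \<sigma> i)))"
    using det_def'[of "mat n n f" n] by (simp add: atLeast0LessThan)
  ultimately show ?thesis by (auto intro!: sum.cong)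
qed

text \<open>Multilinearity in the rows: \<open>\<kappa> i\<close> is the summand chosen in row
  \<open>i\<close>. This is the Cauchy-Binet expansion before the non-injective choices, whose
  determinants have equal rows, are discarded.\<close>

lemma det_mat_sum_mult:
  fixes a b :: "nat \<Rightarrow> nat \<Rightarrow> 'a :: comm_ring_1"
  assumes "finite Q"
  shows "det (mat n n (\<lambda>(i, l). \<Sum>k\<in>Q. a i k * b k l)) =
    (\<Sum>\<kappa>\<in>{..<n} \<rightarrow>\<^sub>E Q. (\<Prod>i<n. a i (\<kappa> i)) * det (mat n n (\<lambda>(i, l). b (\<kappa> i) l)))"
proof -
  have "det (mat n n (\<lambda>(i, l). \<Sum>k\<in>Q. a i k * b k l)) =
    (\<Sum>\<sigma> | \<sigma> permutes {..<n}. \<Sum>\<kappa>\<in>{..<n} \<rightarrow>\<^sub>E Q.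
       of_int (sign \<sigma>) * ((\<Prod>i<n. a i (\<kappa> i)) * (\<Prod>i<n. b (\<kappa> i) (\<sigma> i))))"
    by (simp add: det_mat_eq_sum prod_sum_PiE assms sum_distrib_left prod.distrib)
  also have "\<dots> = (\<Sum>\<kappa>\<in>{..<n} \<rightarrow>\<^sub>E Q. \<Sum>\<sigma> | \<sigma> permutes {..<n}.
       of_int (sign \<sigma>) * ((\<Prod>i<n. a i (\<kappa> i)) * (\<Prod>i<n. b (\<kappa> i) (\<sigma> i))))"
    by (rule sum.swap)
  also have "\<dots> = (\<Sum>\<kappa>\<in>{..<n} \<rightarrow>\<^sub>E Q. (\<Prod>i<n. a i (\<kappa> i)) * det (mat n n (\<lambda>(i, l). b (\<kappa> i) l)))"
    by (simp add: det_mat_eq_sum sum_distrib_left ac_simps)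
  finally show ?thesis .
qed

lemma det_mat_eq_0_if_rows_eq:
  fixes f :: "nat \<times> nat \<Rightarrow> 'a :: comm_ring_1"
  assumes "i < n" "j < n" "i \<noteq> j" "\<And>l. l < n \<Longrightarrow> f (i, l) = f (j, l)"
  shows "det (mat n n f) = 0"
  by (rule det_identical_rows[of _ n i j]) (use assms in auto)

text \<open>The field is left general because the data are real while eigenvectors are complex.
  Plain functions replace matrices, so only their values on the relevant indices matter.\<close>

definition full_row_rank :: "nat \<Rightarrow> nat \<Rightarrow> (nat \<Rightarrow> nat \<Rightarrow> 'a :: field) \<Rightarrow> bool" where
  "full_row_rank n c M \<longleftrightarrow>
     (\<forall>v. (\<forall>j<c. (\<Sum>i<n. v i * M i j) = 0) \<longrightarrow> (\<forall>i<n. v i = 0))"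

lemma full_row_rankD:
  "\<lbrakk>full_row_rank n c M; \<And>j. j < c \<Longrightarrow> (\<Sum>i<n. v i * M i j) = 0; i < n\<rbrakk> \<Longrightarrow> v i = 0"
  unfolding full_row_rank_def by blast

lemma full_row_rankI:
  "(\<And>v i. \<lbrakk>\<And>j. j < c \<Longrightarrow> (\<Sum>i<n. v i * M i j) = 0; i < n\<rbrakk> \<Longrightarrow> v i = 0) \<Longrightarrow> full_row_rank n c M"
  unfolding full_row_rank_def by blast

lemma det_transpose_mat: "det (mat n n (\<lambda>(i, j). f j i)) = det (mat n n (\<lambda>(i, j). f i j))"
proof -
  have "mat n n (\<lambda>(i, j). f j i) = transpose_mat (mat n n (\<lambda>(i, j). f i j))"
    by (rule eq_matI) auto
  then show ?thesis by (simp only:) (rule det_transpose, rule mat_carrier)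
qed

text \<open>If \<open>v\<close> annihilates the Gram matrix, then \<open>w = v M\<close> has squared
  norm zero; the conjugation supplies this definiteness over the complex numbers. The point is to
  replace full row rank by the nonvanishing of one determinant.\<close>

lemma full_row_rank_complex_gram:
  fixes M :: "nat \<Rightarrow> nat \<Rightarrow> complex"
  assumes "full_row_rank n c M"
  shows "det (mat n n (\<lambda>(i, l). \<Sum>k<c. M i k * cnj (M l k))) \<noteq> 0"
proof
  assume "det (mat n n (\<lambda>(i, l). \<Sum>k<c. M i k * cnj (M l k))) = 0"
  then obtain v i0 where v: "\<And>l. l < n \<Longrightarrow> (\<Sum>i<n. v i * (\<Sum>k<c. M i k * cnj (M l k))) = 0"
    and i0: "i0 < n" "v i0 \<noteq> 0"
    unfolding det_mat_eq_0_iff by auto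
  define w where "w = (\<lambda>k. \<Sum>i<n. v i * M i k)"
  have w: "(\<Sum>k<c. w k * cnj (M l k)) = 0" if "l < n" for l
  proof -
    have "(\<Sum>k<c. w k * cnj (M l k)) = (\<Sum>k<c. \<Sum>i<n. v i * (M i k * cnj (M l k)))"
      by (simp only: w_def sum_distrib_right mult.assoc)
    also have "\<dots> = (\<Sum>i<n. v i * (\<Sum>k<c. M i k * cnj (M l k)))"
      by (subst sum.swap) (simp add: sum_distrib_left)
    finally show ?thesis using v[OF that] by simp
  qed
  have "(\<Sum>k<c. w k * cnj (w k)) = (\<Sum>k<c. \<Sum>l<n. cnj (v l) * (w k * cnj (M l k)))"
    by (subst (2) w_def) (simp add: sum_distrib_left ac_simps)
  also have "\<dots> = (\<Sum>l<n. cnj (v l) * (\<Sum>k<c. w k * cnj (M l k)))"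
    by (subst sum.swap) (simp add: sum_distrib_left)
  also have "\<dots> = 0" using w by simp
  finally have "complex_of_real (\<Sum>k<c. (cmod (w k))\<^sup>2) = 0"
    by (simp only: of_real_sum complex_norm_square)
  then have "(\<Sum>k<c. (cmod (w k))\<^sup>2) = 0" by (simp only: of_real_eq_0_iff)
  then have "w k = 0" if "k < c" for k
    using that by (subst (asm) sum_nonneg_eq_0_iff) auto
  then have "(\<Sum>i<n. v i * M i k) = 0" if "k < c" for k using that by (simp add: w_def)
  from full_row_rankD[OF assms this i0(1)] have "v i0 = 0" .
  with i0 show False by blast
qed

text \<open>The real and imaginary parts of a complex left null vector of a real matrix are again
  left null vectors.\<close>

lemma full_row_rank_of_real:
  fixes M :: "nat \<Rightarrow> nat \<Rightarrow> real"
  shows "full_row_rank n c (\<lambda>i j. complex_of_real (M i j)) \<longleftrightarrow> full_row_rank n c M"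
proof
  assume *: "full_row_rank n c (\<lambda>i j. complex_of_real (M i j))"
  show "full_row_rank n c M"
  proof (rule full_row_rankI)
    fix v :: "nat \<Rightarrow> real" and i
    assume v: "\<And>j. j < c \<Longrightarrow> (\<Sum>i<n. v i * M i j) = 0" and i: "i < n"
    have "(\<Sum>i<n. complex_of_real (v i) * complex_of_real (M i j)) = 0" if "j < c" for j
      using v[OF that] by (simp flip: of_real_mult of_real_sum)
    from full_row_rankD[OF * this i] show "v i = 0" by simp
  qed
next
  assume *: "full_row_rank n c M"
  show "full_row_rank n c (\<lambda>i j. complex_of_real (M i j))"
  proof (rule full_row_rankI)
    fix v :: "nat \<Rightarrow> complex" and i
    assume v: "\<And>j. j < c \<Longrightarrow> (\<Sum>i<n. v i * complex_of_real (M i j)) = 0" and i: "i < n"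
    have "(\<Sum>i<n. Re (v i) * M i j) = Re (\<Sum>i<n. v i * complex_of_real (M i j))"
      "(\<Sum>i<n. Im (v i) * M i j) = Im (\<Sum>i<n. v i * complex_of_real (M i j))" for j
      by simp_all
    then have "(\<Sum>i<n. Re (v i) * M i j) = 0" "(\<Sum>i<n. Im (v i) * M i j) = 0" if "j < c" for j
      using v[OF that] by (simp_all only: zero_complex.sel)
    from full_row_rankD[OF * this(1) i] full_row_rankD[OF * this(2) i]
    show "v i = 0" by (simp add: complex_eq_iff)
  qed
qed

text \<open>The Gram determinant expands over all choices \<open>\<kappa>\<close> of columns, each
  term containing the minor with these columns as a factor, so some minor survives. The passage
  through the complex numbers only serves to reuse the Gram lemma.\<close>

lemma full_row_rank_imp_nonzero_minor:
  fixes M :: "nat \<Rightarrow> nat \<Rightarrow> real"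
  assumes "full_row_rank n c M"
  shows "\<exists>\<kappa> \<in> {..<n} \<rightarrow>\<^sub>E {..<c}. det (mat n n (\<lambda>(i, l). M i (\<kappa> l))) \<noteq> 0"
proof -
  have "full_row_rank n c (\<lambda>i j. complex_of_real (M i j))"
    using assms by (simp add: full_row_rank_of_real)
  from full_row_rank_complex_gram[OF this]
  have "det (mat n n (\<lambda>(i, l). \<Sum>k<c. complex_of_real (M i k) * complex_of_real (M l k))) \<noteq> 0"
    by simp
  also have "mat n n (\<lambda>(i, l). \<Sum>k<c. complex_of_real (M i k) * complex_of_real (M l k)) =
      map_mat complex_of_real (mat n n (\<lambda>(i, l). \<Sum>k<c. M i k * M l k))"
    by (intro eq_matI) auto
  finally have "det (mat n n (\<lambda>(i, l). \<Sum>k<c. M i k * M l k)) \<noteq> 0"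
    by (simp add: of_real_hom.hom_det)
  then have "(\<Sum>\<kappa>\<in>{..<n} \<rightarrow>\<^sub>E {..<c}. (\<Prod>i<n. M i (\<kappa> i)) * det (mat n n (\<lambda>(i, l). M l (\<kappa> i)))) \<noteq> 0"
    by (subst (asm) det_mat_sum_mult) auto
  then obtain \<kappa> where "\<kappa> \<in> {..<n} \<rightarrow>\<^sub>E {..<c}" "det (mat n n (\<lambda>(i, l). M l (\<kappa> i))) \<noteq> 0"
    by (rule sum.not_neutral_contains_not_neutral) auto
  moreover have "det (mat n n (\<lambda>(i, l). M l (\<kappa> i))) = det (mat n n (\<lambda>(i, l). M i (\<kappa> l)))"
    by (rule det_transpose_mat)
  ultimately show ?thesis by metis
qed

lemma nonzero_minor_imp_full_row_rank:
  fixes M :: "nat \<Rightarrow> nat \<Rightarrow> 'a :: field"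
  assumes "\<And>l. l < n \<Longrightarrow> \<kappa> l < c" "det (mat n n (\<lambda>(i, l). M i (\<kappa> l))) \<noteq> 0"
  shows "full_row_rank n c M"
  using assms unfolding det_mat_eq_0_iff full_row_rank_def by auto

section \<open>Column rank of a real matrix and full row rank\<close>

lemma (in vec_space) ex_maximal_lin_indpt_cols:
  "\<exists>S. finite S \<and> maximal S (\<lambda>T. T \<subseteq> set (cols M) \<and> lin_indpt T)"
proof -
  have "lin_indpt {}" by (rule finite_lin_indpt2) auto
  then show ?thesis
    using maximal_exists_superset[of "set (cols M)" "\<lambda>T. T \<subseteq> set (cols M) \<and> lin_indpt T" "{}"]
    by blast
qed

lemma mat_rank_le: "M \<in> carrier_mat n c \<Longrightarrow> mat_rank M \<le> n"
proof -
  assume M: "M \<in> carrier_mat n c"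
  interpret vec_space "TYPE(real)" n .
  obtain S where S: "maximal S (\<lambda>T. T \<subseteq> set (cols M) \<and> lin_indpt T)"
    using ex_maximal_lin_indpt_cols by blast
  have "card S \<le> n"
    using S M cols_dim[of M] li_le_dim(2)[of S] unfolding maximal_def by (auto simp: dim_is_n)
  then show "mat_rank M \<le> n"
    using rank_card_indpt[OF M S] M by simp
qed

text \<open>Both notions are compared through an invertible square matrix of selected columns: a
  maximal independent set of columns in one direction, a nonzero minor in the other.\<close>

lemma mat_rank_eq_iff_full_row_rank:
  assumes M: "M \<in> carrier_mat n c"
  shows "mat_rank M = n \<longleftrightarrow> full_row_rank n c (\<lambda>i j. M $$ (i, j))"
proof -
  interpret vec_space "TYPE(real)" n .
  show ?thesis
  proof
    assume "mat_rank M = n"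
    then have r: "rank M = n" using M by simp
    obtain S where S: "maximal S (\<lambda>T. T \<subseteq> set (cols M) \<and> lin_indpt T)" "finite S"
      using ex_maximal_lin_indpt_cols by blast
    then have cS: "card S = n" and SM: "S \<subseteq> set (cols M)" and li: "lin_indpt S"
      using rank_card_indpt[OF M] r by (auto simp: maximal_def)
    obtain ss where ss: "set ss = S" "distinct ss" using finite_distinct_list S(2) by blast
    with cS have len: "length ss = n" using distinct_card by fastforce
    have ssc: "set ss \<subseteq> carrier_vec n" using ss SM M cols_dim[of M] by auto
    define N where "N = mat_of_cols n ss"
    have N: "N \<in> carrier_mat n n" "cols N = ss"
      using len ssc by (auto simp: N_def cols_mat_of_cols)
    have "rank N = n" by (rule lin_indpt_full_rank[OF N(1)]) (use N ss li in auto)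
    then have det: "det N \<noteq> 0" using det_rank_iff[OF N(1)] by simp
    have "ss ! l \<in> set (cols M)" if "l < n" for l
      using that len ss SM nth_mem by blast
    then have "\<exists>j<c. ss ! l = col M j" if "l < n" for l
      using that M by (force simp: cols_def)
    then obtain \<kappa> where \<kappa>: "\<And>l. l < n \<Longrightarrow> \<kappa> l < c \<and> ss ! l = col M (\<kappa> l)" by metis
    have "N = mat n n (\<lambda>(i, l). M $$ (i, \<kappa> l))"
      by (rule eq_matI) (use \<kappa> len M in \<open>auto simp: N_def mat_of_cols_index\<close>)
    with det have "det (mat n n (\<lambda>(i, l). M $$ (i, \<kappa> l))) \<noteq> 0" by simp
    then show "full_row_rank n c (\<lambda>i j. M $$ (i, j))"
      using nonzero_minor_imp_full_row_rank[of n \<kappa> c "\<lambda>i j. M $$ (i, j)"] \<kappa> by blast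
  next
    assume "full_row_rank n c (\<lambda>i j. M $$ (i, j))"
    from full_row_rank_imp_nonzero_minor[OF this] obtain \<kappa> where
      \<kappa>: "\<kappa> \<in> {..<n} \<rightarrow>\<^sub>E {..<c}" "det (mat n n (\<lambda>(i, l). M $$ (i, \<kappa> l))) \<noteq> 0" by blast
    define N where "N = mat n n (\<lambda>(i, l). M $$ (i, \<kappa> l))"
    have N: "N \<in> carrier_mat n n" by (simp add: N_def)
    have rN: "rank N = n"
      using \<kappa>(2) det_rank_iff[OF N] by (simp add: N_def)
    \<comment> \<open>\<open>rank\<close> counts independent sets of columns, so the selected
      columns must be pairwise distinct to contribute \<open>n\<close>.\<close>
    have d: "distinct (cols N)"
    proof (rule ccontr)
      assume "\<not> distinct (cols N)"
      from non_distinct_low_rank[OF N this] rN show False by simp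
    qed
    have "col N l \<in> set (cols M)" if "l < n" for l
    proof -
      have "\<kappa> l < c" using \<kappa>(1) that by auto
      moreover have "col N l = col M (\<kappa> l)"
        by (rule eq_vecI) (use that \<open>\<kappa> l < c\<close> M in \<open>auto simp: N_def\<close>)
      ultimately show ?thesis using M by (auto simp: cols_def)
    qed
    then have sub: "set (cols N) \<subseteq> set (cols M)" using N by (auto simp: cols_def)
    have "card (set (cols N)) \<le> rank M"
      by (rule rank_ge_card_indpt[OF M sub full_rank_lin_indpt[OF N rN d]])
    moreover have "card (set (cols N)) = n" using d N by (simp add: distinct_card)
    ultimately show "mat_rank M = n" using mat_rank_le[OF M] M by simp
  qed
qed

subsection \<open>Uncontrollable modes of a rank-one parameterization\<close>

text \<open>Entry functions of the vectors \<open>g k\<close> and \<open>h k\<close>. The values 0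
  and 1 give nonnegativity for the transfer functions and unit weights for the signed count;
  \<open>gh_nonzero\<close> is what linear independence yields for a single product.\<close>

locale rank_one_param =
  fixes n m q :: nat and g h :: "nat \<Rightarrow> nat \<Rightarrow> real"
  assumes g_01: "\<And>k i. \<lbrakk>k < q; i < n\<rbrakk> \<Longrightarrow> g k i = 0 \<or> g k i = 1"
    and h_01: "\<And>k j. \<lbrakk>k < q; j < n + m\<rbrakk> \<Longrightarrow> h k j = 0 \<or> h k j = 1"
    and gh_nonzero: "\<And>k. k < q \<Longrightarrow> \<exists>i<n. \<exists>j<n + m. g k i * h k j \<noteq> 0"
begin

definition M :: "(nat \<Rightarrow> real) \<Rightarrow> nat \<Rightarrow> nat \<Rightarrow> real" where
  "M p i j = (\<Sum>k<q. p k * g k i * h k j)"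

definition adj :: "(nat \<times> nat) set" where
  "adj = {(j, i). j < n + m \<and> i < n \<and> (\<exists>k<q. g k i * h k j \<noteq> 0)}"

definition all_reachable :: bool where
  "all_reachable \<longleftrightarrow> (\<forall>i<n. \<exists>l<m. (n + l, i) \<in> adj\<^sup>*)"

text \<open>This is \<open>[\<mu> I - A, - B]\<close>: for a row index \<open>i < n\<close>, the
  case \<open>i = j\<close> cannot occur in the columns of \<open>B\<close>.\<close>

definition pencil :: "complex \<Rightarrow> (nat \<Rightarrow> real) \<Rightarrow> nat \<Rightarrow> nat \<Rightarrow> complex" where
  "pencil \<mu> p i j = (if i = j then \<mu> else 0) - of_real (M p i j)"

text \<open>By the Popov--Belevitch--Hautus test, these are the uncontrollable eigenvalues at
  \<open>p\<close>.\<close>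

definition uncontrollable_mode :: "complex \<Rightarrow> (nat \<Rightarrow> real) \<Rightarrow> bool" where
  "uncontrollable_mode \<mu> p \<longleftrightarrow> \<not> full_row_rank n (n + m) (pencil \<mu> p)"

lemma M_cong: "(\<And>k. k < q \<Longrightarrow> p k = p' k) \<Longrightarrow> M p = M p'"
  by (intro ext) (simp add: M_def)

lemma uncontrollable_mode_cong:
  "(\<And>k. k < q \<Longrightarrow> p k = p' k) \<Longrightarrow> uncontrollable_mode \<mu> p = uncontrollable_mode \<mu> p'"
  using M_cong[of p p'] by (simp add: uncontrollable_mode_def pencil_def[abs_def])

lemma M_upd: "k < q \<Longrightarrow> M (p(k := y)) i j = M (p(k := 0)) i j + y * g k i * h k j"
  unfolding M_def by (simp add: sum.remove[of "{..<q}" k])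

lemma sum_pencil:
  "(\<Sum>i<n. v i * pencil \<mu> p i j) =
     (if j < n then \<mu> * v j else 0) - (\<Sum>i<n. v i * of_real (M p i j))"
proof -
  have "(\<Sum>i<n. v i * pencil \<mu> p i j) =
      (\<Sum>i<n. if i = j then \<mu> * v i else 0) - (\<Sum>i<n. v i * of_real (M p i j))"
    unfolding sum_subtractf[symmetric] by (rule sum.cong) (auto simp: pencil_def algebra_simps)
  then show ?thesis by (simp add: sum.delta)
qed

text \<open>Splitting the columns of the pencil at \<open>n\<close> separates the left eigenvector
  equation for \<open>A\<close> from the orthogonality of \<open>v\<close> to
  \<open>B\<close>.\<close>

lemma uncontrollable_mode_iff:
  "uncontrollable_mode \<mu> p \<longleftrightarrow>
    (\<exists>v. (\<exists>i<n. v i \<noteq> 0) \<and>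
      (\<forall>j<n + m. (\<Sum>i<n. v i * of_real (M p i j)) = (if j < n then \<mu> * v j else 0)))"
proof -
  have "(\<Sum>i<n. v i * of_real (M p i j)) = (if j < n then \<mu> * v j else 0) \<longleftrightarrow>
      (\<Sum>i<n. v i * pencil \<mu> p i j) = 0" for v j
    unfolding sum_pencil by auto
  then show ?thesis
    unfolding uncontrollable_mode_def full_row_rank_def by simp blast
qed

lemma comm_ring_hom_poly: "comm_ring_hom (\<lambda>p. poly p x)"
  by unfold_locales auto

text \<open>A determinant that is polynomial in the value \<open>y\<close> of parameter
  \<open>k\<close> vanishes at every \<open>y\<close> with mode \<open>\<mu>\<close>, hence
  identically, whereas it would be nonzero at \<open>y = z\<close> if the pencil had full row rank
  there.\<close>

lemma uncontrollable_mode_line: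
  assumes k: "k < q" and inf: "infinite {y. uncontrollable_mode \<mu> (p(k := y))}"
  shows "uncontrollable_mode \<mu> (p(k := z))"
proof (rule ccontr)
  assume "\<not> uncontrollable_mode \<mu> (p(k := z))"
  then have full: "full_row_rank n (n + m) (pencil \<mu> (p(k := z)))"
    by (simp add: uncontrollable_mode_def)
  \<comment> \<open>Freezing the conjugated factor at \<open>z\<close> leaves products affine in
    \<open>y\<close> and avoids conjugating a polynomial variable; at \<open>y = z\<close> the Gram
    determinant reappears.\<close>
  define C where "C = (\<lambda>l j. cnj (pencil \<mu> (p(k := z)) l j))"
  define P where "P = (\<lambda>i j. [:pencil \<mu> (p(k := 0)) i j, - complex_of_real (g k i * h k j):])"
  have P: "poly (P i j) (of_real y) = pencil \<mu> (p(k := y)) i j" for i j y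
    by (simp add: P_def pencil_def M_upd[OF k, of p y] algebra_simps)
  define D where "D = det (mat n n (\<lambda>(i, l). \<Sum>j<n + m. P i j * [:C l j:]))"
  have D: "poly D (of_real y) = det (mat n n (\<lambda>(i, l). \<Sum>j<n + m. pencil \<mu> (p(k := y)) i j * C l j))" for y
    unfolding D_def comm_ring_hom.hom_det[OF comm_ring_hom_poly, symmetric]
    by (rule arg_cong[of _ _ det], rule eq_matI) (auto simp: poly_sum P algebra_simps)
  have "poly D (of_real z) \<noteq> 0"
    unfolding D C_def using full_row_rank_complex_gram[OF full] .
  then have "finite {y. poly D y = 0}" by (intro poly_roots_finite) auto
  then have "finite (complex_of_real -` {y. poly D y = 0})"
    by (rule finite_vimageI) (simp add: inj_of_real)
  moreover have "{y. uncontrollable_mode \<mu> (p(k := y))} \<subseteq> complex_of_real -` {y. poly D y = 0}"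
  proof clarsimp
    fix y assume "uncontrollable_mode \<mu> (p(k := y))"
    then obtain v i0 where v: "i0 < n" "v i0 \<noteq> 0"
      "\<And>j. j < n + m \<Longrightarrow> (\<Sum>i<n. v i * pencil \<mu> (p(k := y)) i j) = 0"
      unfolding uncontrollable_mode_def full_row_rank_def by auto
    have "(\<Sum>i<n. v i * (\<Sum>j<n + m. pencil \<mu> (p(k := y)) i j * C l j)) = 0" for l
    proof -
      have "(\<Sum>i<n. v i * (\<Sum>j<n + m. pencil \<mu> (p(k := y)) i j * C l j)) =
          (\<Sum>i<n. \<Sum>j<n + m. v i * pencil \<mu> (p(k := y)) i j * C l j)"
        by (simp only: sum_distrib_left mult.assoc)
      also have "\<dots> = (\<Sum>j<n + m. (\<Sum>i<n. v i * pencil \<mu> (p(k := y)) i j) * C l j)"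
        by (subst sum.swap) (simp only: sum_distrib_right)
      also have "\<dots> = 0" by (simp add: v(3))
      finally show ?thesis .
    qed
    then show "poly D (complex_of_real y) = 0"
      unfolding D det_mat_eq_0_iff using v(1,2) by auto
  qed
  ultimately have "finite {y. uncontrollable_mode \<mu> (p(k := y))}" by (rule rev_finite_subset)
  with inf show False by blast
qed

text \<open>The transfer function from the \<open>l\<close>-th input to the output \<open>h
  k\<close> of the system with \<open>p k = 0\<close> is, up to its denominator, this determinant.
  It does not involve \<open>p k\<close>, and closing the loop through \<open>p k\<close> does not
  change its numerator, so that it vanishes at the uncontrollable modes.\<close>

definition border :: "nat \<Rightarrow> nat \<Rightarrow> (nat \<Rightarrow> real) \<Rightarrow> 'b :: comm_ring_1 \<Rightarrow> (real \<Rightarrow> 'b) \<Rightarrow> nat \<times> nat \<Rightarrow> 'b" where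
  "border k l p s c = (\<lambda>(i, j). let j' = if j < n then j else n + l in
     if i < n then (if i = j then s else 0) - c (M (p(k := 0)) i j') else c (h k j'))"

text \<open>\<open>border\<close> is polymorphic in the ring: here its entries are polynomials in
  the variable \<open>[:0, 1:]\<close>, elsewhere the same matrix is used with complex or real
  \<open>s\<close>.\<close>

definition transfer_poly :: "nat \<Rightarrow> nat \<Rightarrow> (nat \<Rightarrow> real) \<Rightarrow> complex poly" where
  "transfer_poly k l p = det (mat (Suc n) (Suc n) (border k l p [:0, 1:] (\<lambda>x. [:of_real x:])))"

lemma poly_transfer_poly:
  "poly (transfer_poly k l p) s = det (mat (Suc n) (Suc n) (border k l p s of_real))"
  unfolding transfer_poly_def comm_ring_hom.hom_det[OF comm_ring_hom_poly, symmetric]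
  by (rule arg_cong[of _ _ det], rule eq_matI) (auto simp: border_def Let_def)

lemma transfer_poly_upd: "transfer_poly k l (p(k := y)) = transfer_poly k l p"
  unfolding transfer_poly_def border_def fun_upd_upd ..

text \<open>Closing the loop through parameter \<open>k\<close> adds \<open>c\<close> times the row
  \<open>h k\<close> to the product of \<open>v\<close> with \<open>M (p(k := 0))\<close>, where
  \<open>c\<close> is the weight of \<open>v\<close> on \<open>p k * g k\<close>. Appending
  \<open>- c\<close> to \<open>v\<close> cancels this against the last row of the bordered matrix
  and gives a left null vector.\<close>

lemma uncontrollable_mode_imp_transfer_root:
  assumes "uncontrollable_mode \<mu> p" and k: "k < q" and l: "l < m"
  shows "poly (transfer_poly k l p) \<mu> = 0"
proof -
  obtain v i0 where i0: "i0 < n" "v i0 \<noteq> 0" and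
    v: "\<And>j. j < n + m \<Longrightarrow> (\<Sum>i<n. v i * of_real (M p i j)) = (if j < n then \<mu> * v j else 0)"
    using assms(1) unfolding uncontrollable_mode_iff by auto
  define c where "c = (\<Sum>i<n. v i * of_real (p k * g k i))"
  define w where "w = (\<lambda>i. if i < n then v i else - c)"
  have vM: "(\<Sum>i<n. v i * of_real (M (p(k := 0)) i j)) =
      (\<Sum>i<n. v i * of_real (M p i j)) - c * of_real (h k j)" for j
  proof -
    have "v i * of_real (M (p(k := 0)) i j) =
        v i * of_real (M p i j) - v i * of_real (p k * g k i) * of_real (h k j)" for i
      using M_upd[OF k, of p "p k" i j] by (simp add: algebra_simps)
    then show ?thesis by (simp only: c_def sum_distrib_right sum_subtractf)
  qed
  have "(\<Sum>i<Suc n. w i * border k l p \<mu> of_real (i, j)) = 0" if j: "j < Suc n" for j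
  proof -
    \<comment> \<open>The last column of the bordered matrix stands for the input vertex
      \<open>n + l\<close>.\<close>
    define j' where "j' = (if j < n then j else n + l)"
    have j': "j' < n + m" using l by (auto simp: j'_def)
    have "(\<Sum>i<Suc n. w i * border k l p \<mu> of_real (i, j)) =
        (\<Sum>i<n. v i * ((if i = j then \<mu> else 0) - of_real (M (p(k := 0)) i j'))) - c * of_real (h k j')"
      by (simp add: w_def border_def Let_def j'_def)
    also have "(\<Sum>i<n. v i * ((if i = j then \<mu> else 0) - of_real (M (p(k := 0)) i j'))) =
        (\<Sum>i<n. if i = j then \<mu> * v i else 0) - (\<Sum>i<n. v i * of_real (M (p(k := 0)) i j'))"
      unfolding sum_subtractf[symmetric] by (rule sum.cong) (auto simp: algebra_simps)
    also have "(\<Sum>i<n. if i = j then \<mu> * v i else 0) = (if j' < n then \<mu> * v j' else 0)"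
      by (simp add: sum.delta j'_def)
    finally show ?thesis unfolding vM v[OF j'] by simp
  qed
  moreover have "i0 < Suc n" "w i0 \<noteq> 0" using i0 by (auto simp: w_def)
  ultimately show ?thesis
    unfolding poly_transfer_poly det_mat_eq_0_iff by blast
qed

section \<open>Positivity of transfer functions\<close>

lemma M_nonneg:
  assumes "\<And>k. k < q \<Longrightarrow> p k \<ge> 0" "i < n" "j < n + m"
  shows "M p i j \<ge> 0"
  unfolding M_def
proof (rule sum_nonneg)
  fix k assume "k \<in> {..<q}"
  then show "0 \<le> p k * g k i * h k j"
    using assms g_01[of k i] h_01[of k j] by auto
qed

lemma M_pos:
  assumes "\<And>k. k < q \<Longrightarrow> p k \<ge> 0" "i < n" "j < n + m" "k < q" "p k > 0" "g k i * h k j \<noteq> 0"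
  shows "M p i j > 0"
  unfolding M_def
proof (rule sum_pos2[of _ k])
  show "0 < p k * g k i * h k j"
    using assms g_01[of k i] h_01[of k j] by auto
  show "0 \<le> p k' * g k' i * h k' j" if "k' \<in> {..<q}" for k'
    using that assms(1)[of k'] assms(2,3) g_01[of k' i] h_01[of k' j] by auto
qed (use assms in auto)

text \<open>For large real \<open>s\<close> the response \<open>(s I - A)\<^sup>-\<^sup>1
  b\<close> of a nonnegative system is nonnegative, by a minimum principle.\<close>

lemma nonneg_response:
  fixes N :: "nat \<Rightarrow> nat \<Rightarrow> real" and x b :: "nat \<Rightarrow> real"
  assumes N: "\<And>i j. \<lbrakk>i < n; j < n\<rbrakk> \<Longrightarrow> N i j \<ge> 0" and b: "\<And>i. i < n \<Longrightarrow> b i \<ge> 0"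
    and s: "\<And>i. i < n \<Longrightarrow> (\<Sum>j<n. N i j) < s"
    and x: "\<And>i. i < n \<Longrightarrow> s * x i = (\<Sum>j<n. N i j * x j) + b i"
    and i: "i < n"
  shows "x i \<ge> 0"
proof -
  define i0 where "i0 = arg_min_on x {..<n}"
  have ne: "finite {..<n}" "{..<n} \<noteq> {}" using i by auto
  have i0: "i0 < n" and min: "\<And>j. j < n \<Longrightarrow> x i0 \<le> x j"
    using arg_min_if_finite[OF ne, of x] unfolding i0_def by (auto simp: not_less)
  have "(\<Sum>j<n. N i0 j) * x i0 \<le> (\<Sum>j<n. N i0 j * x j)"
    unfolding sum_distrib_right by (intro sum_mono mult_left_mono) (use min N i0 in auto)
  also have "\<dots> \<le> s * x i0" using x[OF i0] b[OF i0] by simp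
  finally have "(s - (\<Sum>j<n. N i0 j)) * x i0 \<ge> 0" by (simp add: algebra_simps)
  with s[OF i0] have "x i0 \<ge> 0" by (simp add: zero_le_mult_iff)
  with min[OF i] show ?thesis by simp
qed

text \<open>A kernel vector of the bordered matrix at a large real \<open>s\<close> is a state
  together with an input level whose output is zero. With positive input the state is nonnegative
  and positivity propagates along arcs, while a vanishing sum of nonnegative terms makes each
  \<open>h k j * y j\<close> zero.\<close>

lemma transfer_poly_0_imp:
  assumes p: "\<And>k'. \<lbrakk>k' < q; k' \<noteq> k\<rbrakk> \<Longrightarrow> p k' > 0" and k: "k < q" and l: "l < m"
    and zero: "transfer_poly k l p = 0"
  shows "\<exists>y. (\<forall>j<n + m. y j \<ge> 0 \<and> h k j * y j = 0) \<and> y (n + l) > (0::real) \<and>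
    (\<forall>i<n. \<forall>j<n + m. M (p(k := 0)) i j > 0 \<longrightarrow> y j > 0 \<longrightarrow> y i > 0)"
proof -
  let ?M = "M (p(k := 0))"
  have M0: "?M i j \<ge> 0" if "i < n" "j < n + m" for i j
    using that p by (intro M_nonneg) (auto intro: less_imp_le)
  \<comment> \<open>Larger than every row sum of the nonnegative state matrix, as the minimum
    principle requires; the added 1 makes this strict and \<open>s\<close> positive.\<close>
  define s where "s = (\<Sum>i<n. \<Sum>j<n. ?M i j) + 1"
  have s: "(\<Sum>j<n. ?M i j) < s" if "i < n" for i
  proof -
    have "(\<Sum>j<n. ?M i j) \<le> (\<Sum>i<n. \<Sum>j<n. ?M i j)"
      using that by (intro member_le_sum[of i "{..<n}" "\<lambda>i. \<Sum>j<n. ?M i j"] sum_nonneg M0) auto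
    then show ?thesis by (simp add: s_def)
  qed
  have s0: "s > 0" unfolding s_def by (intro add_nonneg_pos sum_nonneg M0) auto
  let ?B = "border k l p s (\<lambda>x. x)"
  have "det (mat (Suc n) (Suc n) (border k l p (complex_of_real s) of_real)) = 0"
    using poly_transfer_poly[of k l p "complex_of_real s"] zero by simp
  also have "mat (Suc n) (Suc n) (border k l p (complex_of_real s) of_real) =
      map_mat complex_of_real (mat (Suc n) (Suc n) ?B)"
    by (rule eq_matI) (auto simp: border_def Let_def)
  finally have "det (mat (Suc n) (Suc n) ?B) = 0"
    by (simp only: of_real_hom.hom_det of_real_eq_0_iff)
  \<comment> \<open>\<open>det_mat_eq_0_iff\<close> yields left null vectors; transposing first
    turns them into right ones, that is, into states with an input.\<close>
  then have "det (mat (Suc n) (Suc n) (\<lambda>(j, i). ?B (i, j))) = 0"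
    using det_transpose_mat[of "Suc n" "\<lambda>i j. ?B (i, j)"] by (simp add: case_prod_eta)
  then obtain x where x_nz: "\<exists>j<Suc n. x j \<noteq> 0" and
    x0: "\<And>i. i < Suc n \<Longrightarrow> (\<Sum>j<Suc n. x j * ?B (i, j)) = 0"
    unfolding det_mat_eq_0_iff by auto
  \<comment> \<open>The input coordinate may be assumed nonnegative after a change of sign.\<close>
  define x' where "x' = (if x n \<ge> 0 then x else (\<lambda>j. - x j))"
  have x'_nz: "\<exists>j<Suc n. x' j \<noteq> 0" using x_nz by (auto simp: x'_def)
  have x'0: "(\<Sum>j<Suc n. x' j * ?B (i, j)) = 0" if "i < Suc n" for i
    using x0[OF that] by (auto simp: x'_def sum_negf)
  have x'n: "x' n \<ge> 0" by (auto simp: x'_def)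
  have eq: "s * x' i = (\<Sum>j<n. ?M i j * x' j) + ?M i (n + l) * x' n" if i: "i < n" for i
  proof -
    have "(\<Sum>j<n. x' j * ((if i = j then s else 0) - ?M i j)) - x' n * ?M i (n + l) = 0"
      using x'0[of i] i by (simp add: border_def Let_def)
    moreover have "(\<Sum>j<n. x' j * ((if i = j then s else 0) - ?M i j)) =
        (\<Sum>j<n. if i = j then s * x' j else 0) - (\<Sum>j<n. ?M i j * x' j)"
      unfolding sum_subtractf[symmetric] by (rule sum.cong) (auto simp: algebra_simps)
    ultimately show ?thesis using i by (simp add: sum.delta' algebra_simps)
  qed
  have out: "(\<Sum>j<n. h k j * x' j) + h k (n + l) * x' n = 0"
    using x'0[of n] by (simp add: border_def Let_def algebra_simps)
  have nonneg: "x' i \<ge> 0" if "i < n" for i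
    by (rule nonneg_response[of ?M "\<lambda>i. ?M i (n + l) * x' n" s])
      (use M0 x'n s eq l that in auto)
  \<comment> \<open>With zero input both \<open>x'\<close> and \<open>- x'\<close> solve the
    nonnegative system, so the state would vanish too, contradicting \<open>x'_nz\<close>.\<close>
  have pos: "x' n > 0"
  proof (rule ccontr)
    assume "\<not> x' n > 0"
    with x'n have z: "x' n = 0" by simp
    have "- x' i \<ge> 0" if "i < n" for i
      by (rule nonneg_response[of ?M "\<lambda>i. 0" s "\<lambda>i. - x' i"])
        (use M0 s eq z that in \<open>auto simp: sum_negf\<close>)
    with nonneg have "x' i = 0" if "i < n" for i using that by fastforce
    with x'_nz z show False by (auto simp: less_Suc_eq)
  qed
  \<comment> \<open>Moves the input coordinate from position \<open>n\<close> to its vertex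
    \<open>n + l\<close>; the other inputs are switched off.\<close>
  define y where "y = (\<lambda>j. if j < n then x' j else if j = n + l then x' n else 0)"
  have h0: "h k j \<ge> 0" if "j < n + m" for j using h_01[OF k that] by auto
  have hx: "0 \<le> h k j * x' j" if "j < n" for j using that h0 nonneg by simp
  have hn: "0 \<le> h k (n + l) * x' n" using h0 l x'n by simp
  have S: "0 \<le> (\<Sum>j<n. h k j * x' j)" using hx by (intro sum_nonneg) auto
  with out hn have "(\<Sum>j<n. h k j * x' j) = 0" "h k (n + l) * x' n = 0" by linarith+
  then have hz: "h k j * x' j = 0" if "j < n" for j
    using sum_nonneg_eq_0_iff[of "{..<n}" "\<lambda>j. h k j * x' j"] hx that by auto
  have "y i > 0" if i: "i < n" and j: "j < n + m" and Mij: "?M i j > 0" and yj: "y j > 0" for i j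
  proof -
    have t1: "0 \<le> ?M i (n + l) * x' n" using M0[OF i] l x'n by simp
    have t2: "0 \<le> ?M i j' * x' j'" if "j' < n" for j' using M0[OF i] nonneg that by simp
    have "0 < (\<Sum>j<n. ?M i j * x' j) + ?M i (n + l) * x' n"
    proof (cases "j < n")
      case True
      then have "0 < (\<Sum>j<n. ?M i j * x' j)"
        using Mij yj t2 by (intro sum_pos2[of _ j]) (auto simp: y_def)
      with t1 show ?thesis by simp
    next
      case False
      with yj have "j = n + l" by (auto simp: y_def split: if_splits)
      with Mij pos have "0 < ?M i (n + l) * x' n" by simp
      moreover have "0 \<le> (\<Sum>j<n. ?M i j * x' j)" using t2 by (intro sum_nonneg) auto
      ultimately show ?thesis by simp
    qed
    then have "s * x' i > 0" using eq[OF i] by simp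
    with s0 i show ?thesis by (simp add: y_def zero_less_mult_iff)
  qed
  moreover have "\<forall>j<n + m. y j \<ge> 0 \<and> h k j * y j = 0"
    using nonneg hz \<open>h k (n + l) * x' n = 0\<close> x'n by (auto simp: y_def)
  moreover have "y (n + l) > 0" using pos by (simp add: y_def)
  ultimately show ?thesis by blast
qed

text \<open>If all these polynomials vanished, the positive response would spread from each input to
  everything reachable from it. All vertices together would be covered in this way, so
  \<open>h k\<close> would be zero on all of them, contrary to \<open>gh_nonzero\<close>.\<close>

lemma ex_transfer_poly_nonzero:
  assumes p: "\<And>k'. \<lbrakk>k' < q; k' \<noteq> k\<rbrakk> \<Longrightarrow> p k' > 0" and k: "k < q" and reach: all_reachable
  shows "\<exists>l<m. transfer_poly k l p \<noteq> 0"
proof (rule ccontr)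
  assume "\<not> (\<exists>l<m. transfer_poly k l p \<noteq> 0)"
  then have zero: "transfer_poly k l p = 0" if "l < m" for l using that by blast
  have *: "h k w = 0" if l: "l < m" and w: "(n + l, w) \<in> adj\<^sup>*" for l w
  proof -
    obtain y where y: "\<And>j. j < n + m \<Longrightarrow> h k j * y j = 0" "y (n + l) > (0::real)"
      "\<And>i j. \<lbrakk>i < n; j < n + m; M (p(k := 0)) i j > 0; y j > 0\<rbrakk> \<Longrightarrow> y i > 0"
      using transfer_poly_0_imp[OF p k l zero[OF l]] by blast
    from w have "w < n + m \<and> y w > 0"
    proof (induction rule: rtrancl_induct)
      case base
      then show ?case using l y(2) by simp
    next
      case (step w w')
      from step.hyps(2) obtain k' where k': "w' < n" "k' < q" "g k' w' * h k' w \<noteq> 0"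
        by (auto simp: adj_def)
      \<comment> \<open>A vertex with positive response sends out no arc of color \<open>k\<close>,
        so the arc at hand survives setting \<open>p k\<close> to 0.\<close>
      have "h k w = 0" using step.IH y(1)[of w] by auto
      with k'(3) have "k' \<noteq> k" by auto
      have "M (p(k := 0)) w' w > 0"
        by (rule M_pos[of _ _ _ k']) (use p k' step.IH \<open>k' \<noteq> k\<close> in \<open>auto intro: less_imp_le\<close>)
      with y(3)[of w' w] k'(1) step.IH show ?case by simp
    qed
    with y(1)[of w] show ?thesis by auto
  qed
  have "h k j = 0" if "j < n + m" for j
  proof (cases "j < n")
    case True
    with reach *[of _ j] show ?thesis unfolding all_reachable_def by blast
  next
    case False
    with *[of "j - n" j] that show ?thesis by auto
  qed
  with gh_nonzero[OF k] show False by auto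
qed

text \<open>\<open>j\<close> counts the released parameters; those from \<open>j\<close> on stay at
  their positive values. Since \<open>\<mu>\<close> may depend on the latter only, each step removes
  its dependence on one more parameter.\<close>

lemma persistent_mode:
  assumes modes: "\<And>p. \<exists>\<mu>. uncontrollable_mode \<mu> p" and reach: all_reachable
  shows "j \<le> q \<Longrightarrow> (\<And>k. p k > 0) \<Longrightarrow>
    \<exists>\<mu>. \<forall>p'. (\<forall>k\<ge>j. p' k = p k) \<longrightarrow> uncontrollable_mode \<mu> p'"
proof (induction j arbitrary: p)
  case 0
  then have "p' = p" if "\<forall>k\<ge>0. p' k = p k" for p' using that by auto
  with modes[of p] show ?case by blast
next
  case (Suc j)
  then have j: "j < q" by simp
  \<comment> \<open>For every positive value \<open>y\<close> of parameter \<open>j\<close> the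
    induction hypothesis supplies a mode \<open>\<Lambda> y\<close> that does not depend on the
    parameters below \<open>j\<close>.\<close>
  have "\<forall>y\<in>{0<..}. \<exists>\<mu>. \<forall>p'. (\<forall>k\<ge>j. p' k = (p(j := y)) k) \<longrightarrow> uncontrollable_mode \<mu> p'"
    using Suc.IH[of "p(j := y)" for y] Suc.prems by simp
  from bchoice[OF this] obtain \<Lambda> where
    \<Lambda>': "\<forall>y\<in>{0<..}. \<forall>p'. (\<forall>k\<ge>j. p' k = (p(j := y)) k) \<longrightarrow> uncontrollable_mode (\<Lambda> y) p'" ..
  have \<Lambda>: "uncontrollable_mode (\<Lambda> y) p'" if "y > 0" "\<forall>k\<ge>j. p' k = (p(j := y)) k" for y p'
    using \<Lambda>' that by simp
  obtain l where l: "l < m" "transfer_poly j l p \<noteq> 0"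
    using ex_transfer_poly_nonzero[of j p] j reach Suc.prems(2) by blast
  \<comment> \<open>The mode is tested at the positive point \<open>p(j := y)\<close>. By
    \<open>transfer_poly_upd\<close> the polynomial does not involve \<open>y\<close>, so all
    \<open>\<Lambda> y\<close> lie in one finite root set.\<close>
  have "poly (transfer_poly j l p) (\<Lambda> y) = 0" if "y > 0" for y
    using uncontrollable_mode_imp_transfer_root[OF \<Lambda>[of y "p(j := y)"] j l(1)] that
    by (simp add: transfer_poly_upd)
  then have "\<Lambda> ` {0<..} \<subseteq> {x. poly (transfer_poly j l p) x = 0}" by auto
  then have "finite (\<Lambda> ` {0<..})"
    using poly_roots_finite[OF l(2)] by (rule finite_subset)
  then obtain y0 where "infinite {y \<in> {0<..}. \<Lambda> y = \<Lambda> y0}"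
    using pigeonhole_infinite[of "{0::real<..}" \<Lambda>] infinite_Ioi[of "0::real"] by blast
  then have inf: "infinite {y. y > 0 \<and> \<Lambda> y = \<Lambda> y0}" by simp
  have "uncontrollable_mode (\<Lambda> y0) p'" if p': "\<forall>k\<ge>Suc j. p' k = p k" for p'
  proof -
    \<comment> \<open>The same infinite set of values \<open>y\<close> serves every setting
      \<open>p'\<close> of the released parameters.\<close>
    have "{y. y > 0 \<and> \<Lambda> y = \<Lambda> y0} \<subseteq> {y. uncontrollable_mode (\<Lambda> y0) (p'(j := y))}"
    proof clarify
      fix y :: real assume "y > 0" "\<Lambda> y = \<Lambda> y0"
      then show "uncontrollable_mode (\<Lambda> y0) (p'(j := y))"
        using \<Lambda>[of y "p'(j := y)"] p' by simp
    qed
    with inf have "infinite {y. uncontrollable_mode (\<Lambda> y0) (p'(j := y))}"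
      using finite_subset by blast
    from uncontrollable_mode_line[OF j this, of "p' j"] show ?thesis by simp
  qed
  then show ?case by blast
qed

lemma uncontrollable_imp_rank_deficient:
  assumes modes: "\<And>p. \<exists>\<mu>. uncontrollable_mode \<mu> p" and reach: all_reachable
  shows "\<not> full_row_rank n (n + m) (M p)"
proof -
  \<comment> \<open>For \<open>j = q\<close> only coordinates beyond the parameters remain fixed; 1
    is an arbitrary positive value.\<close>
  obtain \<mu> where \<mu>: "\<And>p'. (\<forall>k\<ge>q. p' k = 1) \<Longrightarrow> uncontrollable_mode \<mu> p'"
    using persistent_mode[OF modes reach, of q "\<lambda>_. 1"] by auto
  have all: "uncontrollable_mode \<mu> p" for p
    using \<mu>[of "\<lambda>k. if k < q then p k else 1"]
      uncontrollable_mode_cong[of "\<lambda>k. if k < q then p k else 1" p] by simp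
  have "\<mu> = 0"
  proof -
    obtain v i where "i < n" "v i \<noteq> 0" "\<mu> * v i = (\<Sum>j<n. v j * of_real (M (\<lambda>_. 0) j i))"
      using all[of "\<lambda>_. 0"] unfolding uncontrollable_mode_iff by fastforce
    then show ?thesis by (simp add: M_def)
  qed
  with all[of p] have "\<not> full_row_rank n (n + m) (pencil 0 p)"
    by (simp add: uncontrollable_mode_def)
  \<comment> \<open>The pencil at eigenvalue 0 is \<open>- M p\<close> over the complex numbers, so
    full row rank over the reals would contradict the mode 0.\<close>
  moreover have "full_row_rank n (n + m) (pencil 0 p)" if "full_row_rank n (n + m) (M p)"
  proof (rule full_row_rankI)
    fix v i assume v: "\<And>j. j < n + m \<Longrightarrow> (\<Sum>i<n. v i * pencil 0 p i j) = 0" and i: "i < n"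
    have "(\<Sum>i<n. v i * of_real (M p i j)) = 0" if "j < n + m" for j
      using v[OF that] by (cases "j < n") (simp_all add: sum_pencil)
    from full_row_rankD[OF that[folded full_row_rank_of_real] this i] show "v i = 0" .
  qed
  ultimately show ?thesis by blast
qed

end

subsection \<open>The controllability matrix\<close>

text \<open>Column \<open>k * m + l\<close> of the controllability matrix is column \<open>l\<close>
  of \<open>A^k B\<close>; quotient and remainder by \<open>m\<close> recover the pair.\<close>

lemma controllable_iff:
  assumes A: "A \<in> carrier_mat n n" and B: "B \<in> carrier_mat n m"
  shows "controllable A B \<longleftrightarrow>
    (\<forall>v. (\<forall>k<n. \<forall>l<m. (\<Sum>i<n. v i * (A ^\<^sub>m k * B) $$ (i, l)) = 0) \<longrightarrow> (\<forall>i<n. v i = 0))"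
proof -
  let ?C = "controllability_mat A B"
  have C: "?C \<in> carrier_mat n (n * m)"
    using A B by (simp add: controllability_mat_def)
  have C_index: "?C $$ (i, j) = (A ^\<^sub>m (j div m) * B) $$ (i, j mod m)" if "i < n" "j < n * m" for i j
    using A B that by (simp add: controllability_mat_def)
  have "(\<forall>j<n * m. (\<Sum>i<n. v i * ?C $$ (i, j)) = 0) \<longleftrightarrow>
      (\<forall>k<n. \<forall>l<m. (\<Sum>i<n. v i * (A ^\<^sub>m k * B) $$ (i, l)) = 0)" for v
  proof (intro iffI allI impI)
    fix k l assume *: "\<forall>j<n * m. (\<Sum>i<n. v i * ?C $$ (i, j)) = 0" and kl: "k < n" "l < m"
    have "k * m + l < Suc k * m" using kl by simp
    also have "\<dots> \<le> n * m" using kl by (intro mult_le_mono1) simp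
    finally have "k * m + l < n * m" .
    with * kl C_index[of _ "k * m + l"] show "(\<Sum>i<n. v i * (A ^\<^sub>m k * B) $$ (i, l)) = 0"
      by fastforce
  next
    fix j assume *: "\<forall>k<n. \<forall>l<m. (\<Sum>i<n. v i * (A ^\<^sub>m k * B) $$ (i, l)) = 0" and j: "j < n * m"
    have "m > 0" using j by (cases m) auto
    then have "j div m < n" "j mod m < m" using j by (auto simp: less_mult_imp_div_less)
    with * C_index[OF _ j] show "(\<Sum>i<n. v i * ?C $$ (i, j)) = 0" by simp
  qed
  then show ?thesis
    unfolding controllable_def using A C mat_rank_eq_iff_full_row_rank[OF C]
    by (simp add: full_row_rank_def)
qed

text \<open>Powers are defined by multiplication on the right, whereas the block argument for
  reducible pairs peels off a factor on the left.\<close>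

lemma pow_mat_Suc_left: "A \<in> carrier_mat n n \<Longrightarrow> A ^\<^sub>m Suc k = A * A ^\<^sub>m k"
proof (induction k)
  case (Suc k)
  have "A ^\<^sub>m Suc (Suc k) = (A * A ^\<^sub>m k) * A" using Suc by simp
  also have "\<dots> = A * (A ^\<^sub>m k * A)" using Suc.prems by (intro assoc_mult_mat[of _ n n _ n _ n]) auto
  finally show ?case by simp
qed simp

lemma index_mult_mat_sum:
  "\<lbrakk>A \<in> carrier_mat a b; B \<in> carrier_mat b c; i < a; j < c\<rbrakk> \<Longrightarrow>
    (A * B) $$ (i, j) = (\<Sum>x<b. A $$ (i, x) * B $$ (x, j))"
  by (auto simp: scalar_prod_def atLeast0LessThan intro!: sum.cong)

text \<open>Component \<open>j\<close> of the row vector \<open>v A^k\<close>, that is, the Krylov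
  sequence of \<open>v\<close> under the transpose of \<open>A\<close>.\<close>

definition krylov :: "nat \<Rightarrow> real mat \<Rightarrow> (nat \<Rightarrow> real) \<Rightarrow> nat \<Rightarrow> nat \<Rightarrow> real" where
  "krylov n A v k j = (\<Sum>i<n. v i * (A ^\<^sub>m k) $$ (i, j))"

lemma sum_mult_mat:
  fixes v :: "nat \<Rightarrow> real"
  assumes "A \<in> carrier_mat n b" "B \<in> carrier_mat b c" "j < c"
  shows "(\<Sum>i<n. v i * (A * B) $$ (i, j)) = (\<Sum>x<b. (\<Sum>i<n. v i * A $$ (i, x)) * B $$ (x, j))"
proof -
  have "(\<Sum>i<n. v i * (A * B) $$ (i, j)) = (\<Sum>i<n. \<Sum>x<b. v i * A $$ (i, x) * B $$ (x, j))"
    using assms by (simp add: index_mult_mat_sum sum_distrib_left mult.assoc del: index_mult_mat)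
  then show ?thesis by (simp only: sum.swap[of _ "{..<n}"] sum_distrib_right)
qed

lemma krylov_0: "A \<in> carrier_mat n n \<Longrightarrow> j < n \<Longrightarrow> krylov n A v 0 j = v j"
proof -
  assume *: "A \<in> carrier_mat n n" "j < n"
  then have "krylov n A v 0 j = (\<Sum>i<n. if i = j then v i else 0)"
    unfolding krylov_def by (intro sum.cong) auto
  then show ?thesis using * by simp
qed

lemma krylov_Suc:
  "A \<in> carrier_mat n n \<Longrightarrow> j < n \<Longrightarrow> krylov n A v (Suc k) j = (\<Sum>i<n. krylov n A v k i * A $$ (i, j))"
  unfolding krylov_def using sum_mult_mat[of "A ^\<^sub>m k" n n A n j v] by simp

lemma krylov_mult:
  "A \<in> carrier_mat n n \<Longrightarrow> B \<in> carrier_mat n m \<Longrightarrow> l < m \<Longrightarrow>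
    (\<Sum>i<n. v i * (A ^\<^sub>m k * B) $$ (i, l)) = (\<Sum>i<n. krylov n A v k i * B $$ (i, l))"
  unfolding krylov_def by (rule sum_mult_mat) auto

text \<open>A row vector with \<open>v A = 0\<close> and \<open>v B = 0\<close> annihilates every
  \<open>A^k B\<close>: its Krylov sequence vanishes from index 1 on, and index 0 is handled by
  \<open>B\<close>.\<close>

lemma controllable_imp_full_row_rank:
  assumes A: "A \<in> carrier_mat n n" and B: "B \<in> carrier_mat n m" and "controllable A B"
  shows "full_row_rank n (n + m) (\<lambda>i j. if j < n then A $$ (i, j) else B $$ (i, j - n))"
proof (rule full_row_rankI)
  fix v i
  assume v: "\<And>j. j < n + m \<Longrightarrow> (\<Sum>i<n. v i * (if j < n then A $$ (i, j) else B $$ (i, j - n))) = 0"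
    and i: "i < n"
  have vA: "(\<Sum>i<n. v i * A $$ (i, j)) = 0" if "j < n" for j using v[of j] that by simp
  have vB: "(\<Sum>i<n. v i * B $$ (i, l)) = 0" if "l < m" for l using v[of "n + l"] that by simp
  have "\<forall>j<n. krylov n A v (Suc k) j = 0" for k
  proof (induction k)
    case 0
    have "krylov n A v (Suc 0) j = (\<Sum>i<n. v i * A $$ (i, j))" if "j < n" for j
      using krylov_Suc[OF A that] krylov_0[OF A] by simp
    with vA show ?case by simp
  next
    case (Suc k)
    then show ?case using krylov_Suc[OF A, of _ v "Suc k"] by simp
  qed
  then have "(\<Sum>i<n. krylov n A v k i * B $$ (i, l)) = 0" if "l < m" for k l
    by (cases k) (use that vB krylov_0[OF A] in simp_all)
  then have "\<forall>k<n. \<forall>l<m. (\<Sum>i<n. v i * (A ^\<^sub>m k * B) $$ (i, l)) = 0"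
    using krylov_mult[OF A B] by simp
  then show "v i = 0" using assms(3) i unfolding controllable_iff[OF A B] by blast
qed

text \<open>A polynomial \<open>f\<close> of least degree with \<open>f(A\<^sup>T) v = 0\<close>
  has a root \<open>\<mu>\<close>; dividing out \<open>x - \<mu>\<close> gives an eigenvector in
  the Krylov space of \<open>v\<close>.\<close>

lemma uncontrollable_imp_eigenvector:
  assumes A: "A \<in> carrier_mat n n" and B: "B \<in> carrier_mat n m" and "\<not> controllable A B"
  shows "\<exists>\<mu> w. (\<exists>i<n. w i \<noteq> 0) \<and>
    (\<forall>j<n. (\<Sum>i<n. w i * complex_of_real (A $$ (i, j))) = \<mu> * w j) \<and>
    (\<forall>l<m. (\<Sum>i<n. w i * complex_of_real (B $$ (i, l))) = 0)"
proof -
  obtain v i0 where i0: "i0 < n" "v i0 \<noteq> 0" and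
    v: "\<And>k l. \<lbrakk>k < n; l < m\<rbrakk> \<Longrightarrow> (\<Sum>i<n. v i * (A ^\<^sub>m k * B) $$ (i, l)) = 0"
    using assms(3) unfolding controllable_iff[OF A B] by blast
  define u where "u = (\<lambda>k j. complex_of_real (krylov n A v k j))"
  have u0: "u 0 i0 \<noteq> 0" using i0 krylov_0[OF A] by (simp add: u_def)
  have uSuc: "u (Suc k) j = (\<Sum>i<n. u k i * complex_of_real (A $$ (i, j)))" if "j < n" for k j
    using krylov_Suc[OF A that, of v k] by (simp add: u_def)
  \<comment> \<open>The controllability matrix gives this for \<open>k < n\<close> only, which
    suffices because the quotient polynomial \<open>f'\<close> below has degree less than
    \<open>n\<close>.\<close>
  have uB: "(\<Sum>i<n. u k i * complex_of_real (B $$ (i, l))) = 0" if "k < n" "l < m" for k l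
  proof -
    have "(\<Sum>i<n. krylov n A v k i * B $$ (i, l)) = 0"
      using v[OF that] krylov_mult[OF A B that(2), of v k] by simp
    then have "complex_of_real (\<Sum>i<n. krylov n A v k i * B $$ (i, l)) = 0" by simp
    then show ?thesis by (simp add: u_def)
  qed
  \<comment> \<open>\<open>act f\<close> is the row vector \<open>v f(A)\<close> for polynomials of
    degree at most \<open>n\<close>; the fixed summation range makes it linear in
    \<open>f\<close>.\<close>
  define act where "act = (\<lambda>f j. \<Sum>k\<le>n. coeff f k * u k j)"
  define ann where "ann = (\<lambda>f. f \<noteq> 0 \<and> degree f \<le> n \<and> (\<forall>j<n. act f j = 0))"
  have "\<exists>f. ann f"
  proof -
    \<comment> \<open>The \<open>n + 1\<close> vectors \<open>u 0\<close>, ..., \<open>u n\<close>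
      have only \<open>n\<close> components. A zero column makes the matrix square and singular,
      which yields a linear relation \<open>c\<close> between its rows.\<close>
    have "det (mat (Suc n) (Suc n) (\<lambda>(k, j). if j < n then u k j else 0)) =
        det (mat (Suc n) (Suc n) (\<lambda>(j, k). if j < n then u k j else 0))"
      using det_transpose_mat[of "Suc n" "\<lambda>j k. if j < n then u k j else 0"] .
    also have "\<dots> = 0"
      unfolding det_mat_eq_0_iff by (rule exI[of _ "\<lambda>j. if j = n then 1 else 0"]) auto
    finally obtain c k0 where c: "k0 < Suc n" "c k0 \<noteq> 0"
      "\<And>j. j < Suc n \<Longrightarrow> (\<Sum>k<Suc n. c k * (if j < n then u k j else 0)) = 0"
      unfolding det_mat_eq_0_iff by auto
    define f where "f = (\<Sum>k<Suc n. monom (c k) k)"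
    have f: "coeff f k = (if k < Suc n then c k else 0)" for k
      by (simp add: f_def coeff_sum sum.delta del: sum.lessThan_Suc)
    have "f \<noteq> 0" using f[of k0] c(1,2) by auto
    moreover have "degree f \<le> n" by (rule degree_le) (simp add: f)
    moreover have "act f j = 0" if "j < n" for j
    proof -
      have "act f j = (\<Sum>k<Suc n. c k * u k j)"
        unfolding act_def lessThan_Suc_atMost by (rule sum.cong) (auto simp: f)
      then show ?thesis using c(3)[of j] that by simp
    qed
    ultimately show ?thesis unfolding ann_def by blast
  qed
  then obtain f where f: "ann f" and least: "\<And>f'. ann f' \<Longrightarrow> degree f \<le> degree f'"
    using ex_has_least_nat[of ann _ degree] by blast
  \<comment> \<open>A nonzero constant cannot annihilate \<open>v\<close>, because
    \<open>u 0 i0\<close> is nonzero.\<close>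
  have "degree f \<noteq> 0"
  proof
    assume "degree f = 0"
    then obtain a where a: "f = [:a:]" using degree_eq_zeroE by blast
    have "act f i0 = (\<Sum>k\<le>n. if k = 0 then a * u 0 i0 else 0)"
      unfolding act_def by (rule sum.cong) (auto simp: a coeff_pCons split: nat.splits)
    then have "a * u 0 i0 = 0" using f i0 by (simp add: ann_def)
    with u0 a f show False by (simp add: ann_def)
  qed
  then have "\<not> constant (poly f)" by (simp add: constant_degree)
  then obtain \<mu> where "poly f \<mu> = 0" using fundamental_theorem_of_algebra by blast
  then obtain f' where ff': "f = [:- \<mu>, 1:] * f'" by (auto simp: poly_eq_0_iff_dvd dvd_def)
  have f'0: "f' \<noteq> 0" using f ff' by (auto simp: ann_def)
  then have deg: "degree f = Suc (degree f')"
    unfolding ff' by (subst degree_mult_eq) auto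
  then have degn: "degree f' < n" using f by (simp add: ann_def)
  \<comment> \<open>Lets the sum up to \<open>n\<close> be shifted by one without losing a term, and
    spares the index \<open>k = n\<close> when \<open>B\<close> is applied.\<close>
  then have coeff_n: "coeff f' n = 0" by (simp add: coeff_eq_0)
  \<comment> \<open>Minimality of the degree of \<open>f\<close> makes \<open>act f'\<close> a
    nonzero vector; it is the eigenvector.\<close>
  have "\<not> ann f'" using least[of f'] deg by fastforce
  then obtain j0 where j0: "j0 < n" "act f' j0 \<noteq> 0" using f'0 degn by (auto simp: ann_def)
  have "(\<Sum>i<n. act f' i * complex_of_real (A $$ (i, j))) = \<mu> * act f' j" if j: "j < n" for j
  proof -
    have "(\<Sum>i<n. act f' i * complex_of_real (A $$ (i, j))) =
        (\<Sum>k\<le>n. coeff f' k * (\<Sum>i<n. u k i * complex_of_real (A $$ (i, j))))"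
      unfolding act_def sum_distrib_right by (subst sum.swap) (simp only: sum_distrib_left mult.assoc)
    also have "\<dots> = (\<Sum>k\<le>n. coeff f' k * u (Suc k) j)" using uSuc[OF j] by simp
    also have "\<dots> = (\<Sum>k<n. coeff f' k * u (Suc k) j)"
      by (simp add: coeff_n flip: lessThan_Suc_atMost)
    also have "\<dots> = (\<Sum>k\<le>n. coeff (pCons 0 f') k * u k j)"
      unfolding lessThan_Suc_atMost[symmetric] by (subst sum.lessThan_Suc_shift) simp
    finally have *: "(\<Sum>i<n. act f' i * complex_of_real (A $$ (i, j))) =
      (\<Sum>k\<le>n. coeff (pCons 0 f') k * u k j)" .
    have "coeff f k = coeff (pCons 0 f') k - \<mu> * coeff f' k" for k by (simp add: ff')
    then have "act f j = (\<Sum>k\<le>n. coeff (pCons 0 f') k * u k j) - \<mu> * act f' j"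
      by (simp only: act_def left_diff_distrib sum_subtractf sum_distrib_left mult.assoc)
    with f j * show ?thesis by (simp add: ann_def)
  qed
  moreover have "(\<Sum>i<n. act f' i * complex_of_real (B $$ (i, l))) = 0" if l: "l < m" for l
  proof -
    have "(\<Sum>i<n. act f' i * complex_of_real (B $$ (i, l))) =
        (\<Sum>k\<le>n. coeff f' k * (\<Sum>i<n. u k i * complex_of_real (B $$ (i, l))))"
      unfolding act_def sum_distrib_right by (subst sum.swap) (simp only: sum_distrib_left mult.assoc)
    also have "\<dots> = 0"
    proof (rule sum.neutral, rule ballI)
      fix k assume "k \<in> {..n}"
      then show "coeff f' k * (\<Sum>i<n. u k i * complex_of_real (B $$ (i, l))) = 0"
        using uB[of k l] l coeff_n by (cases "k = n") auto
    qed
    finally show ?thesis .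
  qed
  ultimately show ?thesis using j0 by blast
qed

text \<open>Block triangularity keeps the first \<open>n1\<close> rows of \<open>P A^k B\<close>
  zero for all \<open>k\<close>, so row 0 of \<open>P\<close> is a left null vector of the
  controllability matrix. It is nonzero because \<open>P\<close> is invertible.\<close>

lemma controllable_imp_not_reducible:
  assumes A: "A \<in> carrier_mat n n" and B: "B \<in> carrier_mat n m" and "controllable A B"
    and P: "P \<in> carrier_mat n n" "P' \<in> carrier_mat n n" "inverts_mat P P'" "inverts_mat P' P"
    and n1: "1 \<le> n1" "n1 \<le> n"
    and PA: "\<And>i j. \<lbrakk>i < n1; n1 \<le> j; j < n\<rbrakk> \<Longrightarrow> (P * A * P') $$ (i, j) = 0"
    and PB: "\<And>i l. \<lbrakk>i < n1; l < m\<rbrakk> \<Longrightarrow> (P * B) $$ (i, l) = 0"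
  shows False
proof -
  have inv: "P * P' = 1\<^sub>m n" "P' * P = 1\<^sub>m n" using P by (auto simp: inverts_mat_def)
  have Ak: "A ^\<^sub>m k * B \<in> carrier_mat n m" for k using A B by auto
  have zero: "\<forall>i<n1. \<forall>l<m. (P * (A ^\<^sub>m k * B)) $$ (i, l) = 0" for k
  proof (induction k)
    case 0
    then show ?case using PB A B by simp
  next
    case (Suc k)
    let ?X = "A ^\<^sub>m k * B"
    have PX: "P * ?X \<in> carrier_mat n m" using P Ak[of k] by simp
    have PA': "P * A \<in> carrier_mat n n" using P A by simp
    \<comment> \<open>Inserting \<open>P' * P\<close> between \<open>A\<close> and
      \<open>A^k B\<close> exposes the transformed state matrix acting on the previous
      product.\<close>
    have "(P * A * P') * (P * ?X) = P * A * (P' * (P * ?X))"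
      by (rule assoc_mult_mat[OF PA' P(2) PX])
    also have "P' * (P * ?X) = (P' * P) * ?X"
      by (rule assoc_mult_mat[OF P(2,1) Ak, symmetric])
    also have "\<dots> = ?X" unfolding inv using Ak[of k] by (rule left_mult_one_mat)
    also have "P * A * ?X = P * (A * ?X)" by (rule assoc_mult_mat[OF P(1) A Ak])
    also have "A * ?X = A * A ^\<^sub>m k * B"
      by (rule assoc_mult_mat[OF A _ B, symmetric]) (use A in simp)
    also have "A * A ^\<^sub>m k = A ^\<^sub>m Suc k" by (rule pow_mat_Suc_left[OF A, symmetric])
    finally have *: "P * (A ^\<^sub>m Suc k * B) = (P * A * P') * (P * (A ^\<^sub>m k * B))" ..
    show ?case
    proof (intro allI impI)
      fix i l assume il: "i < n1" "l < m"
      have "((P * A * P') * (P * (A ^\<^sub>m k * B))) $$ (i, l) =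
          (\<Sum>j<n. (P * A * P') $$ (i, j) * (P * (A ^\<^sub>m k * B)) $$ (j, l))"
        by (rule index_mult_mat_sum[of _ n n _ m]) (use A B P il n1 Ak[of k] in auto)
      also have "\<dots> = 0"
      proof (rule sum.neutral, rule ballI)
        fix j assume "j \<in> {..<n}"
        then show "(P * A * P') $$ (i, j) * (P * (A ^\<^sub>m k * B)) $$ (j, l) = 0"
          using PA[of i j] il Suc by (cases "j < n1") simp_all
      qed
      finally show "(P * (A ^\<^sub>m Suc k * B)) $$ (i, l) = 0" using * by simp
    qed
  qed
  have n0: "0 < n1" "0 < n" using n1 by auto
  have "(\<Sum>i<n. P $$ (0, i) * (A ^\<^sub>m k * B) $$ (i, l)) = 0" if "l < m" for k l
    using zero[of k, rule_format, OF n0(1) that] unfolding index_mult_mat_sum[OF P(1) Ak n0(2) that] .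
  then have "\<forall>k<n. \<forall>l<m. (\<Sum>i<n. P $$ (0, i) * (A ^\<^sub>m k * B) $$ (i, l)) = 0" by blast
  then have "\<forall>i<n. P $$ (0, i) = 0"
    by (rule assms(3)[unfolded controllable_iff[OF A B], THEN spec, THEN mp])
  moreover have "(\<Sum>i<n. P $$ (0, i) * P' $$ (i, 0)) = 1"
    using index_mult_mat_sum[OF P(1,2) n0(2) n0(2)] n0(2) unfolding inv by simp
  ultimately show False by simp
qed

subsection \<open>Irreducibility and reachability\<close>

text \<open>Supplies the permutation that lists a given set of vertices first.\<close>

lemma ex_permutes_image:
  assumes "U \<subseteq> {..<n::nat}"
  shows "\<exists>\<sigma>. \<sigma> permutes {..<n} \<and> \<sigma> ` {..<card U} = U"
proof -
  have fin: "finite U" using assms finite_subset by blast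
  have cU: "card U \<le> n" using card_mono[OF _ assms] by simp
  obtain f where f: "bij_betw f {..<card U} U"
    using ex_bij_betw_nat_finite[OF fin] by (auto simp: atLeast0LessThan)
  have "card {card U..<n} = card ({..<n} - U)"
    using card_Diff_subset[OF fin assms] by simp
  then obtain g where g: "bij_betw g {card U..<n} ({..<n} - U)"
    using finite_same_card_bij[of "{card U..<n}" "{..<n} - U"] by auto
  define \<sigma> where "\<sigma> = (\<lambda>i. if i < card U then f i else if i < n then g i else i)"
  have f': "bij_betw \<sigma> {..<card U} U"
    using f by (rule bij_betw_cong[THEN iffD2, rotated]) (simp add: \<sigma>_def)
  have g': "bij_betw \<sigma> {card U..<n} ({..<n} - U)"
    using g by (rule bij_betw_cong[THEN iffD2, rotated]) (simp add: \<sigma>_def)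
  have "bij_betw \<sigma> ({..<card U} \<union> {card U..<n}) (U \<union> ({..<n} - U))"
    by (rule bij_betw_combine[OF f' g']) auto
  moreover have "{..<card U} \<union> {card U..<n} = {..<n}" "U \<union> ({..<n} - U) = {..<n}"
    using cU assms by auto
  ultimately have "\<sigma> permutes {..<n}"
    using cU by (intro bij_imp_permutes) (auto simp: \<sigma>_def)
  moreover have "\<sigma> ` {..<card U} = U" using f' by (simp add: bij_betw_def)
  ultimately show ?thesis by blast
qed

lemma index_permutation_mult:
  assumes "\<sigma> permutes {..<n}" "A \<in> carrier_mat n c" "i < n" "j < c"
  shows "(mat n n (\<lambda>(i, j). if j = \<sigma> i then 1 else 0) * A) $$ (i, j) = (A $$ (\<sigma> i, j) :: real)"
proof -
  have "\<sigma> i < n" using permutes_in_image[OF assms(1), of i] assms(3) by simp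
  have "(mat n n (\<lambda>(i, j). if j = \<sigma> i then 1 else 0) * A) $$ (i, j) =
      (\<Sum>x<n. (if x = \<sigma> i then 1 else 0) * A $$ (x, j))"
    by (subst index_mult_mat_sum[of _ n n _ c]) (use assms in simp_all)
  also have "\<dots> = (\<Sum>x<n. if x = \<sigma> i then A $$ (x, j) else 0)" by (intro sum.cong) simp_all
  finally show ?thesis using \<open>\<sigma> i < n\<close> by simp
qed

lemma index_mult_permutation:
  assumes "\<sigma> permutes {..<n}" "A \<in> carrier_mat c n" "i < c" "j < n"
  shows "(A * mat n n (\<lambda>(i, j). if i = \<sigma> j then 1 else 0)) $$ (i, j) = (A $$ (i, \<sigma> j) :: real)"
proof -
  have "\<sigma> j < n" using permutes_in_image[OF assms(1), of j] assms(4) by simp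
  have "(A * mat n n (\<lambda>(i, j). if i = \<sigma> j then 1 else 0)) $$ (i, j) =
      (\<Sum>x<n. A $$ (i, x) * (if x = \<sigma> j then 1 else 0))"
    by (subst index_mult_mat_sum[of _ c n _ n]) (use assms in simp_all)
  also have "\<dots> = (\<Sum>x<n. if x = \<sigma> j then A $$ (i, x) else 0)" by (intro sum.cong) simp_all
  finally show ?thesis using \<open>\<sigma> j < n\<close> by simp
qed

context rank_one_param
begin

definition A_mat :: "(nat \<Rightarrow> real) \<Rightarrow> real mat" where
  "A_mat p = mat n n (\<lambda>(i, j). M p i j)"

definition B_mat :: "(nat \<Rightarrow> real) \<Rightarrow> real mat" where
  "B_mat p = mat n m (\<lambda>(i, l). M p i (n + l))"

lemma A_mat_carrier [simp]: "A_mat p \<in> carrier_mat n n" and B_mat_carrier [simp]: "B_mat p \<in> carrier_mat n m"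
  by (auto simp: A_mat_def B_mat_def)

lemma uncontrollable_imp_mode:
  assumes "\<not> controllable (A_mat p) (B_mat p)"
  shows "\<exists>\<mu>. uncontrollable_mode \<mu> p"
proof -
  obtain \<mu> w where w: "\<exists>i<n. w i \<noteq> 0"
    "\<And>j. j < n \<Longrightarrow> (\<Sum>i<n. w i * complex_of_real (A_mat p $$ (i, j))) = \<mu> * w j"
    "\<And>l. l < m \<Longrightarrow> (\<Sum>i<n. w i * complex_of_real (B_mat p $$ (i, l))) = 0"
    using uncontrollable_imp_eigenvector[OF A_mat_carrier B_mat_carrier assms] by blast
  have "(\<Sum>i<n. w i * complex_of_real (M p i j)) = (if j < n then \<mu> * w j else 0)" if "j < n + m" for j
  proof (cases "j < n")
    case True
    then show ?thesis using w(2)[OF True] by (simp add: A_mat_def)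
  next
    case False
    then have "j - n < m" "n + (j - n) = j" using that by auto
    then show ?thesis using w(3)[of "j - n"] False by (simp add: B_mat_def)
  qed
  with w(1) show ?thesis unfolding uncontrollable_mode_iff by blast
qed

lemma controllable_imp_full_row_rank_M:
  assumes "controllable (A_mat p) (B_mat p)"
  shows "full_row_rank n (n + m) (M p)"
proof (rule full_row_rankI)
  fix v i assume v: "\<And>j. j < n + m \<Longrightarrow> (\<Sum>i<n. v i * M p i j) = 0" and i: "i < n"
  have "(\<Sum>i<n. v i * (if j < n then A_mat p $$ (i, j) else B_mat p $$ (i, j - n))) = 0"
    if "j < n + m" for j
    using v[OF that] that by (cases "j < n") (simp_all add: A_mat_def B_mat_def)
  from full_row_rankD[OF controllable_imp_full_row_rank[OF A_mat_carrier B_mat_carrier assms] this i]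
  show "v i = 0" .
qed

lemma ex_controllable:
  assumes all_reachable and "full_row_rank n (n + m) (M p)"
  shows "\<exists>p. controllable (A_mat p) (B_mat p)"
proof (rule ccontr)
  assume "\<not> (\<exists>p. controllable (A_mat p) (B_mat p))"
  then have "\<exists>\<mu>. uncontrollable_mode \<mu> p" for p using uncontrollable_imp_mode by blast
  from uncontrollable_imp_rank_deficient[OF this assms(1)] assms(2) show False by blast
qed

lemma controllable_imp_irreducible:
  assumes p: "p \<in> carrier_vec q" and c: "controllable (A_mat (\<lambda>k. p $ k)) (B_mat (\<lambda>k. p $ k))"
  shows "irreducible_pair n m q (\<lambda>p. A_mat (\<lambda>k. p $ k)) (\<lambda>p. B_mat (\<lambda>k. p $ k))"
  unfolding irreducible_pair_def
proof (rule notI, elim exE conjE)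
  fix P P' :: "real mat" and n1
  let ?A = "A_mat (\<lambda>k. p $ k)" and ?B = "B_mat (\<lambda>k. p $ k)"
  assume "permutation_mat n P" and P': "P' \<in> carrier_mat n n" "inverts_mat P P'" "inverts_mat P' P"
    and n1: "1 \<le> n1" "n1 \<le> n"
    and "\<forall>p\<in>carrier_vec q. \<exists>A1 A2 A3 B1. A1 \<in> carrier_mat n1 n1 \<and> A2 \<in> carrier_mat (n - n1) n1 \<and>
             A3 \<in> carrier_mat (n - n1) (n - n1) \<and> B1 \<in> carrier_mat (n - n1) m \<and>
             P * A_mat (\<lambda>k. p $ k) * P' = four_block_mat A1 (0\<^sub>m n1 (n - n1)) A2 A3 \<and>
             P * B_mat (\<lambda>k. p $ k) = 0\<^sub>m n1 m @\<^sub>r B1"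
  then obtain A1 A2 A3 B1 where blocks: "A1 \<in> carrier_mat n1 n1" "A2 \<in> carrier_mat (n - n1) n1"
      "A3 \<in> carrier_mat (n - n1) (n - n1)" "B1 \<in> carrier_mat (n - n1) m"
    and PA: "P * ?A * P' = four_block_mat A1 (0\<^sub>m n1 (n - n1)) A2 A3"
    and PB: "P * ?B = 0\<^sub>m n1 m @\<^sub>r B1"
    using p by blast
  have P: "P \<in> carrier_mat n n" using \<open>permutation_mat n P\<close> by (auto simp: permutation_mat_def)
  show False
  proof (rule controllable_imp_not_reducible[OF A_mat_carrier B_mat_carrier c P P' n1])
    fix i j assume "i < n1" "n1 \<le> j" "j < n"
    then show "(P * ?A * P') $$ (i, j) = 0" unfolding PA using blocks n1 by simp
  next
    fix i l assume "i < n1" "l < m"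
    then show "(P * ?B) $$ (i, l) = 0" unfolding PB append_rows_def using blocks n1 by simp
  qed
qed

lemma M_eq_0_if_not_adj:
  assumes "i < n" "j < n + m" "(j, i) \<notin> adj"
  shows "M p i j = 0"
  using assms unfolding adj_def M_def by (auto intro!: sum.neutral)

text \<open>No arc enters the set \<open>U\<close> of unreachable vertices from outside, neither
  from a reachable vertex nor from an input. Listing \<open>U\<close> first therefore produces the
  forbidden block form; \<open>U\<close> may be everything, in which case
  \<open>n1 = n\<close>.\<close>

lemma irreducible_imp_all_reachable:
  assumes "irreducible_pair n m q (\<lambda>p. A_mat (\<lambda>k. p $ k)) (\<lambda>p. B_mat (\<lambda>k. p $ k))"
  shows all_reachable
proof (rule ccontr)
  define U where "U = {i. i < n \<and> (\<forall>l<m. (n + l, i) \<notin> adj\<^sup>*)}"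
  assume "\<not> all_reachable"
  then have "U \<noteq> {}" unfolding all_reachable_def U_def by auto
  have U: "U \<subseteq> {..<n}" by (auto simp: U_def)
  then have finU: "finite U" using finite_subset by blast
  define n1 where "n1 = card U"
  have n1: "1 \<le> n1" "n1 \<le> n"
    using \<open>U \<noteq> {}\<close> finU card_mono[OF _ U] by (auto simp: n1_def Suc_le_eq card_gt_0_iff)
  obtain \<sigma> where \<sigma>: "\<sigma> permutes {..<n}" "\<sigma> ` {..<n1} = U"
    using ex_permutes_image[OF U] n1_def by blast
  have \<sigma>n: "\<sigma> i < n" if "i < n" for i using permutes_in_image[OF \<sigma>(1), of i] that by simp
  have inj: "\<sigma> i = \<sigma> j \<longleftrightarrow> i = j" for i j using permutes_inj[OF \<sigma>(1)] by (auto dest: injD)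
  have \<sigma>U: "\<sigma> i \<in> U \<longleftrightarrow> i < n1" for i
    using \<sigma>(2) inj by (metis imageE imageI lessThan_iff)
  define P where "P = mat n n (\<lambda>(i, j). if j = \<sigma> i then 1 else (0::real))"
  \<comment> \<open>The inverse of a permutation matrix is its transpose.\<close>
  define P' where "P' = mat n n (\<lambda>(i, j). if i = \<sigma> j then 1 else (0::real))"
  have P: "P \<in> carrier_mat n n" "P' \<in> carrier_mat n n" by (auto simp: P_def P'_def)
  have PX: "(P * X) $$ (i, j) = X $$ (\<sigma> i, j)" if "X \<in> carrier_mat n c" "i < n" "j < c" for X i j c
    unfolding P_def by (rule index_permutation_mult[OF \<sigma>(1) that])
  have XP': "(X * P') $$ (i, j) = X $$ (i, \<sigma> j)" if "X \<in> carrier_mat n n" "i < n" "j < n" for X i j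
    unfolding P'_def by (rule index_mult_permutation[OF \<sigma>(1) that])
  have PP': "P * P' = 1\<^sub>m n"
    by (rule eq_matI) (use PX[OF P(2)] \<sigma>n inj P in \<open>auto simp: P'_def\<close>)
  have "P' * P = 1\<^sub>m n"
    using mat_mult_left_right_inverse[OF P PP'] .
  have PAP': "(P * A_mat p * P') $$ (i, j) = M p (\<sigma> i) (\<sigma> j)" if "i < n" "j < n" for p i j
  proof -
    have "P * A_mat p \<in> carrier_mat n n" using P(1) by simp
    then have "(P * A_mat p * P') $$ (i, j) = (P * A_mat p) $$ (i, \<sigma> j)"
      using that by (rule XP')
    also have "\<dots> = A_mat p $$ (\<sigma> i, \<sigma> j)" by (rule PX[OF A_mat_carrier]) (use that \<sigma>n in auto)
    finally show ?thesis using that \<sigma>n by (simp add: A_mat_def)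
  qed
  have PB: "(P * B_mat p) $$ (i, l) = M p (\<sigma> i) (n + l)" if "i < n" "l < m" for p i l
    using PX[OF B_mat_carrier that] that \<sigma>n by (simp add: B_mat_def)
  have zeroA: "M p (\<sigma> i) (\<sigma> j) = 0" if "i < n1" "n1 \<le> j" "j < n" for p i j
  proof (rule M_eq_0_if_not_adj)
    have "\<sigma> i \<in> U" "\<sigma> j \<notin> U" "\<sigma> j < n" using that \<sigma>U \<sigma>n by auto
    then obtain l where "l < m" "(n + l, \<sigma> j) \<in> adj\<^sup>*" by (auto simp: U_def)
    with \<open>\<sigma> i \<in> U\<close> show "(\<sigma> j, \<sigma> i) \<notin> adj" by (auto simp: U_def dest: rtrancl_into_rtrancl)
  qed (use that n1 \<sigma>n in \<open>auto simp: trans_less_add1\<close>)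
  have zeroB: "M p (\<sigma> i) (n + l) = 0" if "i < n1" "l < m" for p i l
  proof (rule M_eq_0_if_not_adj)
    show "(n + l, \<sigma> i) \<notin> adj" using that \<sigma>U[of i] by (auto simp: U_def)
  qed (use that n1 \<sigma>n in auto)
  have "\<not> irreducible_pair n m q (\<lambda>p. A_mat (\<lambda>k. p $ k)) (\<lambda>p. B_mat (\<lambda>k. p $ k))"
    unfolding irreducible_pair_def not_not
  proof (intro exI conjI ballI)
    fix p :: "real vec"
    let ?F = "P * A_mat (\<lambda>k. p $ k) * P'" and ?G = "P * B_mat (\<lambda>k. p $ k)"
    show "?F = four_block_mat (mat n1 n1 (\<lambda>(i, j). ?F $$ (i, j))) (0\<^sub>m n1 (n - n1))
        (mat (n - n1) n1 (\<lambda>(i, j). ?F $$ (i + n1, j)))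
        (mat (n - n1) (n - n1) (\<lambda>(i, j). ?F $$ (i + n1, j + n1)))" (is "_ = ?R")
    proof (rule eq_matI)
      fix i j assume "i < dim_row ?R" "j < dim_col ?R"
      then have ij: "i < n" "j < n" using n1 by auto
      show "?F $$ (i, j) = ?R $$ (i, j)"
        using ij n1 zeroA[of i j "\<lambda>k. p $ k"] PAP'[OF ij, of "\<lambda>k. p $ k"] by auto
    qed (use P n1 in auto)
    show "?G = 0\<^sub>m n1 m @\<^sub>r mat (n - n1) m (\<lambda>(i, j). ?G $$ (i + n1, j))" (is "_ = ?R")
    proof (rule eq_matI)
      fix i j assume "i < dim_row ?R" "j < dim_col ?R"
      then have ij: "i < n" "j < m" using n1 by (auto simp: append_rows_def)
      show "?G $$ (i, j) = ?R $$ (i, j)"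
        using ij n1 zeroB[of i j "\<lambda>k. p $ k"] PB[OF ij, of "\<lambda>k. p $ k"] by (auto simp: append_rows_def)
    qed (use P n1 in \<open>auto simp: append_rows_def B_mat_def\<close>)
  qed (use \<sigma>(1) n1 PP' \<open>P' * P = 1\<^sub>m n\<close> P in
      \<open>auto simp: permutation_mat_def P_def inverts_mat_def\<close>)
  with assms show False by blast
qed

end

subsection \<open>Minors as sums over color sets\<close>

context rank_one_param
begin

definition minor :: "(nat \<Rightarrow> nat) \<Rightarrow> (nat \<Rightarrow> real) \<Rightarrow> real" where
  "minor \<gamma> p = det (mat n n (\<lambda>(i, l). M p i (\<gamma> l)))"

definition colorings :: "nat set \<Rightarrow> (nat \<Rightarrow> nat) set" where
  "colorings C = {\<kappa> \<in> {..<n} \<rightarrow>\<^sub>E {..<q}. inj_on \<kappa> {..<n} \<and> \<kappa> ` {..<n} = C}"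

text \<open>Coefficient of \<open>\<Prod>k\<in>C. p k\<close> in \<open>minor \<gamma>\<close>: row
  \<open>i\<close> contributes its summand of color \<open>\<kappa> i\<close>, and every color of
  \<open>C\<close> is used exactly once.\<close>

definition color_coeff :: "(nat \<Rightarrow> nat) \<Rightarrow> nat set \<Rightarrow> real" where
  "color_coeff \<gamma> C = (\<Sum>\<kappa>\<in>colorings C. (\<Prod>i<n. g (\<kappa> i) i) * det (mat n n (\<lambda>(i, l). h (\<kappa> i) (\<gamma> l))))"

lemma finite_colorings [simp]: "finite (colorings C)"
  unfolding colorings_def by (rule finite_subset[of _ "{..<n} \<rightarrow>\<^sub>E {..<q}"]) (auto intro: finite_PiE)

text \<open>Products with a repeated color cancel because every color contributes a matrix of rank
  one.\<close>

lemma minor_eq_sum: "minor \<gamma> p = (\<Sum>C\<in>Pow {..<q}. (\<Prod>k\<in>C. p k) * color_coeff \<gamma> C)"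
proof -
  let ?D = "\<lambda>\<kappa>. det (mat n n (\<lambda>(i, l). h (\<kappa> i) (\<gamma> l)))"
  let ?F = "\<lambda>\<kappa>. (\<Prod>i<n. p (\<kappa> i) * g (\<kappa> i) i) * ?D \<kappa>"
  let ?E = "{..<n} \<rightarrow>\<^sub>E {..<q}"
  let ?I = "{\<kappa> \<in> ?E. inj_on \<kappa> {..<n}}"
  have fin: "finite ?E" by (auto intro: finite_PiE)
  have "minor \<gamma> p = (\<Sum>\<kappa>\<in>?E. ?F \<kappa>)"
    unfolding minor_def M_def by (rule det_mat_sum_mult) simp
  also have "\<dots> = (\<Sum>\<kappa>\<in>?I. ?F \<kappa>)"
  proof (rule sum.mono_neutral_right)
    show "\<forall>\<kappa>\<in>?E - ?I. ?F \<kappa> = 0"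
    proof
      fix \<kappa> assume "\<kappa> \<in> ?E - ?I"
      then have "\<not> inj_on \<kappa> {..<n}" by blast
      then obtain i j where "i < n" "j < n" "i \<noteq> j" "\<kappa> i = \<kappa> j" unfolding inj_on_def by blast
      then have "?D \<kappa> = 0" by (intro det_mat_eq_0_if_rows_eq[of i n j]) simp_all
      then show "?F \<kappa> = 0" by simp
    qed
  qed (rule fin, blast)
  \<comment> \<open>The monomial of an injective choice depends only on its set of colors, so
    grouping by this set collects the coefficients.\<close>
  also have "\<dots> = (\<Sum>C\<in>Pow {..<q}. \<Sum>\<kappa> | \<kappa> \<in> ?I \<and> \<kappa> ` {..<n} = C. ?F \<kappa>)"
  proof (rule sum.group[symmetric])
    show "finite ?I" by (rule finite_subset[OF _ fin]) blast
    show "(\<lambda>\<kappa>. \<kappa> ` {..<n}) ` ?I \<subseteq> Pow {..<q}" by blast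
  qed simp
  also have "\<dots> = (\<Sum>C\<in>Pow {..<q}. (\<Prod>k\<in>C. p k) * color_coeff \<gamma> C)"
  proof (rule sum.cong[OF refl])
    fix C
    have "(\<Sum>\<kappa> | \<kappa> \<in> ?I \<and> \<kappa> ` {..<n} = C. ?F \<kappa>) = (\<Sum>\<kappa>\<in>colorings C. ?F \<kappa>)"
      by (rule sum.cong) (auto simp: colorings_def)
    also have "\<dots> = (\<Sum>\<kappa>\<in>colorings C. (\<Prod>k\<in>C. p k) * ((\<Prod>i<n. g (\<kappa> i) i) * ?D \<kappa>))"
    proof (rule sum.cong[OF refl])
      fix \<kappa> assume "\<kappa> \<in> colorings C"
      then have "inj_on \<kappa> {..<n}" and C: "C = \<kappa> ` {..<n}" by (simp_all add: colorings_def)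
      then have "(\<Prod>k\<in>C. p k) = (\<Prod>i<n. p (\<kappa> i))"
        unfolding C by (subst prod.reindex) simp_all
      then show "?F \<kappa> = (\<Prod>k\<in>C. p k) * ((\<Prod>i<n. g (\<kappa> i) i) * ?D \<kappa>)"
        by (simp add: prod.distrib)
    qed
    finally show "(\<Sum>\<kappa> | \<kappa> \<in> ?I \<and> \<kappa> ` {..<n} = C. ?F \<kappa>) = (\<Prod>k\<in>C. p k) * color_coeff \<gamma> C"
      by (simp add: color_coeff_def sum_distrib_left)
  qed
  finally show ?thesis .
qed

lemma color_coeff_nonzero_imp:
  assumes "color_coeff \<gamma> C \<noteq> 0"
  shows "C \<subseteq> {..<q}" "card C = n"
proof -
  have "colorings C \<noteq> {}" using assms by (auto simp: color_coeff_def)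
  then obtain \<kappa> where "\<kappa> \<in> {..<n} \<rightarrow>\<^sub>E {..<q}" "inj_on \<kappa> {..<n}" "\<kappa> ` {..<n} = C"
    unfolding colorings_def by blast
  then show "C \<subseteq> {..<q}" "card C = n" using card_image[of \<kappa> "{..<n}"] by auto
qed

text \<open>At the indicator point of \<open>C\<close> the surviving monomials use colors from
  \<open>C\<close> only, and since those with nonzero coefficient have exactly \<open>n\<close>
  colors, \<open>C\<close> itself is the only one. A nonzero coefficient thus comes with explicit
  parameters at which the minor is nonzero.\<close>

lemma color_coeff_eq_minor:
  assumes C: "C \<subseteq> {..<q}" "card C = n"
  shows "color_coeff \<gamma> C = minor \<gamma> (\<lambda>k. if k \<in> C then 1 else 0)"
proof -
  let ?p = "\<lambda>k. if k \<in> C then 1 else (0::real)"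
  have "(\<Prod>k\<in>C'. ?p k) * color_coeff \<gamma> C' = 0" if C': "C' \<in> Pow {..<q} - {C}" for C'
  proof (rule ccontr)
    assume nz: "(\<Prod>k\<in>C'. ?p k) * color_coeff \<gamma> C' \<noteq> 0"
    have fin: "finite C'" "finite C" using C' C finite_subset by blast+
    have "card C' = n" using color_coeff_nonzero_imp(2)[of \<gamma> C'] nz by fastforce
    moreover have "C' \<subseteq> C"
    proof (rule subsetI, rule ccontr)
      fix x assume "x \<in> C'" "x \<notin> C"
      then have "(\<Prod>k\<in>C'. ?p k) = 0" using fin(1) by (intro prod_zero) auto
      with nz show False by simp
    qed
    ultimately have "C' = C" using card_subset_eq[OF fin(2)] C(2) by simp
    with C' show False by simp
  qed
  then have "(\<Sum>C'\<in>Pow {..<q} - {C}. (\<Prod>k\<in>C'. ?p k) * color_coeff \<gamma> C') = 0"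
    by (rule sum.neutral[OF ballI])
  moreover have "minor \<gamma> ?p = (\<Prod>k\<in>C. ?p k) * color_coeff \<gamma> C +
      (\<Sum>C'\<in>Pow {..<q} - {C}. (\<Prod>k\<in>C'. ?p k) * color_coeff \<gamma> C')"
    unfolding minor_eq_sum by (rule sum.remove) (use C(1) in simp_all)
  moreover have "(\<Prod>k\<in>C. ?p k) = 1" by (rule prod.neutral) simp
  ultimately show ?thesis by (simp only: mult_1_left add_0_right)
qed

lemma minor_nonzero_imp_color_coeff:
  assumes "minor \<gamma> p \<noteq> 0"
  shows "\<exists>C \<subseteq> {..<q}. color_coeff \<gamma> C \<noteq> 0"
proof (rule ccontr)
  assume "\<not> ?thesis"
  then have "minor \<gamma> p = 0" unfolding minor_eq_sum by (intro sum.neutral) auto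
  with assms show False ..
qed

text \<open>Read \<open>i\<close> as the head of an arc with tail
  \<open>\<gamma> (\<sigma> i)\<close> and color \<open>\<kappa> i\<close>; the last condition says
  that this arc exists.\<close>

definition colored_permutations :: "(nat \<Rightarrow> nat) \<Rightarrow> nat set \<Rightarrow> ((nat \<Rightarrow> nat) \<times> (nat \<Rightarrow> nat)) set" where
  "colored_permutations \<gamma> C = {(\<sigma>, \<kappa>). \<sigma> permutes {..<n} \<and> \<kappa> \<in> colorings C \<and>
     (\<forall>i<n. g (\<kappa> i) i * h (\<kappa> i) (\<gamma> (\<sigma> i)) \<noteq> 0)}"

lemma finite_colored_permutations: "finite (colored_permutations \<gamma> C)"
  by (rule finite_subset[of _ "{\<sigma>. \<sigma> permutes {..<n}} \<times> colorings C"])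
    (auto simp: colored_permutations_def finite_permutations)

text \<open>By the Leibniz formula; with entries 0 and 1 each product is 1 if all its arcs exist and
  0 otherwise, so only signs are summed.\<close>

lemma color_coeff_eq_sum_sign:
  assumes \<gamma>: "\<And>l. l < n \<Longrightarrow> \<gamma> l < n + m"
  shows "color_coeff \<gamma> C = (\<Sum>(\<sigma>, \<kappa>)\<in>colored_permutations \<gamma> C. of_int (sign \<sigma>))"
proof -
  let ?S = "{\<sigma>. \<sigma> permutes {..<n}}"
  let ?f = "\<lambda>\<kappa> \<sigma>. \<Prod>i<n. g (\<kappa> i) i * h (\<kappa> i) (\<gamma> (\<sigma> i))"
  have "color_coeff \<gamma> C = (\<Sum>\<kappa>\<in>colorings C. \<Sum>\<sigma>\<in>?S. of_int (sign \<sigma>) * ?f \<kappa> \<sigma>)"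
    unfolding color_coeff_def det_mat_eq_sum sum_distrib_left
    by (intro sum.cong refl) (simp add: prod.distrib ac_simps)
  also have "\<dots> = (\<Sum>\<sigma>\<in>?S. \<Sum>\<kappa>\<in>colorings C. of_int (sign \<sigma>) * ?f \<kappa> \<sigma>)"
    by (rule sum.swap)
  also have "\<dots> = (\<Sum>(\<sigma>, \<kappa>)\<in>?S \<times> colorings C. of_int (sign \<sigma>) * ?f \<kappa> \<sigma>)"
    by (rule sum.cartesian_product)
  also have "\<dots> = (\<Sum>(\<sigma>, \<kappa>)\<in>colored_permutations \<gamma> C. of_int (sign \<sigma>) * ?f \<kappa> \<sigma>)"
  proof (rule sum.mono_neutral_right)
    show "\<forall>x\<in>?S \<times> colorings C - colored_permutations \<gamma> C.
        (case x of (\<sigma>, \<kappa>) \<Rightarrow> real_of_int (sign \<sigma>) * ?f \<kappa> \<sigma>) = 0"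
    proof (rule ballI, elim DiffE, clarify)
      fix \<sigma> \<kappa> assume "\<sigma> permutes {..<n}" "\<kappa> \<in> colorings C" "(\<sigma>, \<kappa>) \<notin> colored_permutations \<gamma> C"
      then have "\<exists>i\<in>{..<n}. g (\<kappa> i) i * h (\<kappa> i) (\<gamma> (\<sigma> i)) = 0"
        unfolding colored_permutations_def by blast
      then have "?f \<kappa> \<sigma> = 0" by (intro prod_zero) simp_all
      then show "real_of_int (sign \<sigma>) * ?f \<kappa> \<sigma> = 0" by simp
    qed
  qed (auto simp: finite_permutations colored_permutations_def)
  also have "\<dots> = (\<Sum>(\<sigma>, \<kappa>)\<in>colored_permutations \<gamma> C. of_int (sign \<sigma>))"
  proof (rule sum.cong[OF refl], clarify)
    fix \<sigma> \<kappa> assume *: "(\<sigma>, \<kappa>) \<in> colored_permutations \<gamma> C"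
    have "g (\<kappa> i) i * h (\<kappa> i) (\<gamma> (\<sigma> i)) = 1" if i: "i < n" for i
    proof -
      have "\<kappa> i < q" "g (\<kappa> i) i * h (\<kappa> i) (\<gamma> (\<sigma> i)) \<noteq> 0" "\<sigma> i < n"
        using * i permutes_in_image[of \<sigma> "{..<n}" i] by (auto simp: colored_permutations_def colorings_def)
      then show ?thesis using g_01[of "\<kappa> i" i] h_01[of "\<kappa> i" "\<gamma> (\<sigma> i)"] \<gamma>[of "\<sigma> i"] i by auto
    qed
    then show "real_of_int (sign \<sigma>) * ?f \<kappa> \<sigma> = real_of_int (sign \<sigma>)" by simp
  qed
  finally show ?thesis .
qed

text \<open>Vanishing of a minor is a matter of left null vectors, which see only the set of
  columns. This avoids tracking the sign of a reordering when two numberings of the same vertices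
  meet.\<close>

lemma minor_nonzero_cong:
  assumes "\<gamma> ` {..<n} = \<gamma>' ` {..<n}" and "minor \<gamma> p \<noteq> 0"
  shows "minor \<gamma>' p \<noteq> 0"
proof
  assume "minor \<gamma>' p = 0"
  then obtain v where v: "\<exists>i<n. v i \<noteq> 0" "\<And>l. l < n \<Longrightarrow> (\<Sum>i<n. v i * M p i (\<gamma>' l)) = 0"
    unfolding minor_def det_mat_eq_0_iff by auto
  have "(\<Sum>i<n. v i * M p i (\<gamma> l)) = 0" if l: "l < n" for l
  proof -
    have "\<gamma> l \<in> \<gamma>' ` {..<n}" using assms(1) l by blast
    then obtain l' where "l' < n" "\<gamma> l = \<gamma>' l'" by auto
    with v(2) show ?thesis by simp
  qed
  with v(1) have "minor \<gamma> p = 0" unfolding minor_def det_mat_eq_0_iff by auto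
  with assms(2) show False ..
qed

lemma minor_nonzero_imp_inj:
  assumes "minor \<gamma> p \<noteq> 0"
  shows "inj_on \<gamma> {..<n}"
proof (rule inj_onI, rule ccontr)
  fix l l' assume *: "l \<in> {..<n}" "l' \<in> {..<n}" "\<gamma> l = \<gamma> l'" "l \<noteq> l'"
  have "det (mat n n (\<lambda>(l, i). M p i (\<gamma> l))) = 0"
    by (rule det_mat_eq_0_if_rows_eq[of l n l']) (use * in auto)
  then have "minor \<gamma> p = 0"
    unfolding minor_def by (rule det_transpose_mat[of n "\<lambda>i l. M p i (\<gamma> l)", symmetric, THEN trans])
  with assms show False ..
qed

end

subsection \<open>Disjoint unions of paths and cycles\<close>

definition succs :: "'a list \<Rightarrow> ('a \<times> 'a) set" where
  "succs vs = {(vs ! i, vs ! Suc i) | i. Suc i < length vs}"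

lemma fst_succs: "fst ` succs vs = set (butlast vs)"
proof -
  have "fst ` succs vs = {vs ! i | i. Suc i < length vs}"
    by (force simp: succs_def image_iff)
  also have "\<dots> = {butlast vs ! i | i. i < length (butlast vs)}"
    by (intro Collect_cong ex_cong1) (auto simp: nth_butlast less_diff_conv)
  finally show ?thesis by (simp add: set_conv_nth)
qed

lemma snd_succs: "snd ` succs vs = set (tl vs)"
proof -
  have "snd ` succs vs = {vs ! Suc i | i. Suc i < length vs}"
    by (force simp: succs_def image_iff)
  also have "\<dots> = {tl vs ! i | i. i < length (tl vs)}"
    by (intro Collect_cong ex_cong1) (auto simp: nth_tl less_diff_conv)
  finally show ?thesis by (simp add: set_conv_nth)
qed

lemma set_butlast_distinct: "distinct vs \<Longrightarrow> vs \<noteq> [] \<Longrightarrow> set (butlast vs) = set vs - {last vs}"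
  by (induction vs rule: rev_induct) auto

lemma set_tl_distinct: "distinct vs \<Longrightarrow> vs \<noteq> [] \<Longrightarrow> set (tl vs) = set vs - {hd vs}"
  by (cases vs) auto

lemma inj_on_fst_succs: "distinct vs \<Longrightarrow> inj_on fst (succs vs)"
  by (rule inj_onI) (auto simp: succs_def nth_eq_iff_index_eq)

lemma inj_on_snd_succs: "distinct vs \<Longrightarrow> inj_on snd (succs vs)"
  by (rule inj_onI) (auto simp: succs_def nth_eq_iff_index_eq)

lemma succs_append:
  assumes "vs \<noteq> []" "ws \<noteq> []"
  shows "succs (vs @ ws) = succs vs \<union> succs ws \<union> {(last vs, hd ws)}"
proof -
  have "succs xs = set (zip xs (tl xs))" for xs :: "'a list"
    unfolding succs_def set_zip by (intro Collect_cong ex_cong1) (auto simp: nth_tl less_diff_conv)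
  moreover have "zip (vs @ ws) (tl (vs @ ws)) = zip vs (tl vs) @ (last vs, hd ws) # zip ws (tl ws)"
    using assms
  proof (induction vs)
    case (Cons x vs)
    then show ?case by (cases vs; cases ws) auto
  qed simp
  ultimately show ?thesis by auto
qed

lemma tail_arcs_conv: "tail H ` arcs H = fst ` arcs_ends H"
  by (simp add: arcs_ends_def arc_to_ends_def image_image)

lemma head_arcs_conv: "head H ` arcs H = snd ` arcs_ends H"
  by (simp add: arcs_ends_def arc_to_ends_def image_image)

lemma inj_on_tail_if:
  assumes "inj_on (arc_to_ends H) (arcs H)" "inj_on fst (arcs_ends H)"
  shows "inj_on (tail H) (arcs H)"
  using comp_inj_on[OF assms(1) assms(2)[unfolded arcs_ends_def]]
  by (simp add: comp_def arc_to_ends_def)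

lemma inj_on_head_if:
  assumes "inj_on (arc_to_ends H) (arcs H)" "inj_on snd (arcs_ends H)"
  shows "inj_on (head H) (arcs H)"
  using comp_inj_on[OF assms(1) assms(2)[unfolded arcs_ends_def]]
  by (simp add: comp_def arc_to_ends_def)

text \<open>Sources, sinks and the number of paths are later read off from these defects: among its
  vertices a path lacks exactly one tail and one head, a cycle none.\<close>

lemma path_labelingD:
  assumes "path_labeling vs H"
  shows "vs \<noteq> []" "verts H = set vs" "inj_on (tail H) (arcs H)" "inj_on (head H) (arcs H)"
    "tail H ` arcs H = verts H - {last vs}" "head H ` arcs H = verts H - {hd vs}"
proof -
  have *: "vs \<noteq> []" "distinct vs" "verts H = set vs" "inj_on (arc_to_ends H) (arcs H)"
    "arcs_ends H = succs vs"
    using assms by (auto simp: path_labeling_def succs_def)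
  then show "vs \<noteq> []" "verts H = set vs" by auto
  show "inj_on (tail H) (arcs H)" "inj_on (head H) (arcs H)"
    using * by (auto intro!: inj_on_tail_if inj_on_head_if inj_on_fst_succs inj_on_snd_succs)
  show "tail H ` arcs H = verts H - {last vs}" "head H ` arcs H = verts H - {hd vs}"
    using * by (simp_all add: tail_arcs_conv head_arcs_conv fst_succs snd_succs
        set_butlast_distinct set_tl_distinct)
qed

lemma cycle_labelingD:
  assumes "cycle_labeling vs H"
  shows "vs \<noteq> []" "verts H = set vs" "inj_on (tail H) (arcs H)" "inj_on (head H) (arcs H)"
    "tail H ` arcs H = verts H" "head H ` arcs H = verts H"
proof -
  have *: "vs \<noteq> []" "distinct vs" "verts H = set vs" "inj_on (arc_to_ends H) (arcs H)"
    "arcs_ends H = insert (last vs, hd vs) (succs vs)"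
    using assms by (auto simp: cycle_labeling_def succs_def)
  then show "vs \<noteq> []" "verts H = set vs" by auto
  have "last vs \<notin> fst ` succs vs" "hd vs \<notin> snd ` succs vs"
    using * by (simp_all add: fst_succs snd_succs set_butlast_distinct set_tl_distinct)
  then have "inj_on fst (arcs_ends H)" "inj_on snd (arcs_ends H)"
    using * inj_on_fst_succs[of vs] inj_on_snd_succs[of vs]
    by (auto simp only: inj_on_insert fst_conv snd_conv)
  then show "inj_on (tail H) (arcs H)" "inj_on (head H) (arcs H)"
    using * by (auto intro!: inj_on_tail_if inj_on_head_if)
  show "tail H ` arcs H = verts H" "head H ` arcs H = verts H"
    using * hd_in_set[of vs] last_in_set[of vs]
    by (auto simp: tail_arcs_conv head_arcs_conv fst_succs snd_succs
        set_butlast_distinct set_tl_distinct)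
qed

lemma disjoint_graph_unionD:
  assumes "disjoint_graph_union S K (\<lambda>H. H)" "H \<in> K"
  shows "tail H = tail S" "head H = head S" "verts H \<subseteq> verts S" "arcs H \<subseteq> arcs S"
    "e \<in> arcs S \<Longrightarrow> tail S e \<in> verts H \<Longrightarrow> e \<in> arcs H"
    "e \<in> arcs S \<Longrightarrow> head S e \<in> verts H \<Longrightarrow> e \<in> arcs H"
proof -
  have sub: "subgraph H' S" if "H' \<in> K" for H' using assms(1) that by (auto simp: disjoint_graph_union_def)
  then show "tail H = tail S" "head H = head S" "verts H \<subseteq> verts S" "arcs H \<subseteq> arcs S"
    using assms(2) by (auto simp: subgraph_def compatible_def)
  have "e \<in> arcs H" if e: "e \<in> arcs S" and v: "tail S e \<in> verts H \<or> head S e \<in> verts H"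
  proof -
    obtain H' where H': "H' \<in> K" "e \<in> arcs H'" using assms(1) e by (auto simp: disjoint_graph_union_def)
    with sub[OF H'(1)] have "tail S e \<in> verts H'" "head S e \<in> verts H'"
      by (auto simp: subgraph_def compatible_def wf_digraph_def)
    with v have "verts H \<inter> verts H' \<noteq> {}" by auto
    with assms H'(1) have "H' = H"
      unfolding disjoint_graph_union_def disjoint_family_on_def by blast
    with H'(2) show ?thesis by simp
  qed
  then show "e \<in> arcs S \<Longrightarrow> tail S e \<in> verts H \<Longrightarrow> e \<in> arcs H"
    "e \<in> arcs S \<Longrightarrow> head S e \<in> verts H \<Longrightarrow> e \<in> arcs H" by auto
qed

lemma disjoint_graph_union_eq:
  assumes "disjoint_graph_union S K (\<lambda>H. H)" "H \<in> K" "H' \<in> K" "v \<in> verts H" "v \<in> verts H'"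
  shows "H = H'"
  using assms unfolding disjoint_graph_union_def disjoint_family_on_def by blast

section \<open>Consequences of a fixed path-cycle decomposition\<close>

locale decomposed =
  fixes m :: nat and S :: "('a, 'b) pre_digraph" and Ps Cs
  assumes dec: "path_cycle_decomposition m S Ps Cs"
begin

lemma union: "disjoint_graph_union S (Ps \<union> Cs) (\<lambda>H. H)"
  and fin: "finite Ps" "finite Cs" and card_Ps: "card Ps = m"
  and path: "P \<in> Ps \<Longrightarrow> path_graph P" and cycle: "C \<in> Cs \<Longrightarrow> cycle_graph C"
  using dec by (auto simp: path_cycle_decomposition_def)

lemma ex_component: "v \<in> verts S \<Longrightarrow> \<exists>H\<in>Ps \<union> Cs. v \<in> verts H"
  using union by (auto simp: disjoint_graph_union_def)

lemma ex_arc_component: "e \<in> arcs S \<Longrightarrow> \<exists>H\<in>Ps \<union> Cs. e \<in> arcs H"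
  using union by (auto simp: disjoint_graph_union_def)

lemma component_wf:
  assumes "H \<in> Ps \<union> Cs" "e \<in> arcs H"
  shows "tail S e \<in> verts H" "head S e \<in> verts H"
proof -
  have "wf_digraph H" using union assms(1) by (auto simp: disjoint_graph_union_def subgraph_def)
  then show "tail S e \<in> verts H" "head S e \<in> verts H"
    using disjoint_graph_unionD(1,2)[OF union assms(1)] assms(2) by (simp_all add: wf_digraph_def)
qed

lemma arc_in_verts:
  assumes "e \<in> arcs S"
  shows "tail S e \<in> verts S" "head S e \<in> verts S"
proof -
  obtain H where H: "H \<in> Ps \<union> Cs" "e \<in> arcs H" using ex_arc_component[OF assms] by blast
  from component_wf[OF H] disjoint_graph_unionD(3)[OF union H(1)]
  show "tail S e \<in> verts S" "head S e \<in> verts S" by auto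
qed

lemma component_cases:
  assumes "H \<in> Ps \<union> Cs"
  obtains vs where "path_labeling vs H" | vs where "cycle_labeling vs H"
proof (cases "H \<in> Ps")
  case True
  then show ?thesis using that(1) path unfolding path_graph_def by blast
next
  case False
  then show ?thesis using that(2) cycle assms unfolding cycle_graph_def by blast
qed

lemma component_props:
  assumes "H \<in> Ps \<union> Cs"
  shows "inj_on (tail S) (arcs H)" "inj_on (head S) (arcs H)" "finite (verts H)"
proof -
  have *: "inj_on (tail H) (arcs H) \<and> inj_on (head H) (arcs H) \<and> finite (verts H)"
  proof (rule component_cases[OF assms])
    fix vs assume "path_labeling vs H"
    from path_labelingD(2-4)[OF this] show ?thesis by simp
  next
    fix vs assume "cycle_labeling vs H"
    from cycle_labelingD(2-4)[OF this] show ?thesis by simp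
  qed
  then show "inj_on (tail S) (arcs H)" "inj_on (head S) (arcs H)" "finite (verts H)"
    unfolding disjoint_graph_unionD(1,2)[OF union assms, symmetric] by auto
qed

lemma inj_tail: "inj_on (tail S) (arcs S)"
proof (rule inj_onI)
  fix e e' assume e: "e \<in> arcs S" "e' \<in> arcs S" "tail S e = tail S e'"
  obtain H where H: "H \<in> Ps \<union> Cs" "tail S e \<in> verts H"
    using ex_component arc_in_verts[OF e(1)] by blast
  then have "e \<in> arcs H" "e' \<in> arcs H" using disjoint_graph_unionD(5)[OF union H(1)] e by auto
  with component_props(1)[OF H(1)] e(3) show "e = e'" by (simp add: inj_on_def)
qed

lemma inj_head: "inj_on (head S) (arcs S)"
proof (rule inj_onI)
  fix e e' assume e: "e \<in> arcs S" "e' \<in> arcs S" "head S e = head S e'"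
  obtain H where H: "H \<in> Ps \<union> Cs" "head S e \<in> verts H"
    using ex_component arc_in_verts[OF e(1)] by blast
  then have "e \<in> arcs H" "e' \<in> arcs H" using disjoint_graph_unionD(6)[OF union H(1)] e by auto
  with component_props(2)[OF H(1)] e(3) show "e = e'" by (simp add: inj_on_def)
qed

lemma finite_verts: "finite (verts S)"
proof -
  have "verts S = (\<Union>H\<in>Ps \<union> Cs. verts H)" using union by (simp add: disjoint_graph_union_def)
  then show ?thesis using fin component_props(3) by simp
qed

lemma tail_arcs_component:
  assumes "H \<in> Ps \<union> Cs"
  shows "verts H - tail S ` arcs S = verts H - tail H ` arcs H"
    "verts H - head S ` arcs S = verts H - head H ` arcs H"
  using disjoint_graph_unionD[OF union assms] by auto

lemma path_ends:
  assumes "P \<in> Ps" "path_labeling vs P"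
  shows "verts P - tail S ` arcs S = {last vs}" "verts P - head S ` arcs S = {hd vs}"
  using tail_arcs_component[of P] assms path_labelingD[OF assms(2)] by auto

lemma cycle_ends:
  assumes "C \<in> Cs"
  shows "verts C - tail S ` arcs S = {}" "verts C - head S ` arcs S = {}"
proof -
  obtain vs where "cycle_labeling vs C" using cycle[OF assms] unfolding cycle_graph_def by blast
  from cycle_labelingD(5,6)[OF this] tail_arcs_component[of C] assms
  show "verts C - tail S ` arcs S = {}" "verts C - head S ` arcs S = {}" by auto
qed

lemma last_unmatched:
  assumes "P \<in> Ps" "path_labeling vs P"
  shows "last vs \<in> verts S - tail S ` arcs S"
proof -
  have "last vs \<in> verts P - tail S ` arcs S" unfolding path_ends(1)[OF assms] by simp
  moreover have "verts P \<subseteq> verts S" using disjoint_graph_unionD(3)[OF union] assms(1) by simp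
  ultimately show ?thesis by auto
qed

lemma ex_path_last:
  assumes v: "v \<in> verts S - tail S ` arcs S"
  shows "\<exists>vs P. P \<in> Ps \<and> path_labeling vs P \<and> v = last vs"
proof -
  obtain H where H: "H \<in> Ps \<union> Cs" "v \<in> verts H" using v ex_component by blast
  with v cycle_ends(1) have P: "H \<in> Ps" by blast
  with path obtain vs where vs: "path_labeling vs H" unfolding path_graph_def by blast
  from path_ends(1)[OF P vs] H(2) v have "v = last vs" by blast
  with P vs show ?thesis by blast
qed

lemma hd_unmatched:
  assumes "P \<in> Ps" "path_labeling vs P"
  shows "hd vs \<in> verts S - head S ` arcs S"
proof -
  have "hd vs \<in> verts P - head S ` arcs S" unfolding path_ends(2)[OF assms] by simp
  moreover have "verts P \<subseteq> verts S" using disjoint_graph_unionD(3)[OF union] assms(1) by simp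
  ultimately show ?thesis by auto
qed

lemma ex_path_hd:
  assumes v: "v \<in> verts S - head S ` arcs S"
  shows "\<exists>vs P. P \<in> Ps \<and> path_labeling vs P \<and> v = hd vs"
proof -
  obtain H where H: "H \<in> Ps \<union> Cs" "v \<in> verts H" using v ex_component by blast
  with v cycle_ends(2) have P: "H \<in> Ps" by blast
  with path obtain vs where vs: "path_labeling vs H" unfolding path_graph_def by blast
  from path_ends(2)[OF P vs] H(2) v have "v = hd vs" by blast
  with P vs show ?thesis by blast
qed

text \<open>Paths correspond to the vertices without outgoing arc, and the other vertices correspond
  to the arcs through their tails.\<close>

lemma card_verts: "card (verts S) = m + card (arcs S)"
proof -
  \<comment> \<open>A path is mapped to its last vertex; the description by \<open>THE\<close> needs
    no choice of a labeling.\<close>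
  have "bij_betw (\<lambda>P. THE v. v \<in> verts P - tail S ` arcs S) Ps (verts S - tail S ` arcs S)"
  proof (rule bij_betw_imageI)
    let ?f = "\<lambda>P. THE v. v \<in> verts P - tail S ` arcs S"
    have f: "?f P = last vs" "last vs \<in> verts P" if "P \<in> Ps" "path_labeling vs P" for P vs
      using path_ends(1)[OF that] by auto
    show "inj_on ?f Ps"
    proof (rule inj_onI)
      fix P P' assume P: "P \<in> Ps" "P' \<in> Ps" "?f P = ?f P'"
      obtain vs where vs: "path_labeling vs P" using path[OF P(1)] unfolding path_graph_def by blast
      obtain vs' where vs': "path_labeling vs' P'" using path[OF P(2)] unfolding path_graph_def by blast
      have "last vs = last vs'" using f(1)[OF P(1) vs] f(1)[OF P(2) vs'] P(3) by simp
      with f(2)[OF P(1) vs] f(2)[OF P(2) vs'] P(1,2) show "P = P'"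
        by (intro disjoint_graph_union_eq[OF union, of P P' "last vs"]) simp_all
    qed
    show "?f ` Ps = verts S - tail S ` arcs S"
    proof (intro equalityI subsetI)
      fix v assume "v \<in> ?f ` Ps"
      then obtain P where P: "P \<in> Ps" "v = ?f P" by (elim imageE)
      obtain vs where vs: "path_labeling vs P" using path[OF P(1)] unfolding path_graph_def by blast
      show "v \<in> verts S - tail S ` arcs S"
        using last_unmatched[OF P(1) vs] f(1)[OF P(1) vs] P(2) by simp
    next
      fix v assume "v \<in> verts S - tail S ` arcs S"
      from ex_path_last[OF this] obtain vs P where *: "P \<in> Ps" "path_labeling vs P" "v = last vs"
        by (elim exE conjE)
      then have "v = ?f P" using f(1)[OF *(1,2)] by simp
      then show "v \<in> ?f ` Ps" using *(1) by (rule image_eqI)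
    qed
  qed
  then have "card Ps = card (verts S - tail S ` arcs S)" by (rule bij_betw_same_card)
  then have "card (verts S - tail S ` arcs S) = m" using card_Ps by simp
  moreover have sub: "tail S ` arcs S \<subseteq> verts S" using arc_in_verts by auto
  moreover have "card (tail S ` arcs S) = card (arcs S)" by (rule card_image[OF inj_tail])
  moreover have "card (verts S - tail S ` arcs S) = card (verts S) - card (tail S ` arcs S)"
    by (rule card_Diff_subset[OF finite_subset[OF sub finite_verts] sub])
  moreover have "card (tail S ` arcs S) \<le> card (verts S)" by (rule card_mono[OF finite_verts sub])
  ultimately show ?thesis by linarith
qed

end

text \<open>The definition ranges over all decompositions of \<open>S\<close>; having no outgoing
  arc characterizes the last vertices in each of them alike.\<close>

lemma sink_verts_eq:
  assumes "path_cycle_decomposition m S Ps Cs"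
  shows "sink_verts m S = verts S - tail S ` arcs S"
proof (intro equalityI subsetI)
  fix v assume "v \<in> sink_verts m S"
  then obtain vs P Ps' Cs' where *: "path_cycle_decomposition m S Ps' Cs'" "P \<in> Ps'"
      "path_labeling vs P" "v = last vs"
    unfolding sink_verts_def by blast
  interpret decomposed m S Ps' Cs' by unfold_locales (rule *(1))
  show "v \<in> verts S - tail S ` arcs S" using last_unmatched[OF *(2,3)] *(4) by simp
next
  interpret decomposed m S Ps Cs by unfold_locales (rule assms)
  fix v assume "v \<in> verts S - tail S ` arcs S"
  from ex_path_last[OF this] obtain vs P where *: "P \<in> Ps" "path_labeling vs P" "v = last vs"
    by (elim exE conjE)
  show "v \<in> sink_verts m S"
    unfolding sink_verts_def
    by (rule CollectI, rule exI[of _ vs], rule exI[of _ P], rule exI[of _ Ps], rule exI[of _ Cs])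
      (simp add: * assms)
qed

lemma source_verts_eq:
  assumes "path_cycle_decomposition m S Ps Cs"
  shows "source_verts m S = verts S - head S ` arcs S"
proof (intro equalityI subsetI)
  fix v assume "v \<in> source_verts m S"
  then obtain vs P Ps' Cs' where *: "path_cycle_decomposition m S Ps' Cs'" "P \<in> Ps'"
      "path_labeling vs P" "v = hd vs"
    unfolding source_verts_def by blast
  interpret decomposed m S Ps' Cs' by unfold_locales (rule *(1))
  show "v \<in> verts S - head S ` arcs S" using hd_unmatched[OF *(2,3)] *(4) by simp
next
  interpret decomposed m S Ps Cs by unfold_locales (rule assms)
  fix v assume "v \<in> verts S - head S ` arcs S"
  from ex_path_hd[OF this] obtain vs P where *: "P \<in> Ps" "path_labeling vs P" "v = hd vs"
    by (elim exE conjE)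
  show "v \<in> source_verts m S"
    unfolding source_verts_def
    by (rule CollectI, rule exI[of _ vs], rule exI[of _ P], rule exI[of _ Ps], rule exI[of _ Cs])
      (simp add: * assms)
qed

text \<open>A new arc fuses the components in \<open>X\<close>, which contain its ends, into
  \<open>Q\<close>. Taking \<open>X\<close> as a set covers at once an arc that joins two components
  and an arc that stays within one.\<close>

lemma disjoint_graph_union_merge:
  assumes U: "disjoint_graph_union \<lparr>verts = V, arcs = A, tail = t, head = h\<rparr> K (\<lambda>H. H)"
    and X: "X \<subseteq> K" and e: "t e \<in> (\<Union>H\<in>X. verts H)" "h e \<in> (\<Union>H\<in>X. verts H)"
    and Q: "Q = \<lparr>verts = (\<Union>H\<in>X. verts H), arcs = insert e (\<Union>H\<in>X. arcs H), tail = t, head = h\<rparr>"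
  shows "disjoint_graph_union \<lparr>verts = V, arcs = insert e A, tail = t, head = h\<rparr> (insert Q (K - X)) (\<lambda>H. H)"
proof -
  have V: "V = (\<Union>H\<in>K. verts H)" and A: "A = (\<Union>H\<in>K. arcs H)"
    and disj: "\<And>H H'. \<lbrakk>H \<in> K; H' \<in> K; H \<noteq> H'\<rbrakk> \<Longrightarrow> verts H \<inter> verts H' = {}"
    and sub: "\<And>H. H \<in> K \<Longrightarrow> subgraph H \<lparr>verts = V, arcs = A, tail = t, head = h\<rparr>"
    using U by (auto simp: disjoint_graph_union_def disjoint_family_on_def)
  have th: "tail H = t" "head H = h" if "H \<in> K" for H
    using sub[OF that] by (auto simp: subgraph_def compatible_def)
  have wfH: "t a \<in> verts H" "h a \<in> verts H" if "H \<in> K" "a \<in> arcs H" for H a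
    using sub[OF that(1)] th[OF that(1)] that(2) by (auto simp: subgraph_def wf_digraph_def)
  have eV: "t e \<in> V" "h e \<in> V" using e X V by auto
  have "t a \<in> V" "h a \<in> V" if a: "a \<in> A" for a
  proof -
    obtain H where "H \<in> K" "a \<in> arcs H" using a unfolding A by blast
    from wfH[OF this] \<open>H \<in> K\<close> show "t a \<in> V" "h a \<in> V" unfolding V by blast+
  qed
  with eV have wf: "wf_digraph \<lparr>verts = V, arcs = insert e A, tail = t, head = h\<rparr>"
    unfolding wf_digraph_def by simp
  have "t a \<in> (\<Union>H\<in>X. verts H)" "h a \<in> (\<Union>H\<in>X. verts H)" if a: "a \<in> (\<Union>H\<in>X. arcs H)" for a
  proof -
    obtain H where H: "H \<in> X" "a \<in> arcs H" using a by blast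
    then have "H \<in> K" using X by blast
    from wfH[OF this H(2)] H(1) show "t a \<in> (\<Union>H\<in>X. verts H)" "h a \<in> (\<Union>H\<in>X. verts H)" by blast+
  qed
  with e have wfQ: "wf_digraph Q"
    unfolding wf_digraph_def Q by auto
  show ?thesis
    unfolding disjoint_graph_union_def
  proof (intro conjI ballI)
    fix H assume "H \<in> insert Q (K - X)"
    then consider "H = Q" | "H \<in> K" by blast
    then show "subgraph H \<lparr>verts = V, arcs = insert e A, tail = t, head = h\<rparr>"
    proof cases
      case 1
      have "verts Q \<subseteq> V" "arcs Q \<subseteq> insert e A" using Q V A X by auto
      then show ?thesis using 1 wf wfQ Q by (simp add: subgraph_def compatible_def)
    next
      case 2
      then show ?thesis using sub[OF 2] wf by (auto simp: subgraph_def compatible_def)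
    qed
  next
    have "verts Q \<inter> verts H = {}" if H: "H \<in> K - X" for H
    proof -
      have "verts H' \<inter> verts H = {}" if "H' \<in> X" for H'
        using disj[of H' H] H X that by blast
      then show ?thesis by (auto simp: Q)
    qed
    then show "disjoint_family_on verts (insert Q (K - X))"
      using disj unfolding disjoint_family_on_def by blast
    show "verts \<lparr>verts = V, arcs = insert e A, tail = t, head = h\<rparr> = (\<Union>H\<in>insert Q (K - X). verts H)"
      using X by (auto simp: V Q)
    show "arcs \<lparr>verts = V, arcs = insert e A, tail = t, head = h\<rparr> = (\<Union>H\<in>insert Q (K - X). arcs H)"
      using X by (auto simp: A Q)
  qed
qed

lemma path_graph_not_cycle_graph: "path_labeling vs H \<Longrightarrow> \<not> cycle_graph H"
proof
  assume P: "path_labeling vs H" and "cycle_graph H"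
  then obtain ws where C: "cycle_labeling ws H" by (auto simp: cycle_graph_def)
  have "last vs \<in> verts H" using path_labelingD(1,2)[OF P] by simp
  with path_labelingD(5)[OF P] cycle_labelingD(5)[OF C] show False by auto
qed

text \<open>Insert the arcs one by one. Injectivity of \<open>t\<close> and \<open>h\<close> makes
  the new arc run from the last vertex of a path to the first vertex of a path: within one path it
  closes a cycle, otherwise it concatenates two paths. The number of paths is left as
  \<open>card Ps\<close>, to be determined by counting afterwards.\<close>

lemma ex_path_cycle_decomposition:
  fixes t h :: "'b \<Rightarrow> 'a"
  assumes "finite A" "finite V" "inj_on t A" "inj_on h A" "t ` A \<subseteq> V" "h ` A \<subseteq> V"
  shows "\<exists>Ps Cs. path_cycle_decomposition (card Ps) \<lparr>verts = V, arcs = A, tail = t, head = h\<rparr> Ps Cs"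
  using assms
proof (induction A rule: finite_induct)
  case empty
  define Ps :: "('a, 'b) pre_digraph set" where
    "Ps = (\<lambda>v. \<lparr>verts = {v}, arcs = {}, tail = t, head = h\<rparr>) ` V"
  have "path_graph P" if P: "P \<in> Ps" for P
  proof -
    obtain v where "P = \<lparr>verts = {v}, arcs = {}, tail = t, head = h\<rparr>" using P by (auto simp: Ps_def)
    then have "path_labeling [v] P" by (simp add: path_labeling_def arcs_ends_def)
    then show ?thesis by (auto simp: path_graph_def)
  qed
  moreover have "disjoint_graph_union \<lparr>verts = V, arcs = {}, tail = t, head = h\<rparr> Ps (\<lambda>H. H)"
    unfolding disjoint_graph_union_def disjoint_family_on_def
    by (auto simp: Ps_def subgraph_def compatible_def wf_digraph_def)
  moreover have "finite Ps" using empty.prems(1) by (simp add: Ps_def)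
  ultimately have "path_cycle_decomposition (card Ps) \<lparr>verts = V, arcs = {}, tail = t, head = h\<rparr> Ps {}"
    unfolding path_cycle_decomposition_def by auto
  then show ?case by (intro exI)
next
  case (insert e A)
  let ?S = "\<lparr>verts = V, arcs = A, tail = t, head = h\<rparr>"
  have "\<exists>Ps Cs. path_cycle_decomposition (card Ps) ?S Ps Cs"
    by (rule insert.IH) (use insert.prems in auto)
  then obtain Ps Cs where dec: "path_cycle_decomposition (card Ps) ?S Ps Cs" by (elim exE)
  interpret decomposed "card Ps" ?S Ps Cs by unfold_locales (rule dec)
  have "t e \<in> V - t ` A" "h e \<in> V - h ` A" using insert.prems insert.hyps(2) by (auto simp: inj_on_def)
  then have te: "t e \<in> verts ?S - tail ?S ` arcs ?S" and he: "h e \<in> verts ?S - head ?S ` arcs ?S" by simp_all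
  from ex_path_last[OF te] obtain vs P where P: "P \<in> Ps" "path_labeling vs P" "t e = last vs"
    by (elim exE conjE)
  from ex_path_hd[OF he] obtain ws R where R: "R \<in> Ps" "path_labeling ws R" "h e = hd ws"
    by (elim exE conjE)
  have notC: "P \<notin> Cs" "R \<notin> Cs"
    using path_graph_not_cycle_graph[OF P(2)] path_graph_not_cycle_graph[OF R(2)] cycle by auto
  have vP: "vs \<noteq> []" "distinct vs" "verts P = set vs" "arcs_ends P = succs vs"
    and vR: "ws \<noteq> []" "distinct ws" "verts R = set ws" "arcs_ends R = succs ws"
    using P(2) R(2) by (auto simp: path_labeling_def succs_def)
  have arcsPR: "arcs P \<subseteq> A" "arcs R \<subseteq> A" "tail P = t" "head P = h" "tail R = t" "head R = h"
    using disjoint_graph_unionD[OF union, of P] disjoint_graph_unionD[OF union, of R] P R by auto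
  define Q where "Q = \<lparr>verts = verts P \<union> verts R, arcs = insert e (arcs P \<union> arcs R), tail = t, head = h\<rparr>"
  \<comment> \<open>If \<open>P = R\<close>, the set \<open>{P, R}\<close> is a singleton and
    \<open>Q\<close> is that path with one more arc.\<close>
  have U: "disjoint_graph_union \<lparr>verts = V, arcs = insert e A, tail = t, head = h\<rparr>
      (insert Q ((Ps \<union> Cs) - {P, R})) (\<lambda>H. H)"
    by (rule disjoint_graph_union_merge[OF union]) (use P R vP vR in \<open>auto simp: Q_def\<close>)
  have "inj_on (arc_to_ends Q) (arcs Q)"
  proof (rule inj_onI)
    fix a b assume "a \<in> arcs Q" "b \<in> arcs Q" "arc_to_ends Q a = arc_to_ends Q b"
    then have "a \<in> insert e A" "b \<in> insert e A" "t a = t b"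
      using arcsPR by (auto simp: Q_def arc_to_ends_def)
    with inj_onD[OF insert.prems(2)] show "a = b" by simp
  qed
  moreover have "arcs_ends Q = insert (last vs, hd ws) (succs vs \<union> succs ws)"
    unfolding vP(4)[symmetric] vR(4)[symmetric] using arcsPR P(3) R(3)
    by (simp add: Q_def arcs_ends_def arc_to_ends_def image_Un)
  ultimately have Q: "inj_on (arc_to_ends Q) (arcs Q)"
    "arcs_ends Q = insert (last vs, hd ws) (succs vs \<union> succs ws)" by auto
  show ?case
  proof (cases "P = R")
    case True
    have "{hd ws} = {hd vs}"
      using path_ends(2)[OF R(1,2)] path_ends(2)[OF P(1,2)] True by simp
    moreover have "succs ws = succs vs" using vP(4) vR(4) True by simp
    ultimately have "cycle_labeling vs Q"
      using Q vP True by (auto simp: cycle_labeling_def Q_def succs_def)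
    then have "cycle_graph Q" by (auto simp: cycle_graph_def)
    moreover have "insert Q ((Ps \<union> Cs) - {P, R}) = (Ps - {P}) \<union> insert Q Cs"
      using notC True by auto
    ultimately have "path_cycle_decomposition (card (Ps - {P}))
        \<lparr>verts = V, arcs = insert e A, tail = t, head = h\<rparr> (Ps - {P}) (insert Q Cs)"
      using U fin path cycle unfolding path_cycle_decomposition_def by auto
    then show ?thesis by (intro exI)
  next
    case False
    have "verts P \<inter> verts R = {}"
      using disjoint_graph_union_eq[OF union, of P R] P(1) R(1) False by auto
    then have "path_labeling (vs @ ws) Q"
      using Q vP vR succs_append[OF vP(1) vR(1)]
      unfolding path_labeling_def succs_def[of "vs @ ws", symmetric] by (auto simp: Q_def)
    then have "path_graph Q" by (auto simp: path_graph_def)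
    moreover have "insert Q ((Ps \<union> Cs) - {P, R}) = insert Q (Ps - {P, R}) \<union> Cs"
      using notC by auto
    ultimately have "path_cycle_decomposition (card (insert Q (Ps - {P, R})))
        \<lparr>verts = V, arcs = insert e A, tail = t, head = h\<rparr> (insert Q (Ps - {P, R})) Cs"
      using U fin path cycle unfolding path_cycle_decomposition_def by auto
    then show ?thesis by (intro exI)
  qed
qed

text \<open>Each inserted arc uses up one path, so the cardinalities fix the number of paths. By
  this criterion a multi-colored subgraph is just a set of \<open>n\<close> arcs with distinct
  tails, heads and colors.\<close>

lemma path_cycle_decomposition_iff:
  assumes "wf_digraph S" "finite (verts S)" "finite (arcs S)"
  shows "(\<exists>Ps Cs. path_cycle_decomposition m S Ps Cs) \<longleftrightarrow>
    inj_on (tail S) (arcs S) \<and> inj_on (head S) (arcs S) \<and> card (verts S) = m + card (arcs S)"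
proof
  assume "\<exists>Ps Cs. path_cycle_decomposition m S Ps Cs"
  then obtain Ps Cs where dec: "path_cycle_decomposition m S Ps Cs" by (elim exE)
  interpret decomposed m S Ps Cs by unfold_locales (rule dec)
  show "inj_on (tail S) (arcs S) \<and> inj_on (head S) (arcs S) \<and> card (verts S) = m + card (arcs S)"
    using inj_tail inj_head card_verts by simp
next
  assume *: "inj_on (tail S) (arcs S) \<and> inj_on (head S) (arcs S) \<and> card (verts S) = m + card (arcs S)"
  have "\<exists>Ps Cs. path_cycle_decomposition (card Ps)
      \<lparr>verts = verts S, arcs = arcs S, tail = tail S, head = head S\<rparr> Ps Cs"
    by (rule ex_path_cycle_decomposition) (use * assms in \<open>auto simp: wf_digraph_def\<close>)
  also have "\<lparr>verts = verts S, arcs = arcs S, tail = tail S, head = head S\<rparr> = S" by (cases S) simp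
  finally obtain Ps Cs where dec: "path_cycle_decomposition (card Ps) S Ps Cs" by (elim exE)
  interpret decomposed "card Ps" S Ps Cs by unfold_locales (rule dec)
  have "card Ps = m" using card_verts * by simp
  with dec show "\<exists>Ps Cs. path_cycle_decomposition m S Ps Cs" by auto
qed

subsection \<open>Signs and cycle graphs of permutations\<close>

lemma orbit_eq_if_mem:
  assumes "\<sigma> permutes S" "finite S" "y \<in> orbit \<sigma> x"
  shows "orbit \<sigma> y = orbit \<sigma> x"
  using orbit_cyclic_eq3[OF cyclic_on_orbit[OF assms(1,2)] assms(3)] .

lemma self_mem_orbit:
  assumes "\<sigma> permutes S" "finite S"
  shows "x \<in> orbit \<sigma> x"
  by (rule permutation_self_in_orbit) (use assms in \<open>auto intro: permutes_imp_permutation\<close>)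

text \<open>\<open>\<tau>\<close> is \<open>\<sigma>\<close> with the point \<open>a\<close> cut out
  of its cycle: the predecessor of \<open>a\<close> is sent to the successor of
  \<open>a\<close>.\<close>

lemma orbit_bypass:
  fixes \<sigma> \<tau> :: "'a \<Rightarrow> 'a"
  assumes S: "a \<notin> S" and ne: "\<sigma> a \<noteq> a" and x: "x \<in> S" and \<tau>: "\<tau> permutes S"
    and \<tau>_eq: "\<And>y. y \<noteq> a \<Longrightarrow> \<tau> y = (if \<sigma> y = a then \<sigma> a else \<sigma> y)"
  shows "orbit \<tau> x = orbit \<sigma> x - {a}"
proof -
  have sub: "orbit \<tau> x \<subseteq> S" by (rule permutes_orbit_subset[OF \<tau> x])
  have "y \<in> orbit \<sigma> x" if "y \<in> orbit \<tau> x" for y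
    using that
  proof (induction rule: orbit.induct)
    case base
    have "x \<noteq> a" using x S by auto
    from \<tau>_eq[OF this] show ?case
      using orbit.base[of \<sigma> x] orbit.step[of "\<sigma> x" \<sigma> x] by (auto split: if_splits)
  next
    case (step y)
    then have "y \<noteq> a" using sub S by auto
    from \<tau>_eq[OF this] show ?case
      using orbit.step[OF step.IH] orbit.step[OF orbit.step[OF step.IH]] by (auto split: if_splits)
  qed
  \<comment> \<open>The \<open>\<sigma>\<close>-orbit may pass through \<open>a\<close>, which
    \<open>\<tau>\<close> skips; the conditional replaces this position by the next one.\<close>
  moreover have "(if y = a then \<sigma> a else y) \<in> orbit \<tau> x" if "y \<in> orbit \<sigma> x" for y
    using that
  proof (induction rule: orbit.induct)
    case base
    have "x \<noteq> a" using x S by auto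
    from \<tau>_eq[OF this] show ?case using orbit.base[of \<tau> x] by simp
  next
    case (step y)
    show ?case
    proof (cases "y = a")
      case True
      then show ?thesis using step.IH ne by simp
    next
      case False
      with step.IH have "y \<in> orbit \<tau> x" by simp
      from orbit.step[OF this] show ?thesis unfolding \<tau>_eq[OF False] .
    qed
  qed
  ultimately show ?thesis using sub S by (auto split: if_splits) (metis (full_types))
qed

text \<open>Remove a point \<open>a\<close>. A fixed point accounts for one element and one orbit
  and leaves the sign alone; otherwise a transposition bypasses \<open>a\<close>, which flips the
  sign and loses one element but no orbit.\<close>

lemma sign_eq_card_orbits:
  assumes "finite S" "\<sigma> permutes S"
  shows "sign \<sigma> = (- 1) ^ (card S + card (orbit \<sigma> ` S))"
  using assms
proof (induction S arbitrary: \<sigma> rule: finite_induct)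
  case empty
  then have "\<sigma> = id" by (simp add: permutes_empty)
  then show ?case by (simp add: sign_id)
next
  case (insert a S)
  note fin = insert.hyps(1) and a = insert.hyps(2) and \<sigma> = insert.prems
  show ?case
  proof (cases "\<sigma> a = a")
    case True
    have \<sigma>S: "\<sigma> permutes S"
      by (rule permutes_superset[OF \<sigma>]) (use True in auto)
    have "orbit \<sigma> a = {a}" using True by (simp add: orbit_eq_singleton_iff)
    moreover have "orbit \<sigma> x \<subseteq> S" if "x \<in> S" for x by (rule permutes_orbit_subset[OF \<sigma>S that])
    ultimately have "card (orbit \<sigma> ` insert a S) = Suc (card (orbit \<sigma> ` S))"
      using a fin by (subst image_insert, subst card_insert_disjoint) auto
    then show ?thesis using insert.IH[OF \<sigma>S] a fin by simp
  next
    case False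
    define \<tau> where "\<tau> = transpose a (\<sigma> a) \<circ> \<sigma>"
    have \<tau>_eq: "\<tau> y = (if \<sigma> y = a then \<sigma> a else \<sigma> y)" if "y \<noteq> a" for y
      using that permutes_inj[OF \<sigma>] by (auto simp: \<tau>_def transpose_def dest: injD)
    have b: "\<sigma> a \<in> S" using permutes_in_image[OF \<sigma>, of a] False by auto
    have \<tau>: "\<tau> permutes S"
    proof (rule permutes_superset)
      show "\<tau> permutes insert a S"
        unfolding \<tau>_def by (intro permutes_compose[OF \<sigma>] permutes_swap_id) (use b in auto)
    qed (auto simp: \<tau>_def)
    have "sign \<tau> = sign (transpose a (\<sigma> a)) * sign \<sigma>"
      unfolding \<tau>_def by (rule sign_compose) (use permutes_imp_permutation[OF _ \<sigma>] fin in \<open>auto simp: permutation_swap_id\<close>)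
    then have sgn: "sign \<sigma> = - sign \<tau>" using False by (simp add: sign_swap_id)
    have fin': "finite (insert a S)" using fin by simp
    have orb: "orbit \<tau> x = orbit \<sigma> x - {a}" if "x \<in> S" for x
      by (rule orbit_bypass[OF a False that \<tau> \<tau>_eq])
    have "orbit \<sigma> a = orbit \<sigma> (\<sigma> a)"
      by (rule orbit_eq_if_mem[OF \<sigma> fin', symmetric]) (rule orbit.base)
    then have "orbit \<sigma> ` insert a S = orbit \<sigma> ` S" using b by auto
    moreover have "orbit \<tau> ` S = (\<lambda>X. X - {a}) ` orbit \<sigma> ` S"
      unfolding image_image using orb by (rule image_cong[OF refl])
    \<comment> \<open>Orbits stay distinct without \<open>a\<close>, since each of them contains a
      point of \<open>S\<close>.\<close>
    moreover have "inj_on (\<lambda>X. X - {a}) (orbit \<sigma> ` S)"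
    proof (rule inj_onI, clarify)
      fix x y assume xy: "x \<in> S" "y \<in> S" "orbit \<sigma> x - {a} = orbit \<sigma> y - {a}"
      have "x \<in> orbit \<sigma> x - {a}" using self_mem_orbit[OF \<sigma> fin', of x] xy(1) a by auto
      then have "x \<in> orbit \<sigma> y" using xy(3) by auto
      from orbit_eq_if_mem[OF \<sigma> fin' this] show "orbit \<sigma> x = orbit \<sigma> y" .
    qed
    ultimately have "card (orbit \<sigma> ` insert a S) = card (orbit \<tau> ` S)"
      by (simp add: card_image)
    then show ?thesis using insert.IH[OF \<tau>] sgn a fin by simp
  qed
qed

text \<open>The points of the permutation are renamed by \<open>c\<close>; \<open>W\<close> may
  contain further vertices, which are isolated and contribute no cycle.\<close>

locale permutation_graph =
  fixes N :: "'i set" and \<rho> :: "'i \<Rightarrow> 'i" and c :: "'i \<Rightarrow> 'a" and W :: "'a set"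
  assumes fin: "finite N" and perm: "\<rho> permutes N" and inj: "inj_on c N" and cW: "c ` N \<subseteq> W"
begin

definition perm_arcs :: "'i set \<Rightarrow> ('a \<times> 'a) set" where
  "perm_arcs X = (\<lambda>i. (c i, c (\<rho> i))) ` X"

definition G :: "('a, 'a \<times> 'a) pre_digraph" where
  "G = \<lparr>verts = W, arcs = perm_arcs N, tail = fst, head = snd\<rparr>"

definition orbit_graph :: "'i set \<Rightarrow> ('a, 'a \<times> 'a) pre_digraph" where
  "orbit_graph X = \<lparr>verts = c ` X, arcs = perm_arcs X, tail = fst, head = snd\<rparr>"

lemma \<rho>_mem: "i \<in> N \<Longrightarrow> \<rho> i \<in> N"
  using permutes_in_image[OF perm] by simp

lemma wf_G: "wf_digraph G"
  unfolding wf_digraph_def G_def perm_arcs_def using cW \<rho>_mem by auto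

lemma funpow_mem: "x \<in> N \<Longrightarrow> (\<rho> ^^ k) x \<in> N"
  by (induction k) (auto simp: \<rho>_mem)

lemma orbit_subset: "x \<in> N \<Longrightarrow> orbit \<rho> x \<subseteq> N"
  by (rule permutes_orbit_subset[OF perm])

lemma orbit_graph_subgraph:
  assumes "x \<in> N"
  shows "subgraph (orbit_graph (orbit \<rho> x)) G"
proof -
  have sub: "orbit \<rho> x \<subseteq> N" by (rule orbit_subset[OF assms])
  then have "perm_arcs (orbit \<rho> x) \<subseteq> perm_arcs N" "c ` orbit \<rho> x \<subseteq> W"
    using cW by (auto simp: perm_arcs_def)
  moreover have "wf_digraph (orbit_graph (orbit \<rho> x))"
    unfolding wf_digraph_def orbit_graph_def perm_arcs_def by (auto intro: orbit.step)
  ultimately show ?thesis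
    using wf_G by (simp add: subgraph_def compatible_def orbit_graph_def G_def)
qed

lemma orbit_graph_cycle:
  assumes x: "x \<in> N"
  shows "cycle_graph (orbit_graph (orbit \<rho> x))"
proof -
  have self: "x \<in> orbit \<rho> x" by (rule self_mem_orbit[OF perm fin])
  define d where "d = funpow_dist1 \<rho> x x"
  have d: "d > 0" "(\<rho> ^^ d) x = x" using funpow_dist1_prop[OF self] by (simp_all only: d_def)
  define vs where "vs = map (\<lambda>k. c ((\<rho> ^^ k) x)) [0..<d]"
  have orb: "orbit \<rho> x = (\<lambda>k. (\<rho> ^^ k) x) ` {0..<d}"
    unfolding d_def by (rule orbit_conv_funpow_dist1[OF self])
  have "inj_on (\<lambda>k. (\<rho> ^^ k) x) {0..<d}"
    unfolding d_def by (rule inj_on_funpow_dist1[OF self])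
  then have "inj_on (c \<circ> (\<lambda>k. (\<rho> ^^ k) x)) {0..<d}"
    by (rule comp_inj_on) (use inj_on_subset[OF inj orbit_subset[OF x]] orb in simp)
  then have dist: "distinct vs" by (simp add: vs_def distinct_map comp_def)
  have ne: "vs \<noteq> []" using d by (simp add: vs_def)
  have set: "set vs = c ` orbit \<rho> x" by (auto simp: vs_def orb)
  have last: "last vs = c ((\<rho> ^^ (d - 1)) x)" and hd: "hd vs = c x"
    using d ne by (simp_all add: vs_def last_conv_nth hd_conv_nth)
  have "perm_arcs (orbit \<rho> x) = (\<lambda>k. (c ((\<rho> ^^ k) x), c ((\<rho> ^^ Suc k) x))) ` {0..<d}"
    by (simp add: perm_arcs_def orb image_image)
  \<comment> \<open>The last index gives the arc that closes the cycle, the others the consecutive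
    pairs.\<close>
  also have "{0..<d} = insert (d - 1) {0..<d - 1}" using d by auto
  also have "(\<lambda>k. (c ((\<rho> ^^ k) x), c ((\<rho> ^^ Suc k) x))) ` insert (d - 1) {0..<d - 1} =
      {(vs ! k, vs ! Suc k) | k. Suc k < length vs} \<union> {(last vs, hd vs)}"
  proof -
    have "\<rho> ((\<rho> ^^ (d - 1)) x) = x" using d by (metis Suc_diff_1 comp_apply funpow.simps(2))
    moreover have "(\<lambda>k. (c ((\<rho> ^^ k) x), c ((\<rho> ^^ Suc k) x))) ` {0..<d - 1} =
        {(vs ! k, vs ! Suc k) | k. Suc k < length vs}"
    proof (intro equalityI subsetI)
      fix e assume "e \<in> (\<lambda>k. (c ((\<rho> ^^ k) x), c ((\<rho> ^^ Suc k) x))) ` {0..<d - 1}"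
      then obtain k where "k < d - 1" "e = (c ((\<rho> ^^ k) x), c ((\<rho> ^^ Suc k) x))" by auto
      then have "Suc k < length vs" "e = (vs ! k, vs ! Suc k)" by (auto simp: vs_def)
      then show "e \<in> {(vs ! k, vs ! Suc k) | k. Suc k < length vs}" by blast
    next
      fix e assume "e \<in> {(vs ! k, vs ! Suc k) | k. Suc k < length vs}"
      then obtain k where "Suc k < d" "e = (vs ! k, vs ! Suc k)" by (auto simp: vs_def)
      then have "k \<in> {0..<d - 1}" "e = (c ((\<rho> ^^ k) x), c ((\<rho> ^^ Suc k) x))" by (auto simp: vs_def)
      then show "e \<in> (\<lambda>k. (c ((\<rho> ^^ k) x), c ((\<rho> ^^ Suc k) x))) ` {0..<d - 1}" by blast
    qed
    ultimately show ?thesis by (simp add: last hd)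
  qed
  finally have "cycle_labeling vs (orbit_graph (orbit \<rho> x))"
    using ne dist set by (simp add: cycle_labeling_def orbit_graph_def arcs_ends_def arc_to_ends_def inj_on_def)
  then show ?thesis by (auto simp: cycle_graph_def)
qed

text \<open>Every vertex \<open>c i\<close> has exactly one outgoing arc, so a cycle that starts at
  \<open>c x\<close> is forced to follow the orbit of \<open>x\<close>.\<close>

lemma cycle_subgraph_eq_orbit_graph:
  assumes sub: "subgraph C G" and cyc: "cycle_graph C"
  shows "\<exists>x\<in>N. C = orbit_graph (orbit \<rho> x)"
proof -
  obtain vs where vs: "cycle_labeling vs C" using cyc unfolding cycle_graph_def by (elim exE)
  note D = cycle_labelingD[OF vs]
  have th: "tail C = fst" "head C = snd" and arcsC: "arcs C \<subseteq> perm_arcs N" and wfC: "wf_digraph C"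
    using sub by (auto simp: subgraph_def compatible_def G_def)
  have next_arc: "(c i, c (\<rho> i)) \<in> arcs C" if i: "i \<in> N" "c i \<in> verts C" for i
  proof -
    have "c i \<in> fst ` arcs C" using D(5) i(2) unfolding th by simp
    then obtain e where e: "c i = fst e" "e \<in> arcs C" by (elim imageE)
    then obtain j where j: "j \<in> N" "e = (c j, c (\<rho> j))" using arcsC by (auto simp: perm_arcs_def)
    with e(1) have "j = i" using inj_onD[OF inj, of j i] i(1) by simp
    with e(2) j(2) show ?thesis by simp
  qed
  have next_vert: "c (\<rho> i) \<in> verts C" if "i \<in> N" "c i \<in> verts C" for i
    using wf_digraph.head_in_verts[OF wfC next_arc[OF that]] by (simp add: th)
  have "hd vs \<in> tail C ` arcs C" unfolding D(5) D(2) using D(1) by simp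
  then obtain x where x: "x \<in> N" "hd vs = c x" using arcsC unfolding th perm_arcs_def by auto
  have self: "x \<in> orbit \<rho> x" by (rule self_mem_orbit[OF perm fin])
  have vs_nth: "k < length vs \<Longrightarrow> vs ! k = c ((\<rho> ^^ k) x)" for k
  proof (induction k)
    case 0
    then show ?case using x(2) D(1) by (simp add: hd_conv_nth)
  next
    case (Suc k)
    then have "(vs ! k, vs ! Suc k) \<in> arcs_ends C"
      using vs unfolding cycle_labeling_def by auto
    then have "(vs ! k, vs ! Suc k) \<in> arcs C"
      by (simp add: arcs_ends_def arc_to_ends_def th)
    then obtain j where j: "j \<in> N" "vs ! k = c j" "vs ! Suc k = c (\<rho> j)"
      using arcsC by (auto simp: perm_arcs_def)
    moreover have "vs ! k = c ((\<rho> ^^ k) x)" using Suc by simp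
    ultimately have "j = (\<rho> ^^ k) x"
      using inj_onD[OF inj, of j "(\<rho> ^^ k) x"] funpow_mem[OF x(1)] by simp
    with j(3) show ?case by simp
  qed
  have verts: "verts C = c ` orbit \<rho> x"
  proof (intro equalityI subsetI)
    fix v assume "v \<in> verts C"
    then obtain k where "k < length vs" "v = vs ! k" by (auto simp: D(2) in_set_conv_nth)
    then have "v = c ((\<rho> ^^ k) x)" using vs_nth by simp
    then show "v \<in> c ` orbit \<rho> x" using funpow_in_orbit[OF self] by blast
  next
    fix v assume "v \<in> c ` orbit \<rho> x"
    then obtain y where y: "y \<in> orbit \<rho> x" "v = c y" by auto
    from y(1) have "c y \<in> verts C"
    proof (induction rule: orbit.induct)
      case base
      have "c x \<in> verts C" using x(2) D(1,2) by (metis hd_in_set)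
      then show ?case by (rule next_vert[OF x(1)])
    next
      case (step y)
      have "y \<in> N" using step.hyps orbit_subset[OF x(1)] by auto
      then show ?case using step.IH by (rule next_vert)
    qed
    with y(2) show "v \<in> verts C" by simp
  qed
  have arcs: "arcs C = perm_arcs (orbit \<rho> x)"
  proof (intro equalityI subsetI)
    fix e assume e: "e \<in> arcs C"
    then obtain j where j: "j \<in> N" "e = (c j, c (\<rho> j))" using arcsC by (auto simp: perm_arcs_def)
    have "c j \<in> verts C" using wf_digraph.tail_in_verts[OF wfC e] by (simp add: th j(2))
    then obtain y where "y \<in> orbit \<rho> x" "c j = c y" unfolding verts by auto
    moreover from this have "j = y" using inj_onD[OF inj, of j y] j(1) orbit_subset[OF x(1)] by auto
    ultimately show "e \<in> perm_arcs (orbit \<rho> x)" using j(2) by (simp add: perm_arcs_def)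
  next
    fix e assume "e \<in> perm_arcs (orbit \<rho> x)"
    then obtain y where y: "y \<in> orbit \<rho> x" "e = (c y, c (\<rho> y))" by (auto simp: perm_arcs_def)
    have "y \<in> N" using y(1) orbit_subset[OF x(1)] by auto
    then show "e \<in> arcs C" unfolding y(2) by (rule next_arc) (use y(1) verts in simp)
  qed
  have "C = orbit_graph (orbit \<rho> x)"
    using verts arcs th by (cases C) (simp add: orbit_graph_def)
  with x(1) show ?thesis by blast
qed

lemma num_cycle_graphs_G: "num_cycle_graphs G = card (orbit \<rho> ` N)"
proof -
  have "{C. subgraph C G \<and> cycle_graph C} = orbit_graph ` orbit \<rho> ` N"
  proof (intro equalityI subsetI)
    fix C assume "C \<in> {C. subgraph C G \<and> cycle_graph C}"
    then obtain x where "x \<in> N" "C = orbit_graph (orbit \<rho> x)"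
      using cycle_subgraph_eq_orbit_graph[of C] by auto
    then show "C \<in> orbit_graph ` orbit \<rho> ` N" by simp
  qed (use orbit_graph_subgraph orbit_graph_cycle in auto)
  moreover have "inj_on orbit_graph (orbit \<rho> ` N)"
  proof (rule inj_onI, clarify)
    fix x y assume xy: "x \<in> N" "y \<in> N" "orbit_graph (orbit \<rho> x) = orbit_graph (orbit \<rho> y)"
    then have "c ` orbit \<rho> x = c ` orbit \<rho> y" by (simp add: orbit_graph_def)
    then show "orbit \<rho> x = orbit \<rho> y"
      using inj_on_image_eq_iff[OF inj orbit_subset orbit_subset] xy by simp
  qed
  ultimately show ?thesis by (simp add: num_cycle_graphs_def card_image)
qed

end

subsection \<open>Similarity classes and colored permutations\<close>

context rank_one_param
begin

definition Gr :: colored_graph where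
  "Gr = \<lparr>verts = {..<n + m},
     arcs = {(j, i, k). j < n + m \<and> i < n \<and> k < q \<and> g k i * h k j \<noteq> 0},
     tail = (\<lambda>(j, i, k). j), head = (\<lambda>(j, i, k). i)\<rparr>"

text \<open>Spanning subgraphs of \<open>Gr\<close> differ only in their arcs, so arc sets can stand
  for them.\<close>

definition spanning_sub :: "colored_arc set \<Rightarrow> colored_graph" where
  "spanning_sub A = \<lparr>verts = {..<n + m}, arcs = A, tail = (\<lambda>(j, i, k). j), head = (\<lambda>(j, i, k). i)\<rparr>"

abbreviation arc_color :: "colored_arc \<Rightarrow> nat" where "arc_color \<equiv> (\<lambda>(j, i, k). k)"
abbreviation arc_tail :: "colored_arc \<Rightarrow> nat" where "arc_tail \<equiv> (\<lambda>(j, i, k). j)"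
abbreviation arc_head :: "colored_arc \<Rightarrow> nat" where "arc_head \<equiv> (\<lambda>(j, i, k). i)"

lemma spanning_sub_simps [simp]:
  "verts (spanning_sub A) = {..<n + m}" "arcs (spanning_sub A) = A"
  "tail (spanning_sub A) = arc_tail" "head (spanning_sub A) = arc_head"
  by (simp_all add: spanning_sub_def)

lemma Gr_simps [simp]:
  "verts Gr = {..<n + m}" "tail Gr = arc_tail" "head Gr = arc_head"
  by (simp_all add: Gr_def)

lemma arcs_GrD:
  assumes "e \<in> arcs Gr"
  shows "arc_tail e < n + m" "arc_head e < n" "arc_color e < q"
    "g (arc_color e) (arc_head e) * h (arc_color e) (arc_tail e) \<noteq> 0"
  using assms by (auto simp: Gr_def)

lemma finite_arcs_Gr: "finite (arcs Gr)"
proof (rule finite_subset)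
  show "arcs Gr \<subseteq> {..<n + m} \<times> {..<n} \<times> {..<q}" by (auto simp: Gr_def)
qed simp

lemma wf_sub:
  assumes "A \<subseteq> arcs Gr"
  shows "wf_digraph (spanning_sub A)"
  unfolding wf_digraph_def
proof (intro conjI allI impI)
  fix e assume "e \<in> arcs (spanning_sub A)"
  then have "e \<in> arcs Gr" using assms by auto
  from arcs_GrD(1,2)[OF this]
  show "tail (spanning_sub A) e \<in> verts (spanning_sub A)" "head (spanning_sub A) e \<in> verts (spanning_sub A)"
    by simp_all
qed

lemma Gr_eq: "Gr = spanning_sub (arcs Gr)"
  by (simp add: Gr_def spanning_sub_def)

text \<open>Reduces decompositions to injectivity; \<open>card A = n\<close> is what
  \<open>n + m\<close> vertices and \<open>m\<close> paths leave for the arcs.\<close>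

lemma multi_colored_subgraph_spanning_sub:
  "multi_colored_subgraph m Gr (spanning_sub A) \<longleftrightarrow>
    A \<subseteq> arcs Gr \<and> inj_on arc_tail A \<and> inj_on arc_head A \<and> inj_on arc_color A \<and> card A = n"
proof (cases "A \<subseteq> arcs Gr")
  case True
  have "wf_digraph Gr" using wf_sub[of "arcs Gr"] Gr_eq by simp
  then have "spanning (spanning_sub A) Gr"
    using True wf_sub[OF True] by (simp add: spanning_def subgraph_def compatible_def)
  moreover have "(\<exists>Ps Cs. path_cycle_decomposition m (spanning_sub A) Ps Cs) \<longleftrightarrow>
      inj_on arc_tail A \<and> inj_on arc_head A \<and> n + m = m + card A"
    using path_cycle_decomposition_iff[OF wf_sub[OF True], of m] finite_subset[OF True finite_arcs_Gr]
    by simp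
  ultimately show ?thesis using True by (auto simp: multi_colored_subgraph_def)
next
  case False
  then show ?thesis by (auto simp: multi_colored_subgraph_def spanning_def subgraph_def)
qed

lemma multi_colored_subgraph_imp_spanning_sub:
  assumes "multi_colored_subgraph m Gr S"
  shows "S = spanning_sub (arcs S)"
  using assms unfolding multi_colored_subgraph_def spanning_def subgraph_def compatible_def
  by (cases S) (auto simp: spanning_sub_def)

text \<open>The \<open>n\<close> arcs have distinct heads below \<open>n\<close>, so every vertex
  below \<open>n\<close> is a head and only the inputs are left as sources.\<close>

lemma sinks_sources_spanning_sub:
  assumes "multi_colored_subgraph m Gr (spanning_sub A)"
  shows "sink_verts m (spanning_sub A) = {..<n + m} - arc_tail ` A"
    "source_verts m (spanning_sub A) = {n..<n + m}"
proof -
  obtain Ps Cs where dec: "path_cycle_decomposition m (spanning_sub A) Ps Cs"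
    using assms unfolding multi_colored_subgraph_def by blast
  have A: "A \<subseteq> arcs Gr" "inj_on arc_head A" "card A = n"
    using assms unfolding multi_colored_subgraph_spanning_sub by auto
  have "arc_head ` A \<subseteq> {..<n}" using A(1) arcs_GrD(2) by auto
  moreover have "card (arc_head ` A) = card {..<n}" using card_image[OF A(2)] A(3) by simp
  ultimately have "arc_head ` A = {..<n}" by (intro card_subset_eq) simp_all
  then show "sink_verts m (spanning_sub A) = {..<n + m} - arc_tail ` A"
    "source_verts m (spanning_sub A) = {n..<n + m}"
    using sink_verts_eq[OF dec] source_verts_eq[OF dec] by auto
qed

definition perm_arcs_of :: "(nat \<Rightarrow> nat) \<Rightarrow> (nat \<Rightarrow> nat) \<times> (nat \<Rightarrow> nat) \<Rightarrow> colored_arc set" where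
  "perm_arcs_of \<gamma> = (\<lambda>(\<sigma>, \<kappa>). (\<lambda>i. (\<gamma> (\<sigma> i), i, \<kappa> i)) ` {..<n})"

text \<open>\<open>\<gamma>\<close> numbers the vertices that are not sinks.\<close>

definition sim_class :: "(nat \<Rightarrow> nat) \<Rightarrow> nat set \<Rightarrow> colored_graph set" where
  "sim_class \<gamma> C = {S. multi_colored_subgraph m Gr S \<and>
     sink_verts m S = {..<n + m} - \<gamma> ` {..<n} \<and> colors S = C}"

lemma perm_arcs_of_mem_class:
  assumes \<gamma>: "inj_on \<gamma> {..<n}" "\<And>l. l < n \<Longrightarrow> \<gamma> l < n + m"
    and scol: "(\<sigma>, \<kappa>) \<in> colored_permutations \<gamma> C"
  shows "spanning_sub (perm_arcs_of \<gamma> (\<sigma>, \<kappa>)) \<in> sim_class \<gamma> C"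
proof -
  have \<sigma>: "\<sigma> permutes {..<n}" and \<kappa>: "\<kappa> \<in> {..<n} \<rightarrow>\<^sub>E {..<q}" "inj_on \<kappa> {..<n}" "\<kappa> ` {..<n} = C"
    and nz: "\<And>i. i < n \<Longrightarrow> g (\<kappa> i) i * h (\<kappa> i) (\<gamma> (\<sigma> i)) \<noteq> 0"
    using scol by (auto simp: colored_permutations_def colorings_def)
  have \<sigma>n: "\<sigma> i < n" if "i < n" for i using permutes_in_image[OF \<sigma>, of i] that by simp
  have \<kappa>q: "\<kappa> i < q" if "i < n" for i using \<kappa>(1) that by auto
  let ?A = "perm_arcs_of \<gamma> (\<sigma>, \<kappa>)"
  have A: "?A = (\<lambda>i. (\<gamma> (\<sigma> i), i, \<kappa> i)) ` {..<n}" by (simp add: perm_arcs_of_def)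
  have sub: "?A \<subseteq> arcs Gr" unfolding A Gr_def using \<gamma>(2) \<sigma>n \<kappa>q nz by auto
  have tail: "inj_on arc_tail ?A"
  proof (rule inj_onI)
    fix e e' assume "e \<in> ?A" "e' \<in> ?A" and eq: "arc_tail e = arc_tail e'"
    then obtain i j where ij: "i < n" "j < n" "e = (\<gamma> (\<sigma> i), i, \<kappa> i)" "e' = (\<gamma> (\<sigma> j), j, \<kappa> j)"
      unfolding A by auto
    with eq have "\<sigma> i = \<sigma> j" using inj_onD[OF \<gamma>(1), of "\<sigma> i" "\<sigma> j"] \<sigma>n by simp
    then have "i = j" using permutes_inj[OF \<sigma>] by (auto dest: injD)
    with ij show "e = e'" by simp
  qed
  have head: "inj_on arc_head ?A" by (rule inj_onI) (auto simp: A)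
  have col: "inj_on arc_color ?A"
  proof (rule inj_onI)
    fix e e' assume "e \<in> ?A" "e' \<in> ?A" and eq: "arc_color e = arc_color e'"
    then obtain i j where ij: "i < n" "j < n" "e = (\<gamma> (\<sigma> i), i, \<kappa> i)" "e' = (\<gamma> (\<sigma> j), j, \<kappa> j)"
      unfolding A by auto
    with eq have "i = j" using inj_onD[OF \<kappa>(2), of i j] by simp
    with ij show "e = e'" by simp
  qed
  have "inj_on (\<lambda>i. (\<gamma> (\<sigma> i), i, \<kappa> i)) {..<n}" by (rule inj_onI) simp
  then have "card ?A = n" unfolding A by (simp add: card_image)
  with sub tail head col have mcs: "multi_colored_subgraph m Gr (spanning_sub ?A)"
    unfolding multi_colored_subgraph_spanning_sub by simp
  have "arc_tail ` ?A = \<gamma> ` \<sigma> ` {..<n}" by (simp add: A image_image)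
  then have "arc_tail ` ?A = \<gamma> ` {..<n}" by (simp only: permutes_image[OF \<sigma>])
  moreover have "colors (spanning_sub ?A) = \<kappa> ` {..<n}" by (simp add: colors_def A image_image)
  ultimately show ?thesis
    using mcs sinks_sources_spanning_sub(1)[OF mcs] \<kappa>(3) by (simp add: sim_class_def)
qed

lemma inj_on_perm_arcs_of:
  assumes \<gamma>: "inj_on \<gamma> {..<n}"
  shows "inj_on (\<lambda>x. spanning_sub (perm_arcs_of \<gamma> x)) (colored_permutations \<gamma> C)"
proof (rule inj_onI, clarify)
  fix \<sigma> \<kappa> \<sigma>' \<kappa>'
  assume *: "(\<sigma>, \<kappa>) \<in> colored_permutations \<gamma> C" "(\<sigma>', \<kappa>') \<in> colored_permutations \<gamma> C"
    and eq: "spanning_sub (perm_arcs_of \<gamma> (\<sigma>, \<kappa>)) = spanning_sub (perm_arcs_of \<gamma> (\<sigma>', \<kappa>'))"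
  have \<sigma>: "\<sigma> permutes {..<n}" "\<sigma>' permutes {..<n}" and
    \<kappa>: "\<kappa> \<in> {..<n} \<rightarrow>\<^sub>E {..<q}" "\<kappa>' \<in> {..<n} \<rightarrow>\<^sub>E {..<q}"
    using * by (auto simp: colored_permutations_def colorings_def)
  have eq': "perm_arcs_of \<gamma> (\<sigma>, \<kappa>) = perm_arcs_of \<gamma> (\<sigma>', \<kappa>')"
    using eq by (simp add: spanning_sub_def)
  have pt: "\<sigma> i = \<sigma>' i \<and> \<kappa> i = \<kappa>' i" if i: "i < n" for i
  proof -
    have "(\<gamma> (\<sigma> i), i, \<kappa> i) \<in> perm_arcs_of \<gamma> (\<sigma>', \<kappa>')"
      unfolding eq'[symmetric] using i by (simp add: perm_arcs_of_def)
    then have "\<gamma> (\<sigma> i) = \<gamma> (\<sigma>' i)" "\<kappa> i = \<kappa>' i" by (auto simp: perm_arcs_of_def)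
    moreover have "\<sigma> i < n" "\<sigma>' i < n"
      using permutes_in_image[OF \<sigma>(1), of i] permutes_in_image[OF \<sigma>(2), of i] i by auto
    ultimately show ?thesis using inj_onD[OF \<gamma>, of "\<sigma> i" "\<sigma>' i"] by simp
  qed
  have "\<sigma> i = \<sigma>' i" for i
    using pt[of i] permutes_not_in[OF \<sigma>(1), of i] permutes_not_in[OF \<sigma>(2), of i] by (cases "i < n") auto
  moreover have "\<kappa> = \<kappa>'" by (rule PiE_ext[OF \<kappa>]) (use pt in auto)
  ultimately show "\<sigma> = \<sigma>' \<and> \<kappa> = \<kappa>'" by auto
qed

text \<open>Each \<open>i < n\<close> is the head of exactly one arc of \<open>S\<close>; its tail,
  renumbered by the inverse of \<open>\<gamma>\<close>, gives \<open>\<sigma> i\<close>, and its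
  color gives \<open>\<kappa> i\<close>.\<close>

lemma sim_class_subset:
  assumes \<gamma>: "inj_on \<gamma> {..<n}" "\<And>l. l < n \<Longrightarrow> \<gamma> l < n + m" and S: "S \<in> sim_class \<gamma> C"
  shows "S \<in> (\<lambda>x. spanning_sub (perm_arcs_of \<gamma> x)) ` colored_permutations \<gamma> C"
proof -
  define A where "A = arcs S"
  have S_eq: "S = spanning_sub A" and mcs: "multi_colored_subgraph m Gr (spanning_sub A)"
    using S multi_colored_subgraph_imp_spanning_sub[of S] by (auto simp: sim_class_def A_def)
  have A: "A \<subseteq> arcs Gr" "inj_on arc_tail A" "inj_on arc_head A" "inj_on arc_color A" "card A = n"
    using mcs unfolding multi_colored_subgraph_spanning_sub by auto
  have colC: "arc_color ` A = C" using S by (simp add: S_eq sim_class_def colors_def)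
  have "{..<n + m} - arc_tail ` A = {..<n + m} - \<gamma> ` {..<n}"
    using S sinks_sources_spanning_sub(1)[OF mcs] by (simp add: S_eq sim_class_def)
  moreover have "arc_tail ` A \<subseteq> {..<n + m}" using A(1) arcs_GrD(1) by auto
  moreover have "\<gamma> ` {..<n} \<subseteq> {..<n + m}" using \<gamma>(2) by auto
  ultimately have tails: "arc_tail ` A = \<gamma> ` {..<n}" by blast
  have "arc_head ` A \<subseteq> {..<n}" using A(1) arcs_GrD(2) by auto
  moreover have "card (arc_head ` A) = card {..<n}" using card_image[OF A(3)] A(5) by simp
  ultimately have heads: "arc_head ` A = {..<n}" by (intro card_subset_eq) simp_all
  define arc where "arc = the_inv_into A arc_head"
  have arc: "arc i \<in> A" "arc_head (arc i) = i" if "i < n" for i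
    unfolding arc_def using the_inv_into_into[OF A(3), of i A] f_the_inv_into_f[OF A(3), of i] that heads
    by auto
  have arc_eq: "arc (arc_head e) = e" if "e \<in> A" for e
    unfolding arc_def by (rule the_inv_into_f_f[OF A(3) that])
  \<comment> \<open>Outside \<open>{..<n}\<close> the identity is what \<open>permutes\<close>
    requires, whereas \<open>\<kappa>\<close> is \<open>undefined\<close> there, as
    \<open>\<rightarrow>\<^sub>E\<close> demands.\<close>
  define \<sigma> where "\<sigma> = (\<lambda>i. if i < n then the_inv_into {..<n} \<gamma> (arc_tail (arc i)) else i)"
  define \<kappa> where "\<kappa> = restrict (\<lambda>i. arc_color (arc i)) {..<n}"
  have tail_mem: "arc_tail (arc i) \<in> \<gamma> ` {..<n}" if "i < n" for i
    using arc(1)[OF that] tails by blast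
  have \<gamma>\<sigma>: "\<gamma> (\<sigma> i) = arc_tail (arc i)" if "i < n" for i
    using f_the_inv_into_f[OF \<gamma>(1) tail_mem[OF that]] that by (simp only: \<sigma>_def if_True)
  have \<sigma>n: "\<sigma> i < n" if "i < n" for i
    using the_inv_into_into[OF \<gamma>(1) tail_mem[OF that] subset_refl] that
    by (simp only: \<sigma>_def if_True lessThan_iff)
  have inj_arc: "i = j" if "i < n" "j < n" "arc i = arc j" for i j
  proof -
    have "arc_head (arc i) = arc_head (arc j)" using that(3) by (rule arg_cong)
    then show ?thesis unfolding arc(2)[OF that(1)] arc(2)[OF that(2)] .
  qed
  have "inj_on \<sigma> {..<n}"
  proof (rule inj_onI)
    fix i j assume ij: "i \<in> {..<n}" "j \<in> {..<n}" "\<sigma> i = \<sigma> j"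
    then have "arc_tail (arc i) = arc_tail (arc j)" using \<gamma>\<sigma>[of i] \<gamma>\<sigma>[of j] by simp
    then have "arc i = arc j" using inj_onD[OF A(2)] arc(1) ij by simp
    then show "i = j" using inj_arc ij by simp
  qed
  moreover have "\<sigma> ` {..<n} \<subseteq> {..<n}" using \<sigma>n by auto
  ultimately have "bij_betw \<sigma> {..<n} {..<n}"
    using endo_inj_surj[of "{..<n}" \<sigma>] by (simp add: bij_betw_def)
  then have \<sigma>: "\<sigma> permutes {..<n}" by (rule bij_imp_permutes) (simp add: \<sigma>_def)
  have arc_split: "arc i = (\<gamma> (\<sigma> i), i, \<kappa> i)" if "i < n" for i
    using \<gamma>\<sigma>[OF that] arc(2)[OF that] that by (auto simp: \<kappa>_def split: prod.splits)
  have A_eq: "A = perm_arcs_of \<gamma> (\<sigma>, \<kappa>)"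
  proof (intro equalityI subsetI)
    fix e assume e: "e \<in> A"
    then have "e \<in> arcs Gr" using A(1) by (rule rev_subsetD)
    then have hn: "arc_head e < n" by (rule arcs_GrD(2))
    have "e = (\<gamma> (\<sigma> (arc_head e)), arc_head e, \<kappa> (arc_head e))"
      using arc_split[OF hn] arc_eq[OF e] by simp
    then show "e \<in> perm_arcs_of \<gamma> (\<sigma>, \<kappa>)"
      unfolding perm_arcs_of_def prod.case by (rule image_eqI) (use hn in simp)
  next
    fix e assume "e \<in> perm_arcs_of \<gamma> (\<sigma>, \<kappa>)"
    then obtain i where i: "i < n" "e = (\<gamma> (\<sigma> i), i, \<kappa> i)" by (auto simp: perm_arcs_of_def)
    then have "e = arc i" using arc_split[OF i(1)] by simp
    with arc(1)[OF i(1)] show "e \<in> A" by simp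
  qed
  have arc_Gr: "arc i \<in> arcs Gr" if "i < n" for i using arc(1)[OF that] A(1) by (rule rev_subsetD)
  have \<kappa>A: "\<kappa> i = arc_color (arc i)" if "i < n" for i using that by (simp add: \<kappa>_def)
  have "\<kappa> \<in> {..<n} \<rightarrow>\<^sub>E {..<q}"
  proof (rule PiE_I)
    fix i assume "i \<in> {..<n}"
    then show "\<kappa> i \<in> {..<q}" using \<kappa>A[of i] arcs_GrD(3)[OF arc_Gr[of i]] by simp
  qed (simp add: \<kappa>_def)
  moreover have "inj_on \<kappa> {..<n}"
  proof (rule inj_onI)
    fix i j assume ij: "i \<in> {..<n}" "j \<in> {..<n}" "\<kappa> i = \<kappa> j"
    then have "arc i = arc j" using inj_onD[OF A(4)] arc(1) \<kappa>A by simp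
    then show "i = j" using inj_arc ij by simp
  qed
  moreover have "\<kappa> ` {..<n} = C"
  proof -
    have "\<kappa> ` {..<n} = arc_color ` A"
      unfolding A_eq by (simp add: perm_arcs_of_def image_image)
    with colC show ?thesis by simp
  qed
  ultimately have "\<kappa> \<in> colorings C" by (simp add: colorings_def)
  moreover have "g (\<kappa> i) i * h (\<kappa> i) (\<gamma> (\<sigma> i)) \<noteq> 0" if "i < n" for i
    using arcs_GrD(4)[OF arc_Gr[OF that]] unfolding arc_split[OF that] by simp
  ultimately have "(\<sigma>, \<kappa>) \<in> colored_permutations \<gamma> C" using \<sigma> by (simp add: colored_permutations_def)
  then show ?thesis unfolding S_eq A_eq by (rule imageI)
qed

lemma bij_betw_sim_class:
  assumes \<gamma>: "inj_on \<gamma> {..<n}" "\<And>l. l < n \<Longrightarrow> \<gamma> l < n + m"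
  shows "bij_betw (\<lambda>x. spanning_sub (perm_arcs_of \<gamma> x)) (colored_permutations \<gamma> C) (sim_class \<gamma> C)"
proof (rule bij_betw_imageI[OF inj_on_perm_arcs_of[OF \<gamma>(1)]])
  show "(\<lambda>x. spanning_sub (perm_arcs_of \<gamma> x)) ` colored_permutations \<gamma> C = sim_class \<gamma> C"
    using perm_arcs_of_mem_class[OF \<gamma>] sim_class_subset[OF \<gamma>] by auto
qed

end

lemma sum_minus_one_power:
  fixes f :: "'a \<Rightarrow> nat"
  assumes "finite K"
  shows "(\<Sum>S\<in>K. (- 1) ^ f S) = (of_nat (card {S \<in> K. even (f S)}) - of_nat (card {S \<in> K. odd (f S)}) :: real)"
proof -
  have "(\<Sum>S\<in>K. (- 1) ^ f S) = (\<Sum>S\<in>K. if even (f S) then 1 else (- 1 :: real))"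
    by (rule sum.cong) auto
  also have "\<dots> = (\<Sum>S\<in>{S \<in> K. even (f S)}. 1) + (\<Sum>S\<in>{S \<in> K. odd (f S)}. - 1)"
    using assms by (simp add: sum.If_cases Int_def)
  finally show ?thesis by simp
qed

section \<open>Parity via the quotient by a matrimonial partition\<close>

locale matching = rank_one_param +
  fixes T :: "nat set" and f :: "nat \<Rightarrow> nat"
  assumes T: "T \<subseteq> {..<n + m}" and bij: "bij_betw f ({n..<n + m} - T) (T - {n..<n + m})"
begin

definition X where "X = {n..<n + m} - T"
definition Y where "Y = T - {n..<n + m}"

definition f_inv :: "nat \<Rightarrow> nat" where "f_inv = the_inv_into X f"

text \<open>Every cell other than a common source and sink has one vertex \<open>l < n\<close> that
  arcs enter and one vertex \<open>nonsink l\<close> that arcs leave. The two differ exactly when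
  \<open>l\<close> is a sink matched with a source.\<close>

definition nonsink :: "nat \<Rightarrow> nat" where "nonsink l = (if l \<in> Y then f_inv l else l)"

definition cell :: "nat \<Rightarrow> nat set" where "cell l = (if l \<in> Y then {f_inv l, l} else {l})"

definition part :: "nat set set" where
  "part = (\<lambda>v. {v, f v}) ` X \<union> (\<lambda>v. {v}) ` ({..<n + m} - (X \<union> Y))"

lemma Y_iff: "l < n \<Longrightarrow> l \<in> Y \<longleftrightarrow> l \<in> T" by (simp add: Y_def)

lemma Y_less: "l \<in> Y \<Longrightarrow> l < n" using T by (auto simp: Y_def)

lemma X_iff: "v \<in> X \<longleftrightarrow> n \<le> v \<and> v < n + m \<and> v \<notin> T" by (auto simp: X_def)

lemma f_inv: "l \<in> Y \<Longrightarrow> f_inv l \<in> X" "l \<in> Y \<Longrightarrow> f (f_inv l) = l" "v \<in> X \<Longrightarrow> f_inv (f v) = v"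
  "v \<in> X \<Longrightarrow> f v \<in> Y"
proof -
  have inj: "inj_on f X" and img: "f ` X = Y" using bij by (auto simp: bij_betw_def X_def Y_def)
  show "f_inv l \<in> X" if "l \<in> Y"
    unfolding f_inv_def by (rule the_inv_into_into[OF inj _ subset_refl]) (use that img in simp)
  show "f (f_inv l) = l" if "l \<in> Y"
    unfolding f_inv_def by (rule f_the_inv_into_f[OF inj]) (use that img in simp)
  show "f_inv (f v) = v" if "v \<in> X"
    unfolding f_inv_def by (rule the_inv_into_f_f[OF inj that])
  show "f v \<in> Y" if "v \<in> X" unfolding img[symmetric] using that by (rule imageI)
qed

lemma X_ge: "v \<in> X \<Longrightarrow> n \<le> v" "v \<in> X \<Longrightarrow> v < n + m" by (simp_all add: X_iff)

lemma nonsink_less: "l < n \<Longrightarrow> nonsink l < n + m"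
  using X_ge(2)[OF f_inv(1)[of l]] by (simp add: nonsink_def)

lemma inj_on_nonsink: "inj_on nonsink {..<n}"
proof (rule inj_onI)
  fix l l' assume l: "l \<in> {..<n}" "l' \<in> {..<n}" "nonsink l = nonsink l'"
  have ge: "n \<le> f_inv x" if "x \<in> Y" for x by (rule X_ge(1)[OF f_inv(1)[OF that]])
  show "l = l'"
  proof (cases "l \<in> Y"; cases "l' \<in> Y")
    assume "l \<in> Y" "l' \<in> Y"
    then have "f (f_inv l) = f (f_inv l')" using l(3) by (simp only: nonsink_def if_True)
    then show ?thesis unfolding f_inv(2)[OF \<open>l \<in> Y\<close>] f_inv(2)[OF \<open>l' \<in> Y\<close>] .
  next
    assume "l \<in> Y" "l' \<notin> Y"
    then have "f_inv l = l'" using l(3) by (simp only: nonsink_def if_True if_False)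
    with ge[OF \<open>l \<in> Y\<close>] l(2) show ?thesis by simp
  next
    assume "l \<notin> Y" "l' \<in> Y"
    then have "l = f_inv l'" using l(3) by (simp only: nonsink_def if_True if_False)
    with ge[OF \<open>l' \<in> Y\<close>] l(1) show ?thesis by simp
  next
    assume "l \<notin> Y" "l' \<notin> Y"
    then show ?thesis using l(3) by (simp only: nonsink_def if_False)
  qed
qed

lemma nonsink_image: "nonsink ` {..<n} = {..<n + m} - T"
proof (intro equalityI subsetI)
  fix v assume "v \<in> nonsink ` {..<n}"
  then obtain l where l: "l < n" "v = nonsink l" by auto
  show "v \<in> {..<n + m} - T"
  proof (cases "l \<in> Y")
    case True
    then have "v = f_inv l" using l(2) by (simp only: nonsink_def if_True)
    with f_inv(1)[OF True] show ?thesis by (simp add: X_iff)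
  next
    case False
    then have "v = l" using l(2) by (simp only: nonsink_def if_False)
    with False l(1) show ?thesis by (simp add: Y_iff)
  qed
next
  fix v assume v: "v \<in> {..<n + m} - T"
  show "v \<in> nonsink ` {..<n}"
  proof (cases "v < n")
    case True
    then have "nonsink v = v" using v by (simp add: nonsink_def Y_iff)
    with True show ?thesis by (intro image_eqI[of _ _ v]) simp_all
  next
    case False
    then have "v \<in> X" using v by (simp add: X_iff)
    then have "nonsink (f v) = v" using f_inv(3)[of v] f_inv(4)[of v] by (simp only: nonsink_def if_True)
    with Y_less[OF f_inv(4)[OF \<open>v \<in> X\<close>]] show ?thesis by (intro image_eqI[of _ _ "f v"]) simp_all
  qed
qed

lemma cell_mem_part:
  assumes "l < n"
  shows "cell l \<in> part"
proof (cases "l \<in> Y")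
  case True
  then have "cell l = {f_inv l, f (f_inv l)}" using f_inv(2)[OF True] by (simp only: cell_def if_True)
  then show ?thesis unfolding part_def using f_inv(1)[OF True] by blast
next
  case False
  then have "cell l = {l}" by (simp only: cell_def if_False)
  moreover have "l \<in> {..<n + m} - (X \<union> Y)" using False assms by (simp add: X_iff)
  ultimately show ?thesis unfolding part_def by blast
qed

lemma part_cases:
  assumes "d \<in> part"
  obtains v where "v \<in> X" "d = {v, f v}" | v where "v < n + m" "v \<notin> X" "v \<notin> Y" "d = {v}"
  using assms unfolding part_def by blast

text \<open>The entering and the leaving vertex each determine their cell, so the cells at the two
  ends of an arc of a member are known.\<close>

lemma part_mem_iff:
  assumes d: "d \<in> part" and i: "i < n"
  shows "i \<in> d \<longleftrightarrow> d = cell i" "nonsink i \<in> d \<longleftrightarrow> d = cell i"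
proof -
  have cell_i: "i \<in> cell i" "nonsink i \<in> cell i" by (auto simp: cell_def nonsink_def)
  have 1: "d = cell i" if "i \<in> d"
    using d
  proof (cases rule: part_cases)
    case (1 v)
    with that i X_ge(1)[OF 1(1)] have "i = f v" by auto
    with f_inv(3,4)[OF 1(1)] 1(2) show ?thesis by (simp only: cell_def if_True)
  next
    case (2 v)
    with that have "i = v" by simp
    with 2(3,4) show ?thesis by (simp only: cell_def if_False)
  qed
  have 2: "d = cell i" if ni: "nonsink i \<in> d"
  proof (cases "i \<in> Y")
    case True
    then have ni': "f_inv i \<in> d" using ni by (simp only: nonsink_def if_True)
    note fX = f_inv(1)[OF True]
    from d show ?thesis
    proof (cases rule: part_cases)
      case (1 v)
      have "f_inv i \<noteq> f v" using X_ge(1)[OF fX] Y_less[OF f_inv(4)[OF 1(1)]] by simp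
      with ni' 1(2) have "f_inv i = v" by simp
      then have "f v = i" using f_inv(2)[OF True] by simp
      then have "d = {f_inv i, i}" using 1(2) \<open>f_inv i = v\<close> by simp
      with True show ?thesis by (simp only: cell_def if_True)
    next
      case (2 v)
      with ni' fX have False by simp
      then show ?thesis ..
    qed
  next
    case False
    then have "nonsink i = i" by (simp only: nonsink_def if_False)
    with 1 ni show ?thesis by simp
  qed
  show "i \<in> d \<longleftrightarrow> d = cell i" "nonsink i \<in> d \<longleftrightarrow> d = cell i" using 1 2 cell_i by auto
qed

lemma inj_on_cell: "inj_on cell {..<n}"
proof (rule inj_onI)
  fix l l' assume l: "l \<in> {..<n}" "l' \<in> {..<n}" "cell l = cell l'"
  have "l \<in> cell l'" unfolding l(3)[symmetric] by (simp add: cell_def)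
  moreover have "n \<le> f_inv l'" if "l' \<in> Y" by (rule X_ge(1)[OF f_inv(1)[OF that]])
  ultimately show "l = l'" using l(1) by (auto simp: cell_def split: if_splits)
qed

text \<open>The arc with head \<open>i\<close> leads from \<open>cell (\<sigma> i)\<close> to
  \<open>cell i\<close>, so the quotient is the graph of the inverse permutation, which has the same
  sign as \<open>\<sigma>\<close> and one cycle graph per orbit.\<close>

lemma sign_eq_num_cycle_graphs:
  assumes "\<sigma> permutes {..<n}"
  shows "sign \<sigma> = (- 1) ^ (n + num_cycle_graphs
    (quotient_graph (spanning_sub (perm_arcs_of nonsink (\<sigma>, \<kappa>))) part))"
proof -
  interpret pg: permutation_graph "{..<n}" "inv_into UNIV \<sigma>" cell part
    by unfold_locales (use permutes_inv[OF assms] inj_on_cell cell_mem_part in auto)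
  let ?A = "perm_arcs_of nonsink (\<sigma>, \<kappa>)"
  have \<sigma>n: "\<sigma> i < n" if "i < n" for i using permutes_in_image[OF assms, of i] that by simp
  have "{(c, d). c \<in> part \<and> d \<in> part \<and> (\<exists>e\<in>?A. arc_tail e \<in> c \<and> arc_head e \<in> d)} =
      (\<lambda>i. (cell (\<sigma> i), cell i)) ` {..<n}"
  proof (intro equalityI subsetI)
    fix x assume "x \<in> {(c, d). c \<in> part \<and> d \<in> part \<and> (\<exists>e\<in>?A. arc_tail e \<in> c \<and> arc_head e \<in> d)}"
    then obtain c d i where x: "x = (c, d)" "c \<in> part" "d \<in> part" "i < n" "nonsink (\<sigma> i) \<in> c" "i \<in> d"
      by (auto simp: perm_arcs_of_def)
    then have "c = cell (\<sigma> i)" "d = cell i" using part_mem_iff(1)[OF x(3,4)] part_mem_iff(2)[OF x(2) \<sigma>n] by auto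
    with x(1,4) show "x \<in> (\<lambda>i. (cell (\<sigma> i), cell i)) ` {..<n}" by simp
  next
    fix x assume "x \<in> (\<lambda>i. (cell (\<sigma> i), cell i)) ` {..<n}"
    then obtain i where i: "i < n" "x = (cell (\<sigma> i), cell i)" by auto
    have "cell (\<sigma> i) \<in> part" "cell i \<in> part"
      by (rule cell_mem_part[OF \<sigma>n[OF i(1)]]) (rule cell_mem_part[OF i(1)])
    moreover from this have "nonsink (\<sigma> i) \<in> cell (\<sigma> i)" "i \<in> cell i"
      using part_mem_iff(2)[OF _ \<sigma>n[OF i(1)]] part_mem_iff(1)[OF _ i(1)] by blast+
    ultimately show "x \<in> {(c, d). c \<in> part \<and> d \<in> part \<and> (\<exists>e\<in>?A. arc_tail e \<in> c \<and> arc_head e \<in> d)}"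
      using i by (auto simp: perm_arcs_of_def)
  qed
  \<comment> \<open>Reindexing by \<open>j = \<sigma> i\<close> makes every arc lead from a point to
    its image, as in \<open>permutation_graph\<close>.\<close>
  also have "\<dots> = (\<lambda>j. (cell j, cell (inv_into UNIV \<sigma> j))) ` \<sigma> ` {..<n}"
    unfolding image_image using permutes_inverses(2)[OF assms] by simp
  also have "\<sigma> ` {..<n} = {..<n}" by (rule permutes_image[OF assms])
  finally have "quotient_graph (spanning_sub ?A) part = pg.G"
    unfolding quotient_graph_def pg.G_def pg.perm_arcs_def spanning_sub_simps by (simp only:)
  then have "num_cycle_graphs (quotient_graph (spanning_sub ?A) part) = card (orbit (inv_into UNIV \<sigma>) ` {..<n})"
    using pg.num_cycle_graphs_G by simp
  moreover have "sign (inv_into UNIV \<sigma>) = sign \<sigma>"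
    by (rule sign_inverse) (rule permutes_imp_permutation[OF _ assms], simp)
  ultimately show ?thesis
    using sign_eq_card_orbits[OF _ permutes_inv[OF assms]] by simp
qed

text \<open>The factor \<open>(- 1) ^ n\<close> comes from the number of points in the sign formula;
  being common to all members, it does not affect balance.\<close>

lemma color_coeff_eq_card_diff:
  "color_coeff nonsink C = (- 1) ^ n *
     (of_nat (card {S \<in> sim_class nonsink C. even_member part S}) -
      of_nat (card {S \<in> sim_class nonsink C. odd_member part S}))"
proof -
  let ?F = "\<lambda>x. spanning_sub (perm_arcs_of nonsink x)"
  let ?N = "\<lambda>S. num_cycle_graphs (quotient_graph S part)"
  note bij = bij_betw_sim_class[OF inj_on_nonsink nonsink_less]
  have fin: "finite (sim_class nonsink C)"
    using bij_betw_finite[OF bij] finite_colored_permutations by blast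
  have "color_coeff nonsink C = (\<Sum>(\<sigma>, \<kappa>)\<in>colored_permutations nonsink C. of_int (sign \<sigma>))"
    by (rule color_coeff_eq_sum_sign) (rule nonsink_less)
  also have "\<dots> = (\<Sum>x\<in>colored_permutations nonsink C. (- 1) ^ n * (- 1) ^ ?N (?F x))"
  proof (rule sum.cong[OF refl], clarify)
    fix \<sigma> \<kappa> assume "(\<sigma>, \<kappa>) \<in> colored_permutations nonsink C"
    then have "\<sigma> permutes {..<n}" by (simp add: colored_permutations_def)
    from sign_eq_num_cycle_graphs[OF this, of \<kappa>]
    show "real_of_int (sign \<sigma>) = (- 1) ^ n * (- 1) ^ ?N (?F (\<sigma>, \<kappa>))"
      by (simp add: power_add)
  qed
  also have "\<dots> = (\<Sum>S\<in>sim_class nonsink C. (- 1) ^ n * (- 1) ^ ?N S)"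
    by (rule sum.reindex_bij_betw[OF bij])
  also have "\<dots> = (- 1) ^ n * (\<Sum>S\<in>sim_class nonsink C. (- 1) ^ ?N S)"
    by (simp add: sum_distrib_left)
  finally show ?thesis
    unfolding sum_minus_one_power[OF fin] even_member_def odd_member_def .
qed

end

section \<open>Balance and vanishing coefficients of minors\<close>

context rank_one_param
begin

text \<open>All members of \<open>K\<close> share vertices, sources and sinks, so a partition that
  is matrimonial for one is so for all, and the partition fixed for the class falls under
  \<open>matching\<close>. The numbering \<open>\<gamma>\<close> is existential because it depends
  on the bijection behind that partition.\<close>

lemma balanced_class_iff:
  assumes S0: "multi_colored_subgraph m Gr S0" and K: "K = similarity m Gr `` {S0}"
  shows "\<exists>\<gamma>. (\<forall>l<n. \<gamma> l < n + m) \<and> \<gamma> ` {..<n} = {..<n + m} - sink_verts m S0 \<and>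
    (balanced_class m K \<longleftrightarrow> color_coeff \<gamma> (colors S0) = 0)"
proof -
  define T where "T = sink_verts m S0"
  let ?V = "{n..<n + m}"
  have K_eq: "K = {S. multi_colored_subgraph m Gr S \<and> sink_verts m S = T \<and> colors S = colors S0}"
    unfolding K similarity_def T_def using S0 by auto
  have mem: "sink_verts m S = {..<n + m} - arc_tail ` arcs S" "source_verts m S = ?V"
      "verts S = {..<n + m}" "arcs S \<subseteq> arcs Gr" "inj_on arc_tail (arcs S)" "card (arcs S) = n"
    if S: "multi_colored_subgraph m Gr S" for S
  proof -
    obtain A where A: "S = spanning_sub A" using multi_colored_subgraph_imp_spanning_sub[OF S] by (rule that)
    note S' = S[unfolded A]
    from S'[unfolded multi_colored_subgraph_spanning_sub]
    show "arcs S \<subseteq> arcs Gr" "inj_on arc_tail (arcs S)" "card (arcs S) = n" by (simp_all add: A)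
    from sinks_sources_spanning_sub[OF S'] show "sink_verts m S = {..<n + m} - arc_tail ` arcs S"
      "source_verts m S = ?V" "verts S = {..<n + m}" by (simp_all add: A)
  qed
  have TV: "T \<subseteq> {..<n + m}" using mem(1)[OF S0] by (auto simp: T_def)
  have finT: "finite T" using TV finite_subset by blast
  \<comment> \<open>There are as many sinks as inputs, which makes a bijection between the sources
    that are not sinks and the sinks that are not sources possible.\<close>
  have "card T = m"
  proof -
    note A = mem(4-6)[OF S0]
    have sub: "arc_tail ` arcs S0 \<subseteq> {..<n + m}" using A(1) arcs_GrD(1) by auto
    have "card T = card {..<n + m} - card (arc_tail ` arcs S0)"
      unfolding T_def mem(1)[OF S0] by (rule card_Diff_subset[OF finite_subset[OF sub] sub]) simp
    then show ?thesis using card_image[OF A(2)] A(3) by simp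
  qed
  then have "card (?V - T) = card (T - ?V)"
    using card_Diff_subset_Int[of ?V T] card_Diff_subset_Int[of T ?V] finT by (simp add: Int_commute)
  then obtain f0 where f0: "bij_betw f0 (?V - T) (T - ?V)"
    using finite_same_card_bij[of "?V - T" "T - ?V"] finT by auto
  define cells where "cells = (\<lambda>f :: nat \<Rightarrow> nat. (\<lambda>v. {v, f v}) ` (?V - T) \<union>
      (\<lambda>v. {v}) ` ({..<n + m} - ((?V - T) \<union> (T - ?V))))"
  have mat: "matrimonial_partition m S \<pi> \<longleftrightarrow> (\<exists>f. bij_betw f (?V - T) (T - ?V) \<and> \<pi> = cells f)"
    if "S \<in> K" for S \<pi>
  proof -
    have S: "multi_colored_subgraph m Gr S" "sink_verts m S = T" using that K_eq by auto
    show ?thesis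
      unfolding matrimonial_partition_def Let_def S(2) mem(2)[OF S(1)] mem(3)[OF S(1)] cells_def ..
  qed
  \<comment> \<open>A witness for the specification of \<open>class_partition\<close>; the partition
    actually chosen may come from another bijection \<open>f\<close>.\<close>
  have "\<forall>S\<in>K. matrimonial_partition m S (cells f0)"
    using mat f0 by blast
  then have "\<forall>S\<in>K. matrimonial_partition m S (class_partition m K)"
    unfolding class_partition_def by (rule someI[of "\<lambda>\<pi>. \<forall>S\<in>K. matrimonial_partition m S \<pi>"])
  moreover have "S0 \<in> K" using S0 by (simp add: K_eq T_def)
  ultimately obtain f where f: "bij_betw f (?V - T) (T - ?V)" "class_partition m K = cells f"
    using mat[of S0] by blast
  interpret mt: matching n m q g h T f by unfold_locales (use TV f in auto)
  have part: "class_partition m K = mt.part" unfolding f(2) cells_def mt.part_def mt.X_def mt.Y_def ..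
  have KS: "K = sim_class mt.nonsink (colors S0)"
    unfolding K_eq sim_class_def mt.nonsink_image using TV by (simp add: double_diff)
  have "balanced_class m K \<longleftrightarrow> color_coeff mt.nonsink (colors S0) = 0"
    unfolding mt.color_coeff_eq_card_diff balanced_class_def part KS[symmetric] by auto
  then show ?thesis
    using mt.nonsink_less mt.nonsink_image by (intro exI[of _ mt.nonsink]) (simp add: T_def)
qed

lemma ex_unbalanced_class_iff:
  "(\<exists>K\<in>similarity_classes m Gr. \<not> balanced_class m K) \<longleftrightarrow> (\<exists>p. full_row_rank n (n + m) (M p))"
proof
  assume "\<exists>K\<in>similarity_classes m Gr. \<not> balanced_class m K"
  then obtain S0 where S0: "multi_colored_subgraph m Gr S0" "\<not> balanced_class m (similarity m Gr `` {S0})"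
    unfolding similarity_classes_def by (auto elim!: quotientE)
  from balanced_class_iff[OF S0(1) refl] S0(2) obtain \<gamma> where
    \<gamma>: "\<forall>l<n. \<gamma> l < n + m" "color_coeff \<gamma> (colors S0) \<noteq> 0" by blast
  from color_coeff_eq_minor[OF color_coeff_nonzero_imp[OF \<gamma>(2)], of \<gamma>] \<gamma>(2)
  have "minor \<gamma> (\<lambda>k. if k \<in> colors S0 then 1 else 0) \<noteq> 0" by simp
  then have "full_row_rank n (n + m) (M (\<lambda>k. if k \<in> colors S0 then 1 else 0))"
    unfolding minor_def by (intro nonzero_minor_imp_full_row_rank[of n \<gamma>]) (use \<gamma>(1) in auto)
  then show "\<exists>p. full_row_rank n (n + m) (M p)"
    by (rule exI[of "\<lambda>p. full_row_rank n (n + m) (M p)"])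
next
  assume "\<exists>p. full_row_rank n (n + m) (M p)"
  then obtain p where "full_row_rank n (n + m) (M p)" by (elim exE)
  from full_row_rank_imp_nonzero_minor[OF this] obtain \<gamma> where
    \<gamma>: "\<gamma> \<in> {..<n} \<rightarrow>\<^sub>E {..<n + m}" "minor \<gamma> p \<noteq> 0" unfolding minor_def by (elim bexE)
  have \<gamma>n: "\<gamma> l < n + m" if "l < n" for l using PiE_mem[OF \<gamma>(1), of l] that by simp
  have \<gamma>_inj: "inj_on \<gamma> {..<n}" by (rule minor_nonzero_imp_inj[OF \<gamma>(2)])
  from minor_nonzero_imp_color_coeff[OF \<gamma>(2)] obtain C where C: "color_coeff \<gamma> C \<noteq> 0" by blast
  let ?p = "\<lambda>k. if k \<in> C then 1 else 0"
  have coeff: "color_coeff \<gamma>' C = minor \<gamma>' ?p" for \<gamma>'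
    by (rule color_coeff_eq_minor[OF color_coeff_nonzero_imp[OF C]])
  \<comment> \<open>A nonzero signed sum has a summand, and this provides a member of a similarity
    class.\<close>
  have "colored_permutations \<gamma> C \<noteq> {}"
    using C color_coeff_eq_sum_sign[of \<gamma> C] \<gamma>n by auto
  then obtain \<sigma> \<kappa> where "(\<sigma>, \<kappa>) \<in> colored_permutations \<gamma> C" by auto
  from perm_arcs_of_mem_class[OF \<gamma>_inj \<gamma>n this] obtain S0 where S0: "S0 \<in> sim_class \<gamma> C" ..
  then have mcs: "multi_colored_subgraph m Gr S0" and col: "colors S0 = C"
    and sink: "sink_verts m S0 = {..<n + m} - \<gamma> ` {..<n}"
    by (simp_all add: sim_class_def)
  from balanced_class_iff[OF mcs refl] obtain \<gamma>' where \<gamma>': "\<gamma>' ` {..<n} = {..<n + m} - sink_verts m S0"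
    "balanced_class m (similarity m Gr `` {S0}) \<longleftrightarrow> color_coeff \<gamma>' (colors S0) = 0" by blast
  \<comment> \<open>\<open>\<gamma>\<close> comes from the minor and \<open>\<gamma>'\<close> from
    the matching; they number the same non-sinks, possibly in a different order.\<close>
  have "\<gamma> ` {..<n} = \<gamma>' ` {..<n}"
    unfolding \<gamma>'(1) sink using \<gamma>n by auto
  moreover have "minor \<gamma> ?p \<noteq> 0" using C coeff by simp
  ultimately have "minor \<gamma>' ?p \<noteq> 0" by (rule minor_nonzero_cong)
  then have "\<not> balanced_class m (similarity m Gr `` {S0})"
    unfolding \<gamma>'(2) col coeff .
  moreover have "similarity m Gr `` {S0} \<in> similarity_classes m Gr"
    unfolding similarity_classes_def by (rule quotientI) (simp add: mcs)
  ultimately show "\<exists>K\<in>similarity_classes m Gr. \<not> balanced_class m K" by blast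
qed

end

subsection \<open>Cactus graphs\<close>

lemma reachable_iff_rtrancl:
  assumes wf: "wf_digraph G" and u: "u \<in> verts G"
  shows "u \<rightarrow>\<^sup>*\<^bsub>G\<^esub> v \<longleftrightarrow> (u, v) \<in> (arcs_ends G)\<^sup>*"
proof
  show "u \<rightarrow>\<^sup>*\<^bsub>G\<^esub> v \<Longrightarrow> (u, v) \<in> (arcs_ends G)\<^sup>*" by (rule reachable_rtranclI)
  assume "(u, v) \<in> (arcs_ends G)\<^sup>*"
  then show "u \<rightarrow>\<^sup>*\<^bsub>G\<^esub> v"
  proof (induction rule: rtrancl_induct)
    case base
    show ?case using u by (simp add: reachable_def)
  next
    case (step x y)
    show ?case by (rule wf_digraph.reachable_adj_trans[OF wf step.IH step.hyps(2)])
  qed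
qed

lemma arcs_ends_arc: "e \<in> arcs G \<Longrightarrow> (tail G e, head G e) \<in> arcs_ends G"
  by (auto simp: arcs_ends_conv)

lemma arcs_endsE:
  assumes "(u, v) \<in> arcs_ends G"
  obtains e where "e \<in> arcs G" "tail G e = u" "head G e = v"
  using assms by (auto simp: arcs_ends_conv)

lemma subgraph_arcs_ends: "subgraph H G \<Longrightarrow> arcs_ends H \<subseteq> arcs_ends G"
  by (auto simp: arcs_ends_conv subgraph_def compatible_def)

lemma succs_rtrancl:
  assumes "i \<le> j" "j < length vs"
  shows "(vs ! i, vs ! j) \<in> (succs vs)\<^sup>*"
  using assms
proof (induction j rule: dec_induct)
  case (step j)
  then have "(vs ! j, vs ! Suc j) \<in> succs vs" by (auto simp: succs_def)
  with step show ?case by (simp add: rtrancl_into_rtrancl)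
qed simp

lemma path_rtrancl:
  assumes "path_labeling vs P" "v \<in> verts P"
  shows "(hd vs, v) \<in> (arcs_ends P)\<^sup>*"
proof -
  have *: "vs \<noteq> []" "v \<in> set vs" "arcs_ends P = succs vs"
    using assms by (auto simp: path_labeling_def succs_def)
  then obtain j where "j < length vs" "v = vs ! j" by (auto simp: in_set_conv_nth)
  with succs_rtrancl[of 0 j vs] * show ?thesis by (simp add: hd_conv_nth)
qed

lemma cycle_rtrancl:
  assumes C: "cycle_graph C" and uv: "u \<in> verts C" "v \<in> verts C"
  shows "(u, v) \<in> (arcs_ends C)\<^sup>*"
proof -
  obtain vs where vs: "cycle_labeling vs C" using C by (auto simp: cycle_graph_def)
  then have *: "vs \<noteq> []" "u \<in> set vs" "v \<in> set vs" "succs vs \<subseteq> arcs_ends C" "(last vs, hd vs) \<in> arcs_ends C"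
    using uv by (auto simp: cycle_labeling_def succs_def)
  from *(2,3) obtain i j where ij: "i < length vs" "u = vs ! i" "j < length vs" "v = vs ! j"
    by (auto simp: in_set_conv_nth)
  have "(vs ! i, vs ! (length vs - 1)) \<in> (arcs_ends C)\<^sup>*"
    using succs_rtrancl[of i "length vs - 1" vs] ij(1) rtrancl_mono[OF *(4)] by auto
  then have "(u, last vs) \<in> (arcs_ends C)\<^sup>*" using *(1) ij(2) by (simp add: last_conv_nth)
  also note *(5)
  also have "(vs ! 0, vs ! j) \<in> (arcs_ends C)\<^sup>*"
    using succs_rtrancl[of 0 j vs] ij(3) rtrancl_mono[OF *(4)] by auto
  then have "(hd vs, v) \<in> (arcs_ends C)\<^sup>*" using *(1) ij(4) by (simp add: hd_conv_nth)
  finally show ?thesis .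
qed

lemma connected_if_rooted:
  assumes wf: "wf_digraph H" and r: "r \<in> verts H"
    and reach: "\<And>v. v \<in> verts H \<Longrightarrow> (r, v) \<in> (arcs_ends H)\<^sup>*"
  shows "Digraph_Component.connected H"
proof -
  let ?S = "with_proj (mk_symmetric H)"
  interpret S: pair_wf_digraph "mk_symmetric H" by (rule wf_digraph.wellformed_mk_symmetric[OF wf])
  have r_v: "r \<rightarrow>\<^sup>*\<^bsub>?S\<^esub> v" if "v \<in> verts H" for v
    by (rule wf_digraph.reachable_mk_symmetricI[OF wf])
      (use reachable_iff_rtrancl[OF wf r] reach[OF that] in simp)
  have "v \<rightarrow>\<^sup>*\<^bsub>?S\<^esub> r" if "v \<in> verts H" for v
    by (rule symmetric_reachable[OF symmetric_mk_symmetric r_v[OF that]])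
  then have "u \<rightarrow>\<^sup>*\<^bsub>?S\<^esub> v" if "u \<in> verts H" "v \<in> verts H" for u v
    using S.reachable_trans r_v that by blast
  then show ?thesis
    using r by (auto simp: connected_def strongly_connected_def)
qed

text \<open>Closure under arcs in both directions is closure under the symmetrized arcs, through
  which weak connectedness is defined.\<close>

lemma connected_closed_subset:
  assumes wf: "wf_digraph H" and conn: "Digraph_Component.connected H" and r: "r \<in> verts H" "r \<in> R"
    and closed: "\<And>e. e \<in> arcs H \<Longrightarrow> tail H e \<in> R \<longleftrightarrow> head H e \<in> R"
  shows "verts H \<subseteq> R"
proof
  fix v assume v: "v \<in> verts H"
  let ?S = "with_proj (mk_symmetric H)"
  have "r \<rightarrow>\<^sup>*\<^bsub>?S\<^esub> v" using conn r(1) v by (auto simp: connected_def strongly_connected_def)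
  then have "(r, v) \<in> (arcs_ends ?S)\<^sup>*" by (rule reachable_rtranclI)
  then show "v \<in> R"
  proof (induction rule: rtrancl_induct)
    case base
    show ?case by (rule r(2))
  next
    case (step x y)
    from step.hyps(2) obtain e where "e \<in> arcs H"
      "(x, y) = (tail H e, head H e) \<or> (x, y) = (head H e, tail H e)"
      by (auto simp: parcs_mk_symmetric)
    with closed[of e] step.IH show ?case by auto
  qed
qed

lemma disjoint_family_onD_eq:
  "\<lbrakk>disjoint_family_on verts Cs; C \<in> Cs; C' \<in> Cs; v \<in> verts C; v \<in> verts C'\<rbrakk> \<Longrightarrow> C = C'"
  unfolding disjoint_family_on_def by blast

lemma cactus_graphE:
  assumes "cactus_graph r H"
  obtains T vs Cs stem where "Digraph_Component.connected H" "subgraph T H" "path_labeling vs T"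
    "hd vs = r" "finite Cs"
    "\<forall>C\<in>Cs. subgraph C H \<and> cycle_graph C \<and> verts C \<inter> verts T = {}"
    "disjoint_family_on verts Cs"
    "\<forall>C\<in>Cs. stem C \<in> arcs H \<and> head H (stem C) \<in> verts C \<and>
       tail H (stem C) \<in> verts T \<union> (\<Union>C'\<in>Cs - {C}. verts C')"
    "verts H = verts T \<union> (\<Union>C\<in>Cs. verts C)"
    "arcs H = arcs T \<union> (\<Union>C\<in>Cs. arcs C) \<union> stem ` Cs"
  using assms unfolding cactus_graph_def by (elim conjE exE) (rule that; assumption)

text \<open>Weak connectedness excludes buds whose stems form a closed chain not attached to the
  trunk: the vertices reachable from the root are closed under adjacency, since the stem is the
  only way into a bud.\<close>

lemma cactus_rooted:
  assumes "cactus_graph r H"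
  shows "wf_digraph H" "r \<in> verts H" "\<And>v. v \<in> verts H \<Longrightarrow> (r, v) \<in> (arcs_ends H)\<^sup>*"
proof -
  obtain T vs Cs stem where conn: "Digraph_Component.connected H"
    and T: "subgraph T H" "path_labeling vs T" "hd vs = r"
    and Cs: "\<forall>C\<in>Cs. subgraph C H \<and> cycle_graph C \<and> verts C \<inter> verts T = {}"
    and disj: "disjoint_family_on verts Cs"
    and stems: "\<forall>C\<in>Cs. stem C \<in> arcs H \<and> head H (stem C) \<in> verts C \<and>
       tail H (stem C) \<in> verts T \<union> (\<Union>C'\<in>Cs - {C}. verts C')"
    and arcs: "arcs H = arcs T \<union> (\<Union>C\<in>Cs. arcs C) \<union> stem ` Cs"
    using assms by (rule cactus_graphE)
  have C: "subgraph C H" "cycle_graph C" "verts C \<inter> verts T = {}" if "C \<in> Cs" for C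
    using Cs that by simp_all
  have stem: "head H (stem C) \<in> verts C" if "C \<in> Cs" for C using stems that by simp
  show wf: "wf_digraph H" using T(1) by (simp add: subgraph_def)
  have rT: "r \<in> verts T"
    unfolding T(3)[symmetric] path_labelingD(2)[OF T(2)] by (rule hd_in_set[OF path_labelingD(1)[OF T(2)]])
  have "verts T \<subseteq> verts H" using T(1) by (simp add: subgraph_def)
  then show rH: "r \<in> verts H" using rT by (rule subsetD)
  define R where "R = {v. (r, v) \<in> (arcs_ends H)\<^sup>*}"
  have TR: "verts T \<subseteq> R"
  proof
    fix v assume "v \<in> verts T"
    from path_rtrancl[OF T(2) this] have "(r, v) \<in> (arcs_ends T)\<^sup>*" unfolding T(3) .
    then show "v \<in> R"
      using rtrancl_mono[OF subgraph_arcs_ends[OF T(1)]] unfolding R_def by blast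
  qed
  have C_th: "tail C = tail H" "head C = head H" "wf_digraph C" if "C \<in> Cs" for C
    using C(1)[OF that] by (simp_all add: subgraph_def compatible_def)
  have T_th: "tail T = tail H" "head T = head H" "wf_digraph T"
    using T(1) by (simp_all add: subgraph_def compatible_def)
  have arc_cases: "e \<in> arcs T \<or> (\<exists>C\<in>Cs. e \<in> arcs C) \<or> (\<exists>C\<in>Cs. e = stem C)" if "e \<in> arcs H" for e
    using that unfolding arcs by blast
  have CR: "verts C \<subseteq> R" if CC: "C \<in> Cs" "u \<in> verts C" "u \<in> R" for C u
  proof
    fix v assume "v \<in> verts C"
    with CC(2) have "(u, v) \<in> (arcs_ends C)\<^sup>*" by (rule cycle_rtrancl[OF C(2)[OF CC(1)]])
    then have "(u, v) \<in> (arcs_ends H)\<^sup>*"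
      by (rule rev_subsetD) (rule rtrancl_mono[OF subgraph_arcs_ends[OF C(1)[OF CC(1)]]])
    with CC(3) show "v \<in> R" by (simp add: R_def)
  qed
  \<comment> \<open>Trace a walk from \<open>r\<close> back from its end in \<open>C\<close>: it
    stays in \<open>C\<close> until the step that entered through the stem, so the stem starts at a
    reachable vertex.\<close>
  have stemR: "tail H (stem C) \<in> R" if CC: "C \<in> Cs" "v \<in> verts C" and v: "(r, v) \<in> (arcs_ends H)\<^sup>*" for C v
    using v CC
  proof (induction rule: rtrancl_induct)
    case base
    then show ?case using C(3)[OF base(1)] rT by auto
  next
    case (step u v)
    from step.hyps(2) obtain e where e: "e \<in> arcs H" "tail H e = u" "head H e = v" by (rule arcs_endsE)
    from arc_cases[OF e(1)] show ?case
    proof (elim disjE bexE)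
      assume "e \<in> arcs T"
      then have "v \<in> verts T" using wf_digraph.head_in_verts[OF T_th(3)] T_th(2) e(3) by auto
      then show ?thesis using C(3)[OF step.prems(1)] step.prems(2) by auto
    next
      fix C' assume C': "C' \<in> Cs" "e \<in> arcs C'"
      have "u \<in> verts C'" "v \<in> verts C'"
        using wf_digraph.tail_in_verts[OF C_th(3)[OF C'(1)] C'(2)]
          wf_digraph.head_in_verts[OF C_th(3)[OF C'(1)] C'(2)] C_th[OF C'(1)] e by auto
      moreover from this have "C' = C"
        using disjoint_family_onD_eq[OF disj C'(1) step.prems(1) _ step.prems(2)] by simp
      ultimately show ?thesis using step.IH step.prems(1) by simp
    next
      fix C' assume C': "C' \<in> Cs" "e = stem C'"
      then have "v \<in> verts C'" using stem[OF C'(1)] e(3) by simp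
      then have "C' = C"
        using disjoint_family_onD_eq[OF disj C'(1) step.prems(1) _ step.prems(2)] by simp
      then show ?thesis using C'(2) e(2) step.hyps(1) by (simp add: R_def)
    qed
  qed
  have closed: "tail H e \<in> R \<longleftrightarrow> head H e \<in> R" if e: "e \<in> arcs H" for e
  proof
    assume "tail H e \<in> R"
    with arcs_ends_arc[OF e] show "head H e \<in> R" by (auto simp: R_def)
  next
    assume hR: "head H e \<in> R"
    from arc_cases[OF e] show "tail H e \<in> R"
    proof (elim disjE bexE)
      assume "e \<in> arcs T"
      then have "tail H e \<in> verts T" using wf_digraph.tail_in_verts[OF T_th(3)] T_th(1) by auto
      with TR show ?thesis by blast
    next
      fix C' assume C': "C' \<in> Cs" "e \<in> arcs C'"
      have "tail H e \<in> verts C'" "head H e \<in> verts C'"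
        using wf_digraph.tail_in_verts[OF C_th(3)[OF C'(1)] C'(2)]
          wf_digraph.head_in_verts[OF C_th(3)[OF C'(1)] C'(2)] C_th[OF C'(1)] by auto
      with CR[OF C'(1) _ hR] show ?thesis by blast
    next
      fix C' assume C': "C' \<in> Cs" "e = stem C'"
      then have "head H e \<in> verts C'" using stem[OF C'(1)] by simp
      with stemR[OF C'(1)] hR C'(2) show ?thesis by (simp add: R_def)
    qed
  qed
  have "r \<in> R" by (simp add: R_def)
  from connected_closed_subset[OF wf conn rH this closed]
  show "(r, v) \<in> (arcs_ends H)\<^sup>*" if "v \<in> verts H" for v using that by (auto simp: R_def)
qed

lemma path_cactus:
  assumes P: "path_labeling vs P" and wf: "wf_digraph P"
  shows "cactus_graph (hd vs) P"
proof -
  have "hd vs \<in> verts P" using path_labelingD(1,2)[OF P] by simp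
  then have "Digraph_Component.connected P" by (rule connected_if_rooted[OF wf _ path_rtrancl[OF P]])
  moreover have "subgraph P P" using wf by (simp add: subgraph_def compatible_def)
  ultimately show ?thesis
    unfolding cactus_graph_def using P
    by (intro conjI exI[of _ P] exI[of _ vs] exI[of _ "{}"]) (simp_all add: disjoint_family_on_def)
qed

definition add_bud :: "('a, 'b) pre_digraph \<Rightarrow> ('a, 'b) pre_digraph \<Rightarrow> 'b \<Rightarrow> ('a, 'b) pre_digraph" where
  "add_bud H C e = \<lparr>verts = verts H \<union> verts C, arcs = arcs H \<union> arcs C \<union> {e}, tail = tail H, head = head H\<rparr>"

lemma add_bud_simps [simp]:
  "verts (add_bud H C e) = verts H \<union> verts C" "arcs (add_bud H C e) = arcs H \<union> arcs C \<union> {e}"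
  "tail (add_bud H C e) = tail H" "head (add_bud H C e) = head H"
  by (simp_all add: add_bud_def)

text \<open>The new cycle is reached from \<open>r\<close> through its stem \<open>e\<close>, so
  weak connectedness persists; trunk, old buds and old stems are kept.\<close>

lemma add_bud_cactus:
  assumes H: "cactus_graph r H" and cyc: "cycle_graph C" and wfC: "wf_digraph C"
    and th: "tail C = tail H" "head C = head H" and disj: "verts C \<inter> verts H = {}"
    and e: "tail H e \<in> verts H" "head H e \<in> verts C"
  shows "cactus_graph r (add_bud H C e)"
proof -
  let ?H = "add_bud H C e"
  note root = cactus_rooted[OF H]
  have wf: "wf_digraph ?H"
    using root(1) wfC e th by (auto simp: wf_digraph_def)
  have subH: "subgraph H ?H" and subC: "subgraph C ?H"
    using root(1) wfC wf th by (auto simp: subgraph_def compatible_def)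
  have sub_trans: "subgraph T ?H" if "subgraph T H" for T
    using that subH by (auto simp: subgraph_def compatible_def)
  have "(r, v) \<in> (arcs_ends ?H)\<^sup>*" if v: "v \<in> verts ?H" for v
  proof (cases "v \<in> verts H")
    case True
    show ?thesis by (rule subsetD[OF rtrancl_mono[OF subgraph_arcs_ends[OF subH]] root(3)[OF True]])
  next
    case False
    with v have vC: "v \<in> verts C" by simp
    have "(r, tail H e) \<in> (arcs_ends ?H)\<^sup>*"
      using root(3)[OF e(1)] rtrancl_mono[OF subgraph_arcs_ends[OF subH]] by blast
    also have "(tail H e, head H e) \<in> arcs_ends ?H" using arcs_ends_arc[of e ?H] by simp
    also have "(head H e, v) \<in> (arcs_ends ?H)\<^sup>*"
      using cycle_rtrancl[OF cyc e(2) vC] rtrancl_mono[OF subgraph_arcs_ends[OF subC]] by blast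
    finally show ?thesis .
  qed
  then have conn: "Digraph_Component.connected ?H"
    using root(2) by (intro connected_if_rooted[OF wf, of r]) auto
  obtain T vs Cs stem where T: "subgraph T H" "path_labeling vs T" "hd vs = r" and fin: "finite Cs"
    and Cs: "\<forall>C\<in>Cs. subgraph C H \<and> cycle_graph C \<and> verts C \<inter> verts T = {}"
    and disjCs: "disjoint_family_on verts Cs"
    and stem: "\<forall>C\<in>Cs. stem C \<in> arcs H \<and> head H (stem C) \<in> verts C \<and>
       tail H (stem C) \<in> verts T \<union> (\<Union>C'\<in>Cs - {C}. verts C')"
    and verts: "verts H = verts T \<union> (\<Union>C\<in>Cs. verts C)"
    and arcs: "arcs H = arcs T \<union> (\<Union>C\<in>Cs. arcs C) \<union> stem ` Cs"
    using H by (rule cactus_graphE)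
  have notin: "C \<notin> Cs" using disj e(2) verts by auto
  define stem' where "stem' = stem(C := e)"
  have stem'_old: "stem' D = stem D" if "D \<in> Cs" for D using that notin by (auto simp: stem'_def)
  have stem'_C: "stem' C = e" by (simp add: stem'_def)
  have "cycle_graph D \<and> subgraph D ?H \<and> verts D \<inter> verts T = {}" if "D \<in> insert C Cs" for D
    using that Cs cyc subC sub_trans disj verts by auto
  moreover have "disjoint_family_on verts (insert C Cs)"
    using disjCs disj verts unfolding disjoint_family_on_def by blast
  moreover have "stem' D \<in> arcs ?H \<and> head ?H (stem' D) \<in> verts D \<and>
      tail ?H (stem' D) \<in> verts T \<union> (\<Union>C'\<in>insert C Cs - {D}. verts C')" if "D \<in> insert C Cs" for D
  proof (cases "D = C")
    case True
    have "insert C Cs - {C} = Cs" using notin by auto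
    then show ?thesis unfolding True stem'_C using e verts by simp
  next
    case False
    with that have D: "D \<in> Cs" by simp
    then show ?thesis unfolding stem'_old[OF D] using stem by auto
  qed
  moreover have "stem' ` insert C Cs = insert e (stem ` Cs)"
    using stem'_C stem'_old by (auto simp: image_iff)
  then have "arcs ?H = arcs T \<union> (\<Union>C\<in>insert C Cs. arcs C) \<union> stem' ` insert C Cs"
    using arcs by auto
  moreover have "verts ?H = verts T \<union> (\<Union>C\<in>insert C Cs. verts C)"
    using verts by auto
  ultimately show ?thesis
    unfolding cactus_graph_def using conn T(2,3) sub_trans[OF T(1)] fin
    by (intro conjI exI[of _ T] exI[of _ vs] exI[of _ "insert C Cs"] exI[of _ stem']) auto
qed

lemma rtrancl_crossing:
  assumes "(a, b) \<in> E\<^sup>*" "a \<in> V" "b \<notin> V"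
  shows "\<exists>x y. (x, y) \<in> E \<and> x \<in> V \<and> y \<notin> V"
  using assms by (induction rule: rtrancl_induct) auto

section \<open>Growing spanning cacti from a decomposition\<close>

context decomposed
begin

definition roots :: "'a set" where "roots = verts S - head S ` arcs S"

text \<open>The invariant of the growth: the cacti cover precisely the paths and the cycles in
  \<open>As\<close>. They are subgraphs of \<open>G\<close> rather than of \<open>S\<close>, because
  stems join different components of \<open>S\<close>.\<close>

definition attached :: "('a, 'b) pre_digraph \<Rightarrow> ('a, 'b) pre_digraph set \<Rightarrow> ('a \<Rightarrow> ('a, 'b) pre_digraph) \<Rightarrow> bool" where
  "attached G As H \<longleftrightarrow> As \<subseteq> Cs \<and> (\<forall>r\<in>roots. cactus_graph r (H r) \<and> subgraph (H r) G) \<and>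
     disjoint_family_on (\<lambda>r. verts (H r)) roots \<and>
     (\<Union>r\<in>roots. verts (H r)) = (\<Union>P\<in>Ps \<union> As. verts P)"

lemma attached_paths:
  assumes S: "spanning S G"
  shows "\<exists>H. attached G {} H"
proof -
  have "\<forall>r\<in>roots. \<exists>P. P \<in> Ps \<and> (\<exists>vs. path_labeling vs P \<and> r = hd vs)"
    using ex_path_hd unfolding roots_def by blast
  from bchoice[OF this] obtain H where H: "\<forall>r\<in>roots. H r \<in> Ps \<and> (\<exists>vs. path_labeling vs (H r) \<and> r = hd vs)" ..
  have root_eq: "roots \<inter> verts (H r) = {r}" if r: "r \<in> roots" for r
  proof -
    obtain vs where vs: "H r \<in> Ps" "path_labeling vs (H r)" "r = hd vs" using H r by blast
    have "verts (H r) - head S ` arcs S = {r}" using path_ends(2)[OF vs(1,2)] vs(3) by simp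
    moreover have "verts (H r) \<subseteq> verts S" using disjoint_graph_unionD(3)[OF union, of "H r"] vs(1) by simp
    ultimately show ?thesis unfolding roots_def by blast
  qed
  have sub: "subgraph (H r) G" if r: "r \<in> roots" for r
  proof -
    have "subgraph (H r) S" using union H r by (simp add: disjoint_graph_union_def)
    then show ?thesis using S by (auto simp: spanning_def subgraph_def compatible_def)
  qed
  have "cactus_graph r (H r)" if r: "r \<in> roots" for r
  proof -
    obtain vs where vs: "path_labeling vs (H r)" "r = hd vs" using H r by blast
    show ?thesis unfolding vs(2)
      by (rule path_cactus[of vs]) (use sub[OF r] vs in \<open>simp_all add: subgraph_def\<close>)
  qed
  moreover have "disjoint_family_on (\<lambda>r. verts (H r)) roots"
    unfolding disjoint_family_on_def
  proof (intro ballI impI, rule ccontr)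
    fix r r' assume r: "r \<in> roots" "r' \<in> roots" "r \<noteq> r'" "verts (H r) \<inter> verts (H r') \<noteq> {}"
    then obtain v where "v \<in> verts (H r)" "v \<in> verts (H r')" by blast
    then have "H r = H r'" using disjoint_graph_union_eq[OF union, of "H r" "H r'" v] H r(1,2) by simp
    then have "roots \<inter> verts (H r) = roots \<inter> verts (H r')" by (rule arg_cong)
    then have "{r} = {r'}" unfolding root_eq[OF r(1)] root_eq[OF r(2)] .
    with r(3) show False by simp
  qed
  moreover have "(\<Union>r\<in>roots. verts (H r)) = (\<Union>P\<in>Ps. verts P)"
  proof (intro equalityI subsetI)
    fix v assume "v \<in> (\<Union>r\<in>roots. verts (H r))"
    then show "v \<in> (\<Union>P\<in>Ps. verts P)" using H by blast
  next
    fix v assume "v \<in> (\<Union>P\<in>Ps. verts P)"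
    then obtain P where P: "P \<in> Ps" "v \<in> verts P" by blast
    obtain vs where vs: "path_labeling vs P" using path[OF P(1)] by (auto simp: path_graph_def)
    have r: "hd vs \<in> roots" unfolding roots_def by (rule hd_unmatched[OF P(1) vs])
    have "hd vs \<in> verts P" using path_labelingD(1,2)[OF vs] by simp
    moreover have "hd vs \<in> verts (H (hd vs))" using root_eq[OF r] by blast
    ultimately have "P = H (hd vs)"
      using disjoint_graph_union_eq[OF union, of P "H (hd vs)" "hd vs"] H r P(1) by simp
    with P(2) r show "v \<in> (\<Union>r\<in>roots. verts (H r))" by blast
  qed
  ultimately have "attached G {} H" unfolding attached_def using sub by simp
  then show ?thesis by (intro exI[of _ H])
qed

text \<open>A walk of the forest leads from a root to an uncovered vertex. Some arc \<open>e\<close>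
  of it leaves the covered set and enters an uncovered component, necessarily a cycle, whose stem it
  becomes.\<close>

lemma attach_bud:
  assumes S: "spanning S G" and forest: "spanning_forest_rooted G roots"
    and att: "attached G As H" and ne: "As \<noteq> Cs"
  shows "\<exists>C H'. C \<in> Cs - As \<and> attached G (insert C As) H'"
proof -
  have AsC: "As \<subseteq> Cs" and cact: "\<And>r. r \<in> roots \<Longrightarrow> cactus_graph r (H r)"
    and subH: "\<And>r. r \<in> roots \<Longrightarrow> subgraph (H r) G"
    and disj: "disjoint_family_on (\<lambda>r. verts (H r)) roots"
    and V: "(\<Union>r\<in>roots. verts (H r)) = (\<Union>P\<in>Ps \<union> As. verts P)"
    using att unfolding attached_def by blast+
  define V' where "V' = (\<Union>P\<in>Ps \<union> As. verts P)"
  have wfG: "wf_digraph G" and vG: "verts G = verts S" and cSG: "tail G = tail S" "head G = head S"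
    and arcsSG: "arcs S \<subseteq> arcs G"
    using S by (auto simp: spanning_def subgraph_def compatible_def)
  have comp_disj: "verts D \<inter> V' = {}" if D: "D \<in> Ps \<union> Cs" "v \<in> verts D" "v \<notin> V'" for D v
  proof (rule ccontr)
    assume "verts D \<inter> V' \<noteq> {}"
    then obtain x P where x: "x \<in> verts D" "P \<in> Ps \<union> As" "x \<in> verts P" unfolding V'_def by blast
    have "D = P" by (rule disjoint_graph_union_eq[OF union D(1) _ x(1,3)]) (use x(2) AsC in auto)
    with x(2) D(2,3) show False unfolding V'_def by blast
  qed
  \<comment> \<open>\<open>C0\<close> only provides an uncovered vertex; the cycle attached below
    may be a different one.\<close>
  obtain C0 where C0: "C0 \<in> Cs" "C0 \<notin> As" using ne AsC by blast
  obtain vs where vs: "cycle_labeling vs C0" using cycle[OF C0(1)] by (auto simp: cycle_graph_def)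
  then have v0: "hd vs \<in> verts C0" using cycle_labelingD(1,2)[OF vs] by simp
  have v0S: "hd vs \<in> verts S" using disjoint_graph_unionD(3)[OF union, of C0] C0(1) v0 by auto
  have v0V: "hd vs \<notin> V'"
  proof
    assume "hd vs \<in> V'"
    then obtain P where P: "P \<in> Ps \<union> As" "hd vs \<in> verts P" unfolding V'_def by blast
    have "C0 = P" by (rule disjoint_graph_union_eq[OF union _ _ v0 P(2)]) (use C0 P(1) AsC in auto)
    with P(1) C0(2) have "C0 \<in> Ps" by simp
    then obtain ws where "path_labeling ws C0" using path by (auto simp: path_graph_def)
    from path_graph_not_cycle_graph[OF this] cycle[OF C0(1)] show False by contradiction
  qed
  have rV: "r \<in> V'" if "r \<in> roots" for r
    using cactus_rooted(2)[OF cact[OF that]] that V unfolding V'_def by blast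
  then have "hd vs \<in> verts G - roots" using v0S v0V vG by blast
  then obtain r where r: "r \<in> roots" "r \<rightarrow>\<^sup>*\<^bsub>G\<^esub> hd vs"
    using forest unfolding spanning_forest_rooted_def by blast
  from rtrancl_crossing[OF reachable_rtranclI[OF r(2)] rV[OF r(1)] v0V]
  obtain x y where xy: "(x, y) \<in> arcs_ends G" "x \<in> V'" "y \<notin> V'" by blast
  from xy(1) obtain e where e: "e \<in> arcs G" "tail G e = x" "head G e = y" by (rule arcs_endsE)
  have "y \<in> verts S" using wf_digraph.head_in_verts[OF wfG e(1)] e(3) vG by simp
  then obtain C where C: "C \<in> Ps \<union> Cs" "y \<in> verts C" using ex_component by blast
  have CPA: "C \<notin> Ps" "C \<notin> As" using xy(3) C(2) unfolding V'_def by blast+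
  with C(1) have CC: "C \<in> Cs" by simp
  have CV: "verts C \<inter> V' = {}" by (rule comp_disj[OF C xy(3)])
  have subC: "subgraph C S" using union CC by (simp add: disjoint_graph_union_def)
  obtain r0 where r0: "r0 \<in> roots" "x \<in> verts (H r0)" using xy(2) V unfolding V'_def by blast
  have HV: "verts (H r') \<subseteq> V'" if "r' \<in> roots" for r' using V that unfolding V'_def by blast
  have th: "tail (H r0) = tail S" "head (H r0) = head S" "arcs (H r0) \<subseteq> arcs G" "verts (H r0) \<subseteq> verts G"
    using subH[OF r0(1)] cSG by (auto simp: subgraph_def compatible_def)
  have thC: "tail C = tail S" "head C = head S" "wf_digraph C" "arcs C \<subseteq> arcs S" "verts C \<subseteq> verts S"
    using subC by (auto simp: subgraph_def compatible_def)
  let ?B = "add_bud (H r0) C e"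
  have bud: "cactus_graph r0 ?B"
    by (rule add_bud_cactus[OF cact[OF r0(1)] cycle[OF CC] thC(3)])
      (use th thC CV HV[OF r0(1)] e cSG r0(2) C(2) in auto)
  have subB: "subgraph ?B G"
    using cactus_rooted(1)[OF bud] wfG th thC arcsSG vG cSG e(1)
    by (auto simp: subgraph_def compatible_def)
  define H' where "H' = H(r0 := ?B)"
  have H'_old: "H' r' = H r'" if "r' \<noteq> r0" for r' using that by (simp add: H'_def)
  have H'_new: "H' r0 = ?B" by (simp add: H'_def)
  have "cactus_graph r' (H' r') \<and> subgraph (H' r') G" if "r' \<in> roots" for r'
    using bud subB cact[OF that] subH[OF that] H'_old H'_new by (cases "r' = r0") simp_all
  moreover have "disjoint_family_on (\<lambda>r. verts (H' r)) roots"
    unfolding disjoint_family_on_def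
  proof (intro ballI impI)
    fix a b assume ab: "a \<in> roots" "b \<in> roots" "a \<noteq> b"
    have old: "verts (H a) \<inter> verts (H b) = {}" using disj ab unfolding disjoint_family_on_def by blast
    have "verts C \<inter> verts (H a) = {}" "verts C \<inter> verts (H b) = {}" using CV HV[OF ab(1)] HV[OF ab(2)] by auto
    with old ab(3) show "verts (H' a) \<inter> verts (H' b) = {}"
      by (cases "a = r0"; cases "b = r0") (auto simp: H'_def)
  qed
  moreover have "(\<Union>r\<in>roots. verts (H' r)) = (\<Union>P\<in>Ps \<union> insert C As. verts P)"
  proof -
    have "(\<Union>r\<in>roots. verts (H' r)) = (\<Union>r\<in>roots. verts (H r)) \<union> verts C"
    proof (intro equalityI subsetI)
      fix v assume "v \<in> (\<Union>r\<in>roots. verts (H' r))"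
      then obtain r' where r': "r' \<in> roots" "v \<in> verts (H' r')" by blast
      then show "v \<in> (\<Union>r\<in>roots. verts (H r)) \<union> verts C"
        by (cases "r' = r0") (auto simp: H'_def)
    next
      fix v assume "v \<in> (\<Union>r\<in>roots. verts (H r)) \<union> verts C"
      then consider r' where "r' \<in> roots" "v \<in> verts (H r')" | "v \<in> verts C" by blast
      then show "v \<in> (\<Union>r\<in>roots. verts (H' r))"
      proof cases
        case 1
        then have "v \<in> verts (H' r')" by (cases "r' = r0") (auto simp: H'_def)
        with 1(1) show ?thesis by blast
      next
        case 2
        then have "v \<in> verts (H' r0)" by (simp add: H'_new)
        with r0(1) show ?thesis by blast
      qed
    qed
    then show ?thesis unfolding V by auto
  qed
  ultimately have "attached G (insert C As) H'" unfolding attached_def using AsC CC by blast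
  with CC CPA(2) show ?thesis by blast
qed

lemma ex_spanning_cacti:
  assumes S: "spanning S G" and forest: "spanning_forest_rooted G roots"
  shows "\<exists>S' H. spanning S' G \<and> disjoint_graph_union S' roots H \<and> (\<forall>r\<in>roots. cactus_graph r (H r))"
proof -
  have "k \<le> card Cs \<Longrightarrow> \<exists>As H. attached G As H \<and> card As = k" for k
  proof (induction k)
    case 0
    from attached_paths[OF S] obtain H where "attached G {} H" by (elim exE)
    then show ?case by (intro exI[of _ "{}"] exI[of _ H]) simp
  next
    case (Suc k)
    then obtain As H where att: "attached G As H" "card As = k" by auto
    then have ne: "As \<noteq> Cs" and fin_As: "finite As"
      using Suc.prems fin(2) finite_subset[of As Cs] by (auto simp: attached_def)
    from attach_bud[OF S forest att(1) ne] obtain C H' where "C \<in> Cs - As" "attached G (insert C As) H'"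
      by blast
    moreover from this have "card (insert C As) = Suc k" using fin_As att(2) by simp
    ultimately show ?case by blast
  qed
  from this[OF order_refl] obtain As H where att: "attached G As H" "card As = card Cs" by blast
  have As: "As = Cs" by (rule card_subset_eq[OF fin(2)]) (use att in \<open>auto simp: attached_def\<close>)
  have cact: "\<And>r. r \<in> roots \<Longrightarrow> cactus_graph r (H r)"
    and subH: "\<And>r. r \<in> roots \<Longrightarrow> subgraph (H r) G"
    and disj: "disjoint_family_on (\<lambda>r. verts (H r)) roots"
    and V: "(\<Union>r\<in>roots. verts (H r)) = (\<Union>P\<in>Ps \<union> Cs. verts P)"
    using att(1) unfolding attached_def As by blast+
  have wfG: "wf_digraph G" and vG: "verts G = verts S"
    using S by (auto simp: spanning_def subgraph_def)
  have VS: "verts S = (\<Union>r\<in>roots. verts (H r))" using union V by (simp add: disjoint_graph_union_def)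
  define S' where "S' = \<lparr>verts = verts G, arcs = (\<Union>r\<in>roots. arcs (H r)), tail = tail G, head = head G\<rparr>"
  have Hr: "arcs (H r) \<subseteq> arcs G" "tail (H r) = tail G" "head (H r) = head G" "verts (H r) \<subseteq> verts G"
    "wf_digraph (H r)" if "r \<in> roots" for r
    using subH[OF that] by (auto simp: subgraph_def compatible_def)
  have arcsS': "arcs S' \<subseteq> arcs G" unfolding S'_def using Hr(1) by auto
  have wfS': "wf_digraph S'"
    unfolding wf_digraph_def
    using arcsS' wf_digraph.tail_in_verts[OF wfG] wf_digraph.head_in_verts[OF wfG] by (auto simp: S'_def)
  have "spanning S' G"
    using arcsS' wfS' wfG by (simp add: spanning_def subgraph_def compatible_def S'_def)
  moreover have "subgraph (H r) S'" if r: "r \<in> roots" for r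
  proof -
    have "arcs (H r) \<subseteq> arcs S'" using r by (auto simp: S'_def)
    then show ?thesis using Hr[OF r] wfS' by (simp add: subgraph_def compatible_def S'_def)
  qed
  then have "disjoint_graph_union S' roots H"
    unfolding disjoint_graph_union_def using disj VS vG by (simp add: S'_def)
  ultimately show ?thesis using cact by blast
qed

end

lemma spanning_cacti_imp_forest:
  assumes S: "spanning S G" and U: "disjoint_graph_union S R H" and cact: "\<And>r. r \<in> R \<Longrightarrow> cactus_graph r (H r)"
  shows "spanning_forest_rooted G R"
  unfolding spanning_forest_rooted_def
proof
  fix v assume "v \<in> verts G - R"
  then have "v \<in> (\<Union>r\<in>R. verts (H r))" using S U by (simp add: spanning_def disjoint_graph_union_def)
  then obtain r where r: "r \<in> R" "v \<in> verts (H r)" by blast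
  have sub: "subgraph (H r) S" "subgraph S G" using S U r(1) by (simp_all add: spanning_def disjoint_graph_union_def)
  have "(r, v) \<in> (arcs_ends (H r))\<^sup>*" by (rule cactus_rooted(3)[OF cact[OF r(1)] r(2)])
  moreover have "arcs_ends (H r) \<subseteq> arcs_ends G"
    using subgraph_arcs_ends[OF sub(1)] subgraph_arcs_ends[OF sub(2)] by (rule subset_trans)
  ultimately have "(r, v) \<in> (arcs_ends G)\<^sup>*" using rtrancl_mono by blast
  moreover have "wf_digraph G" "r \<in> verts G"
    using sub cactus_rooted(2)[OF cact[OF r(1)]] by (auto simp: subgraph_def)
  ultimately have "r \<rightarrow>\<^sup>*\<^bsub>G\<^esub> v" by (simp add: reachable_iff_rtrancl)
  with r(1) show "\<exists>r\<in>R. r \<rightarrow>\<^sup>*\<^bsub>G\<^esub> v" ..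
qed

subsection \<open>The main theorem\<close>

context rank_one_param
begin

lemma wf_Gr: "wf_digraph Gr"
  using wf_sub[of "arcs Gr"] Gr_eq by simp

lemma arcs_ends_Gr: "arcs_ends Gr = adj"
proof (intro equalityI subrelI)
  fix j i assume "(j, i) \<in> arcs_ends Gr"
  then show "(j, i) \<in> adj" by (auto simp: arcs_ends_conv Gr_def adj_def)
next
  fix j i assume "(j, i) \<in> adj"
  then obtain k where "j < n + m" "i < n" "k < q" "g k i * h k j \<noteq> 0" by (auto simp: adj_def)
  then have "(j, i, k) \<in> arcs Gr" by (simp add: Gr_def)
  from arcs_ends_arc[OF this] show "(j, i) \<in> arcs_ends Gr" by simp
qed

lemma forest_iff_all_reachable: "spanning_forest_rooted Gr {n..<n + m} \<longleftrightarrow> all_reachable"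
proof
  assume forest: "spanning_forest_rooted Gr {n..<n + m}"
  show all_reachable unfolding all_reachable_def
  proof (intro allI impI)
    fix i assume "i < n"
    then have "i \<in> verts Gr - {n..<n + m}" by simp
    then obtain r where r: "r \<in> {n..<n + m}" "r \<rightarrow>\<^sup>*\<^bsub>Gr\<^esub> i"
      using forest unfolding spanning_forest_rooted_def by blast
    then have "r - n < m" "(n + (r - n), i) \<in> adj\<^sup>*"
      using reachable_rtranclI[OF r(2)] by (auto simp: arcs_ends_Gr)
    then show "\<exists>l<m. (n + l, i) \<in> adj\<^sup>*" by blast
  qed
next
  assume reach: all_reachable
  show "spanning_forest_rooted Gr {n..<n + m}" unfolding spanning_forest_rooted_def
  proof
    fix i assume "i \<in> verts Gr - {n..<n + m}"
    then have "i < n" by auto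
    then obtain l where l: "l < m" "(n + l, i) \<in> adj\<^sup>*" using reach unfolding all_reachable_def by blast
    have "(n + l) \<rightarrow>\<^sup>*\<^bsub>Gr\<^esub> i"
      by (subst reachable_iff_rtrancl[OF wf_Gr]) (use l in \<open>simp_all add: arcs_ends_Gr\<close>)
    with l(1) show "\<exists>r\<in>{n..<n + m}. r \<rightarrow>\<^sup>*\<^bsub>Gr\<^esub> i" by (intro bexI[of _ "n + l"]) simp_all
  qed
qed

text \<open>From the forest, cacti are grown with the paths of \<open>S\<close> as trunks and the
  cycles of \<open>S\<close> as buds; their roots are the sources of \<open>S\<close>, which are the
  inputs.\<close>

lemma cacti_iff_forest:
  assumes "multi_colored_subgraph m Gr S"
  shows "(\<exists>S' H. spanning S' Gr \<and> disjoint_graph_union S' {n..<n + m} H \<and>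
      (\<forall>r\<in>{n..<n + m}. cactus_graph r (H r))) \<longleftrightarrow> spanning_forest_rooted Gr {n..<n + m}"
proof
  assume "\<exists>S' H. spanning S' Gr \<and> disjoint_graph_union S' {n..<n + m} H \<and>
      (\<forall>r\<in>{n..<n + m}. cactus_graph r (H r))"
  then obtain S' H where S': "spanning S' Gr" "disjoint_graph_union S' {n..<n + m} H"
      "\<forall>r\<in>{n..<n + m}. cactus_graph r (H r)"
    by (elim exE conjE)
  show "spanning_forest_rooted Gr {n..<n + m}"
    by (rule spanning_cacti_imp_forest[OF S'(1,2)]) (use S'(3) in simp)
next
  assume forest: "spanning_forest_rooted Gr {n..<n + m}"
  obtain Ps Cs where dec: "path_cycle_decomposition m S Ps Cs" and span: "spanning S Gr"
    using assms unfolding multi_colored_subgraph_def by (elim conjE exE)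
  obtain A where A: "S = spanning_sub A" using multi_colored_subgraph_imp_spanning_sub[OF assms] by (rule that)
  interpret decomposed m S Ps Cs by unfold_locales (rule dec)
  have "roots = source_verts m S" unfolding roots_def source_verts_eq[OF dec] ..
  also have "\<dots> = {n..<n + m}" unfolding A by (rule sinks_sources_spanning_sub(2)[OF assms[unfolded A]])
  finally have "roots = {n..<n + m}" .
  with ex_spanning_cacti[OF span] forest
  show "\<exists>S' H. spanning S' Gr \<and> disjoint_graph_union S' {n..<n + m} H \<and>
      (\<forall>r\<in>{n..<n + m}. cactus_graph r (H r))"
    by simp
qed

lemma similarity_class_imp_multi_colored_subgraph:
  assumes "K \<in> similarity_classes m Gr"
  shows "\<exists>S. multi_colored_subgraph m Gr S"
  using assms unfolding similarity_classes_def by (auto elim!: quotientE)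

end

lemma full_row_rank_cong:
  assumes "\<And>i j. \<lbrakk>i < n; j < c\<rbrakk> \<Longrightarrow> M i j = M' i j"
  shows "full_row_rank n c M \<longleftrightarrow> full_row_rank n c M'"
proof -
  have "(\<Sum>i<n. v i * M i j) = (\<Sum>i<n. v i * M' i j)" if "j < c" for v j
    using assms that by (intro sum.cong) auto
  then show ?thesis unfolding full_row_rank_def by simp
qed

lemma irreducible_pair_cong:
  assumes "\<And>p. p \<in> carrier_vec q \<Longrightarrow> A p = A' p" "\<And>p. p \<in> carrier_vec q \<Longrightarrow> B p = B' p"
  shows "irreducible_pair n m q A B \<longleftrightarrow> irreducible_pair n m q A' B'"
  unfolding irreducible_pair_def using assms by (simp cong: ball_cong)

theorem theorem1:
  fixes n m q :: nat
    and g h :: "nat \<Rightarrow> real mat"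
    and A B :: "real vec \<Rightarrow> real mat"
  assumes "n \<ge> 1" and "m \<ge> 1" and "q \<ge> 1"
    and "\<And>k. k < q \<Longrightarrow> g k \<in> carrier_mat n 1 \<and> elements_mat (g k) \<subseteq> {0, 1}"
    and "\<And>k. k < q \<Longrightarrow> h k \<in> carrier_mat 1 (n + m) \<and> elements_mat (h k) \<subseteq> {0, 1}"
    and "linearly_independent_products n m q g h"
    and "\<And>p. p \<in> carrier_vec q \<Longrightarrow> A p \<in> carrier_mat n n \<and> B p \<in> carrier_mat n m"
    and "\<And>p. p \<in> carrier_vec q \<Longrightarrow> A p @\<^sub>c B p = linear_param n m q g h p"
  shows "(structurally_controllable q A B \<longleftrightarrow>
            generic_rank q (\<lambda>p. A p @\<^sub>c B p) = n \<and> irreducible_pair n m q A B) \<and>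
         (structurally_controllable q A B \<longleftrightarrow>
            (\<exists>K \<in> similarity_classes m (graph_of_pair n m q g h). \<not> balanced_class m K) \<and>
            (\<exists>S H. spanning S (graph_of_pair n m q g h) \<and>
               disjoint_graph_union S {n..<n + m} H \<and>
               (\<forall>r \<in> {n..<n + m}. cactus_graph r (H r)))) \<and>
         (structurally_controllable q A B \<longleftrightarrow>
            (\<exists>K \<in> similarity_classes m (graph_of_pair n m q g h). \<not> balanced_class m K) \<and>
            spanning_forest_rooted (graph_of_pair n m q g h) {n..<n + m})"
proof -
  define g' where "g' = (\<lambda>k i. g k $$ (i, 0))"
  define h' where "h' = (\<lambda>k j. h k $$ (0, j))"
  have gh: "(g k * h k) $$ (i, j) = g' k i * h' k j" if "k < q" "i < n" "j < n + m" for k i j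
    using index_mult_mat_sum[of "g k" n 1 "h k" "n + m" i j] assms(4,5)[OF that(1)] that(2,3)
    by (simp add: g'_def h'_def del: index_mult_mat)
  have g01: "g' k i = 0 \<or> g' k i = 1" if "k < q" "i < n" for k i
  proof -
    have "g k $$ (i, 0) \<in> elements_mat (g k)"
      by (rule elements_matI[of _ n 1]) (use assms(4)[OF that(1)] that(2) in auto)
    then show ?thesis using assms(4)[OF that(1)] by (auto simp: g'_def)
  qed
  have h01: "h' k j = 0 \<or> h' k j = 1" if "k < q" "j < n + m" for k j
  proof -
    have "h k $$ (0, j) \<in> elements_mat (h k)"
      by (rule elements_matI[of _ 1 "n + m"]) (use assms(5)[OF that(1)] that(2) in auto)
    then show ?thesis using assms(5)[OF that(1)] by (auto simp: h'_def)
  qed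
  \<comment> \<open>A vanishing product \<open>g k * h k\<close> would give a linear relation with
    coefficient vector \<open>unit_vec q k\<close>.\<close>
  have nz: "\<exists>i<n. \<exists>j<n + m. g' k i * h' k j \<noteq> 0" if k: "k < q" for k
  proof (rule ccontr)
    assume "\<not> ?thesis"
    then have z: "(g k * h k) $$ (i, j) = 0" if "i < n" "j < n + m" for i j
      using gh[OF k that] that by auto
    have "(\<Sum>k'<q. unit_vec q k $ k' * (g k' * h k') $$ (i, j)) = 0" if "i < n" "j < n + m" for i j
    proof (rule sum.neutral, rule ballI)
      fix k' assume "k' \<in> {..<q}"
      then show "unit_vec q k $ k' * (g k' * h k') $$ (i, j) = 0"
        using z[OF that] k by (cases "k' = k") simp_all
    qed
    then have "linear_param n m q g h (unit_vec q k) = 0\<^sub>m n (n + m)"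
      unfolding linear_param_def by (intro eq_matI) simp_all
    moreover have "unit_vec q k \<in> carrier_vec q" by simp
    ultimately have "unit_vec q k = (0\<^sub>v q :: real vec)"
      using assms(6) unfolding linearly_independent_products_def by blast
    then have "unit_vec q k $ k = (0\<^sub>v q :: real vec) $ k" by simp
    with k show False by simp
  qed
  interpret rank_one_param n m q g' h'
    by unfold_locales (fact g01, fact h01, fact nz)
  have Gr: "graph_of_pair n m q g h = Gr"
    unfolding graph_of_pair_def Gr_def using gh by (auto cong: conj_cong)
  have M: "linear_param n m q g h p = mat n (n + m) (\<lambda>(i, j). M (\<lambda>k. p $ k) i j)" for p
    unfolding linear_param_def
  proof (rule cong_mat)
    fix i j assume "i < n" "j < n + m"
    then show "(case (i, j) of (i, j) \<Rightarrow> \<Sum>k<q. p $ k * (g k * h k) $$ (i, j)) =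
        (case (i, j) of (i, j) \<Rightarrow> M (\<lambda>k. p $ k) i j)"
      using gh by (simp add: M_def mult.assoc del: index_mult_mat)
  qed simp_all
  have dims: "dim_row (A p) = n" "dim_col (A p) = n" "dim_row (B p) = n" "dim_col (B p) = m"
    if "p \<in> carrier_vec q" for p
    using assms(7)[OF that] by auto
  have AB_index: "(A p @\<^sub>c B p) $$ (i, j) = (if j < n then A p $$ (i, j) else B p $$ (i, j - n))"
    if "p \<in> carrier_vec q" "i < n" "j < n + m" for p i j
    using dims[OF that(1)] that(2,3) by (simp add: append_cols_def)
  have A: "A p = A_mat (\<lambda>k. p $ k)" if p: "p \<in> carrier_vec q" for p
  proof (rule eq_matI)
    fix i j assume "i < dim_row (A_mat (\<lambda>k. p $ k))" "j < dim_col (A_mat (\<lambda>k. p $ k))"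
    then have ij: "i < n" "j < n" by (simp_all add: A_mat_def)
    have "A p $$ (i, j) = linear_param n m q g h p $$ (i, j)"
      using AB_index[OF p, of i j] ij assms(8)[OF p] by simp
    then show "A p $$ (i, j) = A_mat (\<lambda>k. p $ k) $$ (i, j)" using ij by (simp add: M A_mat_def)
  qed (simp_all add: A_mat_def dims[OF p])
  have B: "B p = B_mat (\<lambda>k. p $ k)" if p: "p \<in> carrier_vec q" for p
  proof (rule eq_matI)
    fix i l assume "i < dim_row (B_mat (\<lambda>k. p $ k))" "l < dim_col (B_mat (\<lambda>k. p $ k))"
    then have il: "i < n" "l < m" by (simp_all add: B_mat_def)
    have "B p $$ (i, l) = linear_param n m q g h p $$ (i, n + l)"
      using AB_index[OF p, of i "n + l"] il assms(8)[OF p] by simp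
    then show "B p $$ (i, l) = B_mat (\<lambda>k. p $ k) $$ (i, l)" using il by (simp add: M B_mat_def)
  qed (simp_all add: B_mat_def dims[OF p])
  have sc: "structurally_controllable q A B \<longleftrightarrow> (\<exists>p. controllable (A_mat p) (B_mat p))"
  proof
    assume "structurally_controllable q A B"
    then show "\<exists>p. controllable (A_mat p) (B_mat p)"
      unfolding structurally_controllable_def using A B by auto
  next
    assume "\<exists>p. controllable (A_mat p) (B_mat p)"
    then obtain p where p: "controllable (A_mat p) (B_mat p)" by (elim exE)
    \<comment> \<open>Parameter functions and vectors of length \<open>q\<close> agree on the
      indices below \<open>q\<close>, which is all that \<open>M\<close> uses.\<close>
    have "M p = M (\<lambda>k. vec q p $ k)" by (rule M_cong) simp
    then have "A (vec q p) = A_mat p" "B (vec q p) = B_mat p"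
      using A[of "vec q p"] B[of "vec q p"] by (simp_all add: A_mat_def B_mat_def)
    with p show "structurally_controllable q A B"
      unfolding structurally_controllable_def by (intro bexI[of _ "vec q p"]) simp_all
  qed
  have rank: "mat_rank (A p @\<^sub>c B p) \<le> n"
    "mat_rank (A p @\<^sub>c B p) = n \<longleftrightarrow> full_row_rank n (n + m) (M (\<lambda>k. p $ k))"
    if p: "p \<in> carrier_vec q" for p
  proof -
    have c: "A p @\<^sub>c B p \<in> carrier_mat n (n + m)" unfolding assms(8)[OF p] M by simp
    show "mat_rank (A p @\<^sub>c B p) \<le> n" by (rule mat_rank_le[OF c])
    show "mat_rank (A p @\<^sub>c B p) = n \<longleftrightarrow> full_row_rank n (n + m) (M (\<lambda>k. p $ k))"
      unfolding mat_rank_eq_iff_full_row_rank[OF c]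
      by (rule full_row_rank_cong) (simp add: assms(8)[OF p] M)
  qed
  have gr: "generic_rank q (\<lambda>p. A p @\<^sub>c B p) = n \<longleftrightarrow> (\<exists>p. full_row_rank n (n + m) (M p))"
  proof -
    let ?R = "(\<lambda>p. mat_rank (A p @\<^sub>c B p)) ` carrier_vec q"
    have le: "x \<le> n" if "x \<in> ?R" for x using that rank(1) by blast
    have fin: "finite ?R" by (rule finite_subset[of _ "{..n}"]) (use le in auto)
    have "0\<^sub>v q \<in> carrier_vec q" by simp
    then have ne: "?R \<noteq> {}" by blast
    \<comment> \<open>The bound \<open>n\<close> on all ranks makes the set of ranks finite, so the
      maximum is \<open>n\<close> exactly when \<open>n\<close> is attained.\<close>
    have "Max ?R = n \<longleftrightarrow> n \<in> ?R"
      using Max_eq_iff[OF fin ne, of n] le by blast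
    also have "\<dots> \<longleftrightarrow> (\<exists>p. full_row_rank n (n + m) (M p))"
    proof
      assume "n \<in> ?R"
      then obtain p where "p \<in> carrier_vec q" "mat_rank (A p @\<^sub>c B p) = n" by (elim imageE) simp
      then have "full_row_rank n (n + m) (M (\<lambda>k. p $ k))" using rank(2) by simp
      then show "\<exists>p. full_row_rank n (n + m) (M p)"
        by (rule exI[of "\<lambda>p. full_row_rank n (n + m) (M p)"])
    next
      assume "\<exists>p. full_row_rank n (n + m) (M p)"
      then obtain p where p: "full_row_rank n (n + m) (M p)" by (elim exE)
      have "M p = M (\<lambda>k. vec q p $ k)" by (rule M_cong) simp
      with p rank(2)[of "vec q p"] have "mat_rank (A (vec q p) @\<^sub>c B (vec q p)) = n" by simp
      then show "n \<in> ?R" by (intro image_eqI[of _ _ "vec q p"]) simp_all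
    qed
    finally show ?thesis by (simp add: generic_rank_def)
  qed
  have irr: "irreducible_pair n m q A B \<longleftrightarrow>
      irreducible_pair n m q (\<lambda>p. A_mat (\<lambda>k. p $ k)) (\<lambda>p. B_mat (\<lambda>k. p $ k))"
    by (rule irreducible_pair_cong) (fact A, fact B)
  have sc_imp: "(\<exists>p. full_row_rank n (n + m) (M p)) \<and> irreducible_pair n m q A B"
    if controllable: "structurally_controllable q A B"
  proof -
    obtain p where p: "p \<in> carrier_vec q" "controllable (A p) (B p)"
      using controllable unfolding structurally_controllable_def by blast
    have c: "controllable (A_mat (\<lambda>k. p $ k)) (B_mat (\<lambda>k. p $ k))"
      using p(2) unfolding A[OF p(1)] B[OF p(1)] .
    have "\<exists>p. full_row_rank n (n + m) (M p)"
      using controllable_imp_full_row_rank_M[OF c]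
      by (rule exI[of "\<lambda>p. full_row_rank n (n + m) (M p)"])
    moreover have "irreducible_pair n m q A B"
      unfolding irr by (rule controllable_imp_irreducible[OF p(1) c])
    ultimately show ?thesis ..
  qed
  have irr_imp: "all_reachable" if "irreducible_pair n m q A B"
    using that unfolding irr by (rule irreducible_imp_all_reachable)
  have sc_if: "structurally_controllable q A B"
    if "\<exists>p. full_row_rank n (n + m) (M p)" all_reachable
    unfolding sc using that(1) by (elim exE) (rule ex_controllable[OF that(2)])
  have cacti: "(\<exists>S H. spanning S Gr \<and> disjoint_graph_union S {n..<n + m} H \<and>
      (\<forall>r\<in>{n..<n + m}. cactus_graph r (H r))) \<longleftrightarrow> all_reachable"
    if unbalanced: "\<exists>K\<in>similarity_classes m Gr. \<not> balanced_class m K"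
  proof -
    \<comment> \<open>A similarity class is nonempty, and any of its members supplies the trunks and
      cycles for the cacti.\<close>
    obtain K where "K \<in> similarity_classes m Gr" using unbalanced by blast
    from similarity_class_imp_multi_colored_subgraph[OF this]
    obtain S where "multi_colored_subgraph m Gr S" by (elim exE)
    from cacti_iff_forest[OF this] show ?thesis unfolding forest_iff_all_reachable .
  qed
  show ?thesis
    unfolding Gr gr[symmetric] forest_iff_all_reachable
    using sc_imp sc_if irr_imp cacti ex_unbalanced_class_iff gr by argo
qed

end
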